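(* Let $\mathcal{G}(z)=\int_0^1\binom{x}{z}\,dx$ be the Gregory function, and let $Z(\mathcal{G})$ denote its set of zeros in $\mathbb{C}$. Then the following statements hold. (1) The function $\mathcal{G}$ is a real entire function of order $1$, has exponential type $\pi$, and belongs to the Cartwright class. Its Phragm\'en--Lindel\"of indicator is $h_{\mathcal{G}}(\theta)=\pi|\sin\theta|$. (2) Every zero of $\mathcal{G}$ is real and simple. Its zero set is $$Z(\mathcal{G})=\{-1,-2,-3,\ldots\}\cup\{\rho_n:n\ge 1\},$$ where $n<\rho_n<n+1$ for every $n \geq 1$. (3) We have $\frac32<\rho_1<2$, and $n<\rho_n<n+\frac12$ for $n\ge 2$. If $\varepsilon_n:=\rho_n-n$, then $\varepsilon_1>\varepsilon_2>\varepsilon_3>\cdots>0$. (4) The genus-one Hadamard product of $\mathcal{G}$ is $$\mathcal{G}(z)=e^{\gamma z}\prod_{\rho\in Z(\mathcal{G})}\left(1-\frac{z}{\rho}\right)e^{z/\rho}.$$ The paired product $$\mathcal{G}(z)=\prod_{n=1}^{\infty}\left(1+\frac{z}{n}\right)\left(1-\frac{z}{\rho_n}\right)$$ also converges locally uniformly. In particular, $\mathcal{G}$ belongs to the Laguerre--P\'olya class. (5) Euler's constant satisfies $$\gamma=\sum_{n=1}^{\infty}\left(\frac1n-\frac1{\rho_n}\right).$$ (6) As $n\to\infty$, writing $L:=\log n$, we have $$\rho_n-n=\frac1L-\frac{\gamma}{L^2}+\frac{\gamma^2}{L^3}-\frac{\gamma^3+6\zeta(3)}{L^4}+\frac{\gamma^4+24\gamma\zeta(3)+7\pi^4/90}{L^5}+O(L^{-6}).$$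 More generally, $\rho_n-n$ admits a complete asymptotic expansion in inverse powers of $\log n$.
   Context: For $x\in[0,1]$ and $z\in\mathbb{C}$, $\binom{x}{z}=\frac{\Gamma(x+1)}{\Gamma(z+1)\Gamma(x-z+1)}$, where $1/\Gamma$ is understood as an entire function; thus $\mathcal{G}(z)=\frac{1}{\Gamma(z+1)}\int_0^1\frac{\Gamma(x+1)}{\Gamma(x-z+1)}\,dx$ is entire. $\gamma$ is Euler's constant and $\zeta$ is the Riemann zeta function. For an order-one entire function $f$, the Phragm\'en--Lindel\"of indicator is $h_f(\theta)=\limsup_{r\to\infty}r^{-1}\log|f(re^{i\theta})|$. A function $f$ of exponential type is in the Cartwright class if $\int_{-\infty}^{\infty}\frac{\log^+|f(x)|}{1+x^2}\,dx<\infty$. The Laguerre--P\'olya class is the locally uniform closure (on $\mathbb{C}$) of real polynomials having only real zeros. A complete asymptotic expansion in inverse powers of $\log n$ means that there are constants $a_1,a_2,\ldots$ such that for every $K\ge1$, $\rho_n-n=\sum_{k=1}^{K}a_k(\log n)^{-k}+O_K((\log n)^{-K-1})$ as $n\to\infty$. *)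

theory Defs
  imports
    "HOL-Complex_Analysis.Complex_Analysis"
    "HOL-Library.Landau_Symbols"
begin

definition binom :: "real \<Rightarrow> complex \<Rightarrow> complex" where
  "binom x z = of_real (Gamma (x + 1)) * rGamma (z + 1) * rGamma (of_real x - z + 1)"

definition gregory :: "complex \<Rightarrow> complex" where
  "gregory z = integral {0..1} (\<lambda>x. binom x z)"

(* Dirichlet series; it is the Riemann zeta function only for s > 1. *)
definition zeta :: "real \<Rightarrow> real" where
  "zeta s = (\<Sum>n. 1 / real (Suc n) powr s)"

definition zeros :: "(complex \<Rightarrow> complex) \<Rightarrow> complex set" where
  "zeros f = {z. f z = 0}"

definition real_entire :: "(complex \<Rightarrow> complex) \<Rightarrow> bool" where
  "real_entire f \<longleftrightarrow> f holomorphic_on UNIV \<and> (\<forall>z\<in>\<real>. f z \<in> \<real>)"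

(* The library sets ln 0 = 0; with that value, zeros of f tending to infinity along a ray
   would force the indicator to be nonnegative there. *)
definition elog :: "real \<Rightarrow> ereal" where
  "elog x = (if x = 0 then -\<infinity> else ereal (ln x))"

definition max_modulus :: "(complex \<Rightarrow> complex) \<Rightarrow> real \<Rightarrow> real" where
  "max_modulus f r = (SUP z\<in>sphere 0 r. norm (f z))"

(* The infimum of the exponents a with M(r) \<le> exp (r^a) for all large r. For an unbounded
   entire f this is the limsup of log log M(r) / log r; the infimum also covers constants. *)
definition growth_order :: "(complex \<Rightarrow> complex) \<Rightarrow> ereal" where
  "growth_order f =
     Inf {ereal a | a. a \<ge> 0 \<and> (\<forall>\<^sub>F r in at_top. max_modulus f r \<le> exp (r powr a))}"

definition exponential_type :: "(complex \<Rightarrow> complex) \<Rightarrow> ereal" where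
  "exponential_type f = Limsup at_top (\<lambda>r. elog (max_modulus f r) / ereal r)"

definition pl_indicator :: "(complex \<Rightarrow> complex) \<Rightarrow> real \<Rightarrow> ereal" where
  "pl_indicator f \<theta> = Limsup at_top (\<lambda>r. elog (norm (f (of_real r * cis \<theta>))) / ereal r)"

(* ln (max 1 t) is the positive part of log t, also for t = 0. *)
definition cartwright_class :: "(complex \<Rightarrow> complex) set" where
  "cartwright_class = {f. f holomorphic_on UNIV \<and> exponential_type f < \<infinity> \<and>
     integrable lborel (\<lambda>x::real. ln (max 1 (norm (f (of_real x)))) / (1 + x\<^sup>2))}"

definition locally_uniform_limit ::
  "('i \<Rightarrow> complex \<Rightarrow> complex) \<Rightarrow> (complex \<Rightarrow> complex) \<Rightarrow> 'i filter \<Rightarrow> bool" where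
  "locally_uniform_limit F f I \<longleftrightarrow> (\<forall>K. compact K \<longrightarrow> uniform_limit K F f I)"

(* Locally uniform convergence is metrizable, so the closure is given by sequences. *)
definition laguerre_polya_class :: "(complex \<Rightarrow> complex) set" where
  "laguerre_polya_class = {f. \<exists>p :: nat \<Rightarrow> real poly.
     (\<forall>n. zeros (poly (map_poly of_real (p n))) \<subseteq> \<real>) \<and>
     locally_uniform_limit (\<lambda>n. poly (map_poly of_real (p n))) f sequentially}"

(* The two summability conditions say that the canonical product over A has genus exactly one.
   Each zero occurs once, so this is the Hadamard product only if all zeros in A are simple. *)
definition has_genus_one_product ::
  "(complex \<Rightarrow> complex) \<Rightarrow> complex \<Rightarrow> complex set \<Rightarrow> bool" where
  "has_genus_one_product f c A \<longleftrightarrow>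
     (\<lambda>w. 1 / norm w ^ 2) summable_on A \<and> \<not> (\<lambda>w. 1 / norm w) summable_on A \<and>
     locally_uniform_limit
       (\<lambda>F z. exp (c * z) * (\<Prod>w\<in>F. (1 - z / w) * exp (z / w))) f (finite_subsets_at_top A)"

end

theory Submission
  imports Defs "HOL-Probability.Sinc_Integral" "HOL-Real_Asymp.Real_Asymp"
begin

text \<open>
  For \<open>0 \<le> x \<le> 1\<close> the reflection formula turns \<open>G(n + \<epsilon>)\<close> into \<open>(-1)\<^sup>n\<close> times the integral of the
  positive weight \<open>\<Gamma>(1 + x) \<Gamma>(n + \<epsilon> - x) / \<Gamma>(n + \<epsilon> + 1)\<close> against \<open>sin (\<pi> (\<epsilon> - x)) / \<pi>\<close>. This yields a
  zero \<open>\<rho>\<^sub>n\<close> in each interval \<open>(n, n + 1)\<close>; passing from \<open>n\<close> to \<open>n + 1\<close> multiplies the weight by an affine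
  function of \<open>x\<close>, so the sign at \<open>n + 1 + \<epsilon>\<^sub>n\<close> is known and the gaps decrease.

  The product \<open>P\<close> over these zeros and the negative integers differs from \<open>sin (\<pi> z) / (\<pi> z)\<close> by the factors
  \<open>(1 - z / \<rho>\<^sub>n) / (1 - z / n)\<close>. Since \<open>\<bar>1 - z / t\<bar>\<close> first decreases and then increases in \<open>t\<close>, interlacing
  makes this quotient telescope and bounds \<open>P\<close> from below off the real axis. Hence \<open>G / P\<close> is entire of
  polynomial growth, and it is \<open>o(y)\<close> at \<open>i y\<close>, so it is constant. There are thus no further zeros,
  the products and the growth can be read off, and comparing \<open>G'(0) = \<gamma>\<close> with the logarithmic derivative
  of \<open>P\<close> at 0 gives the series for \<open>\<gamma>\<close>.

  Since \<open>\<Gamma>(n + \<epsilon> - x) / \<Gamma>(n + \<epsilon>) = n\<^bsup>-x\<^esup> + O(1/n)\<close>, the angle \<open>\<pi> (\<rho>\<^sub>n - n)\<close> equals, up to \<open>O(log n / n)\<close>, the argument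
  of the Laplace transform of \<open>\<Gamma>(1 + x) exp (i \<pi> x)\<close> over \<open>[0, 1]\<close> at \<open>log n\<close>, which repeated integration by
  parts expands in inverse powers of \<open>log n\<close>.
\<close>

text \<open>Only the zeros found by sign changes are known at first, so the quotient argument has to
  exclude all others. The lower bound for the product degenerates like |Im z| / |z| at the real
  axis, and therefore the quotient is first bounded only after multiplication by (Im z)^2. A maximum
  principle on circles removes this weight at the price of quadratic growth; the linear and
  quadratic terms are then killed along i y. There the termwise bound |binom x (i y)| \<le> |sin (pi
  i y)| / (pi y) gives only O(y) for the quotient. The missing decay comes from the average over x:
  the bound for the integrand also decreases in x, and its integral is of size log H / H with H
  arbitrarily large.

  The half-unit bound on the gaps is needed for the asymptotics too. It is checked at 5/2 and
  inherited by all n \<ge> 2 from the decrease of the gaps, and it keeps the angles in a compact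
  part of [0, pi/2), where the tangent can be inverted. The zero in (1, 2) is exceptional because G
  is positive at 3/2 and negative at 2.\<close>

section \<open>Bounds for quotients of Gamma values\<close>

text \<open>In Euler's limit for Gamma the quotient is a positive factor depending only on x and n
  times a product of terms 1 + x / (w + i) over indices i. Since |w + i| \<ge> u + i, each term is
  bounded by its value at the real point u.\<close>

lemma norm_Gamma_quotient_le:
  fixes w :: complex and u x :: real
  assumes u: "0 < u" "u \<le> Re w" and x: "0 \<le> x"
  shows "norm (Gamma w / Gamma (w + of_real x)) \<le> Gamma u / Gamma (u + x)"
proof -
  have nI: "v \<notin> \<int>\<^sub>\<le>\<^sub>0" if "Re v > 0" for v :: complex using that by (auto elim!: nonpos_Ints_cases)
  have w: "w \<notin> \<int>\<^sub>\<le>\<^sub>0" "w + of_real x \<notin> \<int>\<^sub>\<le>\<^sub>0" using u x by (auto intro!: nI)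
  have ur: "u \<notin> \<int>\<^sub>\<le>\<^sub>0" "u + x \<notin> \<int>\<^sub>\<le>\<^sub>0" using u x by (auto elim!: nonpos_Ints_cases)
  have 1: "(\<lambda>n. norm (Gamma_series w n / Gamma_series (w + of_real x) n)) \<longlonglongrightarrow>
             norm (Gamma w / Gamma (w + of_real x))"
    by (intro tendsto_intros) (use w in \<open>auto simp: Gamma_eq_zero_iff\<close>)
  have 2: "(\<lambda>n. Gamma_series u n / Gamma_series (u + x) n) \<longlonglongrightarrow> Gamma u / Gamma (u + x)"
    by (intro tendsto_intros) (use ur in \<open>auto simp: Gamma_eq_zero_iff\<close>)
  have le: "norm (Gamma_series w n / Gamma_series (w + of_real x) n) \<le> Gamma_series u n / Gamma_series (u + x) n"
    if "n > 0" for n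
  proof -
    have nz: "pochhammer w (n+1) \<noteq> 0" "pochhammer (w + of_real x) (n+1) \<noteq> 0"
      using w by (auto dest: pochhammer_eq_0_imp_nonpos_Int)
    have nz': "pochhammer u (n+1) > 0" "pochhammer (u + x) (n+1) > 0"
      using u x by (auto intro!: pochhammer_pos)
    have "norm (pochhammer (w + of_real x) (n+1) / pochhammer w (n+1)) =
            (\<Prod>i=0..<n+1. norm ((w + of_real x + of_nat i) / (w + of_nat i)))"
      unfolding pochhammer_prod prod_dividef[symmetric] prod_norm[symmetric] ..
    also have "\<dots> \<le> (\<Prod>i=0..<n+1. (u + x + real i) / (u + real i))"
    proof (intro prod_mono conjI norm_ge_zero)
      fix i
      have ui: "u + real i \<le> norm (w + of_nat i)"
        using complex_Re_le_cmod[of "w + of_nat i"] u by simp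
      have "w + of_nat i \<noteq> 0" using ui u by auto
      hence "(w + of_real x + of_nat i) / (w + of_nat i) = 1 + of_real x / (w + of_nat i)"
        by (simp add: field_simps)
      also have "norm \<dots> \<le> 1 + x / norm (w + of_nat i)"
        using norm_triangle_ineq[of 1 "of_real x / (w + of_nat i)"] x by (simp add: norm_divide)
      also have "\<dots> \<le> 1 + x / (u + real i)"
        using ui u x by (intro add_left_mono divide_left_mono mult_pos_pos) auto
      also have "\<dots> = (u + x + real i) / (u + real i)" using u by (simp add: field_simps)
      finally show "norm ((w + of_real x + of_nat i) / (w + of_nat i)) \<le> (u + x + real i) / (u + real i)" .
    qed
    also have "\<dots> = pochhammer (u + x) (n+1) / pochhammer u (n+1)"
      unfolding pochhammer_prod prod_dividef ..
    finally have A: "norm (pochhammer (w + of_real x) (n+1) / pochhammer w (n+1)) \<le>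
        pochhammer (u + x) (n+1) / pochhammer u (n+1)" .
    have e: "Gamma_series w n / Gamma_series (w + of_real x) n =
       of_real (exp (- x * ln (real n))) * (pochhammer (w + of_real x) (n+1) / pochhammer w (n+1))"
      using nz unfolding Gamma_series_def by (simp add: field_simps exp_add exp_minus flip: exp_of_real)
    have e': "Gamma_series u n / Gamma_series (u + x) n =
       exp (- x * ln (real n)) * (pochhammer (u + x) (n+1) / pochhammer u (n+1))"
      using nz' unfolding Gamma_series_def by (simp add: field_simps exp_add exp_minus)
    show ?thesis unfolding e e' norm_mult
      using A by (intro mult_mono) auto
  qed
  show ?thesis
    by (rule tendsto_le[OF _ 2 1]) (auto intro!: eventually_sequentiallyI[of 1] le)
qed

text \<open>The case u = 1, where the reference quotient is 1 / Gamma (1 + x): moving right by x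
  shrinks the reciprocal Gamma function enough to absorb the factor Gamma (1 + x) of
  \<open>binom\<close>.\<close>

lemma norm_rGamma_add_le:
  fixes w :: complex and x :: real
  assumes w: "1 \<le> Re w" and x: "0 \<le> x"
  shows "Gamma (1 + x) * norm (rGamma (w + of_real x)) \<le> norm (rGamma w)"
proof -
  have ni: "w \<notin> \<int>\<^sub>\<le>\<^sub>0" using w by (auto elim!: nonpos_Ints_cases)
  have p: "Gamma (1 + x) > 0" using x by simp
  have "norm (Gamma w) * norm (rGamma (w + of_real x)) \<le> 1 / Gamma (1 + x)"
    using norm_Gamma_quotient_le[of 1 w x] w x
    by (simp add: rGamma_inverse_Gamma divide_inverse norm_mult norm_inverse)
  moreover have "norm (Gamma w) > 0" using ni by (simp add: Gamma_eq_zero_iff)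
  ultimately have "Gamma (1 + x) * norm (rGamma (w + of_real x)) \<le> 1 / norm (Gamma w)"
    using p by (simp add: field_simps)
  also have "1 / norm (Gamma w) = norm (rGamma w)"
    by (simp add: rGamma_inverse_Gamma norm_inverse divide_inverse)
  finally show ?thesis .
qed

lemma norm_sin_le_exp: "norm (sin z) \<le> exp \<bar>Im z\<bar>" for z :: complex
proof -
  have "norm (exp (\<i> * z) - exp (- (\<i> * z))) \<le> exp \<bar>Im z\<bar> + exp \<bar>Im z\<bar>"
    by (rule order.trans[OF norm_triangle_ineq4]) (cases "Im z \<ge> 0"; simp add: norm_exp_eq_Re; smt (verit) exp_le_cancel_iff)
  thus ?thesis by (simp add: sin_exp_eq norm_divide norm_mult)
qed

lemma norm_sin_ge_sinh: "norm (sin z) \<ge> sinh \<bar>Im z\<bar>" for z :: complex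
proof -
  have "exp \<bar>Im z\<bar> - exp (-\<bar>Im z\<bar>) \<le> norm (exp (\<i> * z) - exp (- (\<i> * z)))"
  proof (cases "Im z \<ge> 0")
    case True
    thus ?thesis using norm_triangle_ineq2[of "exp (- (\<i> * z))" "exp (\<i> * z)"]
      by (simp add: norm_exp_eq_Re norm_minus_commute)
  next
    case False
    thus ?thesis using norm_triangle_ineq2[of "exp (\<i> * z)" "exp (- (\<i> * z))"]
      by (simp add: norm_exp_eq_Re)
  qed
  thus ?thesis by (simp add: sin_exp_eq norm_divide norm_mult sinh_def)
qed

lemma rGamma_add_mult_rGamma_minus:
  "z * (rGamma (1 + z) * rGamma (1 - z)) = sin (of_real pi * z) / of_real pi" for z :: complex
  using rGamma_reflection_complex[of z] rGamma_plus1[of z] by (simp add: add.commute mult.assoc[symmetric])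

text \<open>In the left half-plane 1 - z has real part at least 1. For nonzero z the second bound is
  |sin (pi z) / (pi z)|; the first one retains the dependence on x from which additional decay on
  the imaginary axis is extracted.\<close>

lemma norm_binom_le_left:
  assumes "x \<in> {0..1}" "Re z \<le> 0"
  shows "norm (binom x z) \<le> norm (rGamma (1 + z)) * (Gamma (1 + x) * norm (rGamma (1 - z + of_real x)))"
    and "norm (binom x z) \<le> norm (rGamma (1 + z) * rGamma (1 - z))"
proof -
  have "norm (binom x z) = norm (rGamma (1 + z)) * (Gamma (1 + x) * norm (rGamma (1 - z + of_real x)))"
    using assms unfolding binom_def by (simp add: norm_mult algebra_simps)
  thus "norm (binom x z) \<le> norm (rGamma (1 + z)) * (Gamma (1 + x) * norm (rGamma (1 - z + of_real x)))"
    by simp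
  also have "\<dots> \<le> norm (rGamma (1 + z)) * norm (rGamma (1 - z))"
    using assms by (intro mult_left_mono norm_rGamma_add_le) auto
  finally show "norm (binom x z) \<le> norm (rGamma (1 + z) * rGamma (1 - z))" by (simp add: norm_mult)
qed

text \<open>From Re z \<le> 2 one gets only Re (3 - z) \<ge> 1, so two factors w (w + 1) are pulled
  out of the reciprocal Gamma function to reach 3 - z + x. They are compensated by the three factors
  z (1 - z) (2 - z) that turn the remaining Gamma product into a sine.\<close>

lemma norm_binom_le_sin:
  assumes x: "x \<in> {0..1}" and z: "Re z \<le> 2" "norm z \<ge> 3"
  shows "norm (binom x z) \<le> 2 * norm (sin (of_real pi * z))"
proof -
  define r where "r = norm z"
  define w where "w = 1 + of_real x - z"
  define A where "A = norm (rGamma (1 + z) * rGamma (3 - z))"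
  have r: "r \<ge> 3" using z by (simp add: r_def)
  have w2: "norm w \<le> r + 2" "norm (w + 1) \<le> r + 3"
  proof -
    have "norm w \<le> norm (1 + of_real x :: complex) + norm z" unfolding w_def by (rule norm_triangle_ineq4)
    also have "norm (1 + of_real x :: complex) = norm (of_real (1 + x) :: complex)" by simp
    also have "\<dots> = 1 + x" unfolding norm_of_real using x by simp
    finally show "norm w \<le> r + 2" using x by (simp add: r_def)
    thus "norm (w + 1) \<le> r + 3" using norm_triangle_ineq[of w 1] by simp
  qed
  have "r * (r - 1) * (r - 2) * A \<le> norm z * norm (1 - z) * norm (2 - z) * A"
    using r norm_triangle_ineq2[of z 1] norm_triangle_ineq2[of z 2]
    by (intro mult_right_mono mult_mono) (auto simp: A_def r_def norm_minus_commute)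
  also have "norm z * norm (1 - z) * norm (2 - z) * A = norm (z * (rGamma (1 + z) * ((1 - z) * ((2 - z) * rGamma (3 - z)))))"
    by (simp add: A_def norm_mult)
  also have "(2 - z) * rGamma (3 - z) = rGamma (2 - z)"
    using rGamma_plus1[of "2 - z"] by (simp add: algebra_simps)
  also have "(1 - z) * rGamma (2 - z) = rGamma (1 - z)"
    using rGamma_plus1[of "1 - z"] by (simp add: algebra_simps)
  also have "norm (z * (rGamma (1 + z) * rGamma (1 - z))) = norm (sin (of_real pi * z)) / pi"
    unfolding rGamma_add_mult_rGamma_minus by (simp add: norm_divide)
  finally have q: "r * (r - 1) * (r - 2) * A \<le> norm (sin (of_real pi * z)) / pi" by (simp add: mult.assoc)
  have "rGamma w = w * (w + 1) * rGamma (w + 2)"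
    using rGamma_plus1[of w] rGamma_plus1[of "w + 1"] by (simp add: add.assoc mult.assoc)
  moreover have "w + 2 = (3 - z) + of_real x" by (simp add: w_def)
  moreover have "binom x z = of_real (Gamma (1 + x)) * rGamma (1 + z) * rGamma w"
    by (simp add: binom_def w_def algebra_simps)
  ultimately have "norm (binom x z) = norm w * norm (w + 1) * (norm (rGamma (1 + z)) * (Gamma (1 + x) * norm (rGamma ((3 - z) + of_real x))))"
    using x by (simp add: norm_mult)
  also have "\<dots> \<le> ((r + 2) * (r + 3)) * (norm (rGamma (1 + z)) * norm (rGamma (3 - z)))"
    using x z r w2 by (intro mult_mono norm_rGamma_add_le mult_nonneg_nonneg) auto
  also have "\<dots> = ((r + 2) * (r + 3)) * A" by (simp add: A_def norm_mult)
  also have "\<dots> \<le> (5 * (r * (r - 1) * (r - 2))) * A"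
  proof (rule mult_right_mono)
    \<comment> \<open>Equality holds at r = 3, which explains the constant 5 and the linear factor r
      - 3.\<close>
    have "5 * (r * (r - 1) * (r - 2)) - (r + 2) * (r + 3) = (r - 3) * (5 * r\<^sup>2 - r + 2)"
      by (simp add: power2_eq_square algebra_simps)
    moreover have "5 * r\<^sup>2 - r + 2 \<ge> 0"
    proof -
      have "r * 1 \<le> r * (5 * r)" using r by (intro mult_left_mono) auto
      thus ?thesis by (simp add: power2_eq_square)
    qed
    ultimately show "(r + 2) * (r + 3) \<le> 5 * (r * (r - 1) * (r - 2))"
      using r by (smt (verit) mult_nonneg_nonneg)
  qed (auto simp: A_def)
  also have "\<dots> = 5 * (r * (r - 1) * (r - 2) * A)" by simp
  also have "\<dots> \<le> 5 * (norm (sin (of_real pi * z)) / pi)" using q by simp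
  also have "\<dots> = (5 / pi) * norm (sin (of_real pi * z))" by simp
  also have "\<dots> \<le> 2 * norm (sin (of_real pi * z))"
    using pi_gt3 by (intro mult_right_mono) (auto simp: field_simps)
  finally show ?thesis .
qed

lemma binom_eq_sin:
  "binom x z = of_real (Gamma (x + 1)) * rGamma (z + 1) * Gamma (z - of_real x) *
     sin (of_real pi * (z - of_real x)) / of_real pi"
  if "Re z > x"
proof -
  have ni: "z - of_real x \<notin> \<int>\<^sub>\<le>\<^sub>0" using that by (auto elim!: nonpos_Ints_cases simp: complex_eq_iff)
  have "rGamma (z - of_real x) \<noteq> 0" using ni by (auto simp: rGamma_inverse_Gamma Gamma_eq_zero_iff)
  moreover have "rGamma (z - of_real x) * rGamma (1 - (z - of_real x)) = sin (of_real pi * (z - of_real x)) / of_real pi"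
    by (rule rGamma_reflection_complex)
  ultimately have "rGamma (1 - (z - of_real x)) = Gamma (z - of_real x) * sin (of_real pi * (z - of_real x)) / of_real pi"
    by (simp add: Gamma_def field_simps)
  moreover have "of_real x - z + 1 = 1 - (z - of_real x)" by simp
  ultimately show ?thesis
    unfolding binom_def by (simp only:) simp
qed

lemma norm_binom_le_right:
  assumes x: "x \<in> {0..1}" and z: "Re z \<ge> 2"
  shows "norm (binom x z) \<le> exp (pi * \<bar>Im z\<bar>)"
proof -
  define v where "v = z - of_real x"
  have v: "Re v \<ge> 1" using x z by (simp add: v_def)
  have vn: "norm v \<ge> 1" using v complex_Re_le_cmod[of v] by linarith
  have ni: "v \<notin> \<int>\<^sub>\<le>\<^sub>0" using v by (auto elim!: nonpos_Ints_cases simp: complex_eq_iff)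
  have G: "Gamma (v + 1) = v * Gamma v" using ni by (rule Gamma_plus1)
  have pos: "Gamma (1 + x) > 0" using x by simp
  \<comment> \<open>Since |v| \<ge> 1, replacing Gamma v by Gamma (v + 1) is allowed, and z + 1 = v
    + 1 + x is then exactly the shift in the quotient bound.\<close>
  have "norm (Gamma v) * norm (rGamma (z + 1)) \<le> norm (Gamma (v + 1)) * norm (rGamma (z + 1))"
    unfolding G norm_mult using vn by (intro mult_right_mono) (auto simp: mult_le_cancel_right1)
  also have "\<dots> = norm (Gamma (v + 1) / Gamma (v + 1 + of_real x))"
    by (simp add: v_def rGamma_inverse_Gamma norm_mult norm_inverse divide_inverse)
  also have "\<dots> \<le> Gamma 1 / Gamma (1 + x)"
    using v x by (intro norm_Gamma_quotient_le) auto
  finally have 1: "Gamma (1 + x) * (norm (Gamma v) * norm (rGamma (z + 1))) \<le> 1"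
    using pos by (simp add: field_simps)
  have "norm (binom x z) = Gamma (1 + x) * (norm (Gamma v) * norm (rGamma (z + 1))) * norm (sin (of_real pi * v)) / pi"
    using x z by (subst binom_eq_sin) (auto simp: norm_mult norm_divide v_def algebra_simps)
  also have "\<dots> \<le> 1 * norm (sin (of_real pi * v)) / 1"
    using 1 pi_ge_two pos by (intro frac_le mult_right_mono) auto
  also have "\<dots> \<le> exp (pi * \<bar>Im z\<bar>)"
    using norm_sin_le_exp[of "of_real pi * v"] by (simp add: v_def abs_mult)
  finally show ?thesis .
qed

lemma continuous_on_rGamma_compose [continuous_intros]:
  "continuous_on A f \<Longrightarrow> continuous_on A (\<lambda>x. rGamma (f x :: complex))"
  by (rule continuous_on_compose2[OF continuous_on_rGamma[of UNIV]]) auto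

lemma continuous_on_Gamma_compose:
  "continuous_on A f \<Longrightarrow> (\<And>x. x \<in> A \<Longrightarrow> f x > 0) \<Longrightarrow> continuous_on A (\<lambda>x. Gamma (f x :: real))"
  by (rule continuous_on_compose2[OF continuous_on_Gamma[of "{0<..}"]])
     (auto elim!: nonpos_Ints_cases)

lemma continuous_on_binom: "continuous_on {0..1} (\<lambda>x. binom x z)"
  unfolding binom_def by (intro continuous_intros continuous_on_Gamma_compose) auto

lemma integrable_binom: "(\<lambda>x. binom x z) integrable_on {0..1}"
  by (intro integrable_continuous_interval continuous_on_binom)

section \<open>The Gregory function as an entire function of exponential type\<close>

lemma norm_gregory_le:
  assumes "\<And>x. x \<in> {0..1} \<Longrightarrow> norm (binom x z) \<le> B"
  shows "norm (gregory z) \<le> B"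
proof -
  have "norm (gregory z) \<le> integral {0..1} (\<lambda>x::real. B)"
    unfolding gregory_def using assms
    by (intro integral_norm_bound_integral integrable_binom) auto
  thus ?thesis by simp
qed

text \<open>The derivative is kept as an explicit integral because it will be evaluated at
  0.\<close>

lemma gregory_has_field_derivative:
  "(gregory has_field_derivative integral {0..1} (\<lambda>x. of_real (Gamma (x + 1)) *
      (deriv rGamma (z + 1) * rGamma (of_real x - z + 1) - rGamma (z + 1) * deriv rGamma (of_real x - z + 1)))) (at z)"
proof -
  have d: "(rGamma has_field_derivative deriv rGamma w) (at w within S)" for w :: complex and S
    using field_differentiable_rGamma[of w UNIV]
    by (metis DERIV_deriv_iff_field_differentiable has_field_derivative_at_within)
  have cd: "continuous_on S (deriv rGamma)" for S :: "complex set"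
  proof -
    have "deriv rGamma holomorphic_on (UNIV::complex set)"
      by (intro holomorphic_deriv holomorphic_rGamma) auto
    thus ?thesis by (meson continuous_on_subset holomorphic_on_imp_continuous_on subset_UNIV)
  qed
  define g' :: "complex \<Rightarrow> real \<Rightarrow> complex" where "g' = (\<lambda>z x. of_real (Gamma (x + 1)) *
    (deriv rGamma (z + 1) * rGamma (of_real x - z + 1) - rGamma (z + 1) * deriv rGamma (of_real x - z + 1)))"
  have "((\<lambda>z. integral (cbox 0 1) (\<lambda>x. binom x z)) has_field_derivative integral (cbox 0 1) (g' z)) (at z within UNIV)"
  proof (rule leibniz_rule_field_derivative)
    show "((\<lambda>z. binom x z) has_field_derivative g' z x) (at z within UNIV)" for z x
    proof -
      have 1: "((\<lambda>z. rGamma (z + 1)) has_field_derivative deriv rGamma (z + 1) * 1) (at z within UNIV)"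
        by (rule DERIV_chain2[OF d]) (auto intro!: derivative_eq_intros)
      have 2: "((\<lambda>z. rGamma (of_real x - z + 1)) has_field_derivative
                 deriv rGamma (of_real x - z + 1) * (-1)) (at z within UNIV)"
        by (rule DERIV_chain2[OF d]) (auto intro!: derivative_eq_intros)
      show ?thesis
        using DERIV_cmult[OF DERIV_mult[OF 1 2], of "of_real (Gamma (x + 1))"]
        unfolding binom_def g'_def by (simp add: algebra_simps)
    qed
    show "continuous_on (UNIV \<times> cbox 0 1) (\<lambda>(z, x). g' z x)"
      unfolding g'_def split_beta
      by (intro continuous_intros continuous_on_Gamma_compose continuous_on_compose2[OF cd[of UNIV]]) auto
  qed (use integrable_binom in auto)
  moreover have "gregory = (\<lambda>z. integral (cbox 0 1) (\<lambda>x. binom x z))"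
    by (simp add: fun_eq_iff gregory_def)
  ultimately show ?thesis by (simp add: g'_def)
qed

lemma holomorphic_gregory: "gregory holomorphic_on A"
  using gregory_has_field_derivative
  by (meson field_differentiable_def has_field_derivative_at_within holomorphic_onI)

lemma gregory_0 [simp]: "gregory 0 = 1"
proof -
  have "binom x 0 = 1" if "x \<in> {0..1}" for x
  proof -
    have "Gamma (x + 1) \<noteq> 0" using that by (intro less_imp_neq[symmetric]) simp
    moreover have "rGamma (of_real x - 0 + 1) = complex_of_real (rGamma (x + 1))"
      using rGamma_complex_of_real[of "x + 1"] by simp
    ultimately show ?thesis by (simp add: binom_def rGamma_inverse_Gamma)
  qed
  hence "gregory 0 = integral {0..1} (\<lambda>x::real. 1)" unfolding gregory_def by (intro integral_cong) auto
  thus ?thesis by simp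
qed

lemma norm_gregory_le_sin:
  assumes "Re z \<le> 2" "norm z \<ge> 3"
  shows "norm (gregory z) \<le> 2 * norm (sin (of_real pi * z))"
  by (intro norm_gregory_le norm_binom_le_sin assms)

lemma gregory_exp_bound:
  obtains C where "C > 0" "\<And>z. norm (gregory z) \<le> C * exp (pi * \<bar>Im z\<bar>)"
proof -
  have "compact (gregory ` cball 0 3)"
    by (intro compact_continuous_image holomorphic_on_imp_continuous_on holomorphic_gregory) auto
  then obtain B where B: "B > 0" "\<And>z. norm z \<le> 3 \<Longrightarrow> norm (gregory z) \<le> B"
    by (metis bounded_pos compact_imp_bounded image_eqI mem_cball_0)
  define C where "C = max B 2"
  have "norm (gregory z) \<le> C * exp (pi * \<bar>Im z\<bar>)" for z
  proof (cases "norm z \<le> 3")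
    case True
    have "norm (gregory z) \<le> C * 1" using B(2)[OF True] by (simp add: C_def)
    also have "\<dots> \<le> C * exp (pi * \<bar>Im z\<bar>)" by (intro mult_left_mono) (auto simp: C_def)
    finally show ?thesis .
  next
    case False
    have "norm (gregory z) \<le> 2 * exp (pi * \<bar>Im z\<bar>)"
    proof (cases "Re z \<le> 2")
      case True
      have "norm (gregory z) \<le> 2 * norm (sin (of_real pi * z))"
        using False True by (intro norm_gregory_le_sin) auto
      also have "norm (sin (of_real pi * z)) \<le> exp (pi * \<bar>Im z\<bar>)"
        using norm_sin_le_exp[of "of_real pi * z"] by (simp add: abs_mult)
      finally show ?thesis by simp
    next
      case False
      hence "norm (gregory z) \<le> exp (pi * \<bar>Im z\<bar>)"
        by (intro norm_gregory_le norm_binom_le_right) auto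
      thus ?thesis using exp_gt_zero[of "pi * \<bar>Im z\<bar>"] by linarith
    qed
    also have "\<dots> \<le> C * exp (pi * \<bar>Im z\<bar>)" by (intro mult_right_mono) (auto simp: C_def)
    finally show ?thesis .
  qed
  with that[of C] show ?thesis by (simp add: C_def)
qed

section \<open>Sign changes on the positive real axis\<close>

lemma Gamma_quotient_antimono:
  fixes u v x :: real
  assumes "0 < u" "u \<le> v" "0 \<le> x"
  shows "Gamma v / Gamma (v + x) \<le> Gamma u / Gamma (u + x)"
proof -
  have "norm (Gamma (of_real v) / Gamma (of_real v + of_real x :: complex)) = Gamma v / Gamma (v + x)"
    using assms Gamma_complex_of_real[of "v + x"] by (simp add: norm_divide Gamma_complex_of_real)
  thus ?thesis using norm_Gamma_quotient_le[of u "of_real v" x] assms by simp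
qed

lemma integral_pos_continuous:
  fixes f :: "real \<Rightarrow> real"
  assumes "continuous_on {0..1} f" "\<And>x. x \<in> {0..1} \<Longrightarrow> f x \<ge> 0" "f c > 0" "c \<in> {0..1}"
  shows "integral {0..1} f > 0"
proof -
  have int: "f integrable_on {0..1}" using assms(1) by (rule integrable_continuous_interval)
  have "integral {0..1} f \<ge> 0" by (rule integral_nonneg[OF int assms(2)])
  moreover have "integral {0..1} f \<noteq> 0"
  proof
    assume "integral {0..1} f = 0"
    hence "(f has_integral 0) (cbox 0 1)" using int by (metis cbox_interval has_integral_integral)
    hence "f c = 0"
      by (rule has_integral_0_cbox_imp_0[rotated 2]) (use assms in auto)
    thus False using assms by simp
  qed
  ultimately show ?thesis by simp
qed

section \<open>Restriction to the real axis\<close>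

lemma continuous_on_rGamma_real_compose [continuous_intros]:
  "continuous_on A f \<Longrightarrow> continuous_on A (\<lambda>x. rGamma (f x :: real))"
  by (rule continuous_on_compose2[OF continuous_on_rGamma[of UNIV]]) auto

definition binom_real :: "real \<Rightarrow> real \<Rightarrow> real" where
  "binom_real x s = Gamma (x + 1) * rGamma (s + 1) * rGamma (x - s + 1)"

definition gregory_real :: "real \<Rightarrow> real" where
  "gregory_real s = integral {0..1} (\<lambda>x. binom_real x s)"

lemma continuous_on_binom_real: "continuous_on {0..1} (\<lambda>x. binom_real x s)"
  unfolding binom_real_def by (intro continuous_intros continuous_on_Gamma_compose) auto

lemma binom_of_real: "binom x (of_real s) = of_real (binom_real x s)"
  using rGamma_complex_of_real[of "s + 1"] rGamma_complex_of_real[of "x - s + 1"]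
  by (simp add: binom_def binom_real_def)

lemma gregory_of_real: "gregory (of_real s) = of_real (gregory_real s)"
proof -
  have "((\<lambda>x. binom_real x s) has_integral gregory_real s) {0..1}"
    unfolding gregory_real_def
    by (intro integrable_integral integrable_continuous_interval continuous_on_binom_real)
  hence "((\<lambda>x. complex_of_real (binom_real x s)) has_integral of_real (gregory_real s)) {0..1}"
    by (rule has_integral_of_real)
  thus ?thesis unfolding gregory_def binom_of_real by (rule integral_unique)
qed

lemma gregory_real_eq_0_iff: "gregory_real s = 0 \<longleftrightarrow> gregory (of_real s) = 0"
  by (simp add: gregory_of_real)

lemma continuous_on_gregory_real: "continuous_on A gregory_real"
proof -
  have "continuous_on A (\<lambda>s. Re (gregory (of_real s)))"
    by (intro continuous_intros continuous_on_compose2[OF holomorphic_on_imp_continuous_on[OF holomorphic_gregory[of UNIV]]]) auto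
  thus ?thesis by (simp add: gregory_of_real)
qed

lemma gregory_neg_nat: "n \<ge> 1 \<Longrightarrow> gregory (- of_nat n) = 0"
proof -
  assume n: "n \<ge> 1"
  have "rGamma (- of_nat n + 1 :: complex) = 0"
  proof -
    have "- of_nat n + 1 = (- of_nat (n - 1) :: complex)" using n by (simp add: of_nat_diff)
    thus ?thesis by (auto simp: rGamma_eq_zero_iff)
  qed
  thus ?thesis unfolding gregory_def binom_def by simp
qed

definition gweight :: "real \<Rightarrow> real \<Rightarrow> real" where
  "gweight s x = Gamma (1 + x) * Gamma (s - x) / Gamma (s + 1)"

lemma gweight_pos: "x \<in> {0..1} \<Longrightarrow> s > 1 \<Longrightarrow> gweight s x > 0"
  unfolding gweight_def by (intro divide_pos_pos mult_pos_pos Gamma_real_pos) auto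

lemma continuous_on_gweight: "s > 1 \<Longrightarrow> continuous_on {0..1} (gweight s)"
  unfolding gweight_def[abs_def]
  by (intro continuous_intros continuous_on_Gamma_compose) (auto intro!: Gamma_real_pos less_imp_neq[symmetric])

lemma gweight_plus1:
  assumes "x \<in> {0..1}" "s > 1"
  shows "gweight (s + 1) x = gweight s x * (s - x) / (s + 1)"
proof -
  have "Gamma ((s - x) + 1) = (s - x) * Gamma (s - x)" "Gamma ((s + 1) + 1) = (s + 1) * Gamma (s + 1)"
    using assms by (intro Gamma_plus1; auto elim!: nonpos_Ints_cases)+
  moreover have "s + 1 - x = s - x + 1" by simp
  ultimately show ?thesis unfolding gweight_def by (simp only:) (simp add: mult_ac)
qed

lemma binom_real_eq_gweight:
  assumes "x \<in> {0..1}" "s > 1"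
  shows "binom_real x s = gweight s x * sin (pi * (s - x)) / pi"
proof -
  have r: "Gamma (complex_of_real s - of_real x) = of_real (Gamma (s - x))"
    "rGamma (complex_of_real s + 1) = of_real (rGamma (s + 1))"
    "sin (complex_of_real pi * (of_real s - of_real x)) = of_real (sin (pi * (s - x)))"
    using Gamma_complex_of_real[of "s - x"] rGamma_complex_of_real[of "s + 1"] sin_of_real[of "pi * (s - x)", where 'a = complex]
    by simp_all
  have "complex_of_real (binom_real x s) = of_real (Gamma (x + 1) * rGamma (s + 1) * Gamma (s - x) * sin (pi * (s - x)) / pi)"
    using assms unfolding binom_of_real[symmetric]
    by (subst binom_eq_sin) (simp_all only: r of_real_mult of_real_divide, auto)
  hence "binom_real x s = Gamma (x + 1) * rGamma (s + 1) * Gamma (s - x) * sin (pi * (s - x)) / pi"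
    by (simp only: of_real_eq_iff)
  thus ?thesis by (simp add: gweight_def rGamma_inverse_Gamma divide_inverse add.commute)
qed

definition gmoment :: "nat \<Rightarrow> real \<Rightarrow> real" where
  "gmoment n e = integral {0..1} (\<lambda>x. gweight (real n + e) x * sin (pi * (e - x)))"

lemma sin_pi_nat_add: "sin (pi * (real n + t)) = (-1) ^ n * sin (pi * t)"
proof -
  have "sin (pi * (real n + t)) = sin (pi * t + real n * pi)" by (simp add: algebra_simps)
  also have "\<dots> = (-1) ^ n * sin (pi * t)" by (subst sin_add) (simp add: cos_npi sin_npi)
  finally show ?thesis .
qed

lemma gregory_real_eq_gmoment:
  assumes "real n + e > 1"
  shows "gregory_real (real n + e) = (-1) ^ n / pi * gmoment n e"
proof -
  have "binom_real x (real n + e) = (-1) ^ n / pi * (gweight (real n + e) x * sin (pi * (e - x)))"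
    if "x \<in> {0..1}" for x
    using binom_real_eq_gweight[OF that assms] sin_pi_nat_add[of n "e - x"] by (simp add: add_diff_eq)
  hence "gregory_real (real n + e) = integral {0..1} (\<lambda>x. (-1) ^ n / pi * (gweight (real n + e) x * sin (pi * (e - x))))"
    unfolding gregory_real_def by (intro integral_cong) auto
  thus ?thesis by (simp add: gmoment_def)
qed

text \<open>At e = 0 the sine is -sin (pi x), of constant sign on the unit interval. The case n = 1
  is left out because the weight contains Gamma (n - x), with a pole at x = 1; the interval (1, 2)
  is treated through the point 3/2 instead.\<close>

lemma gmoment_0_neg:
  assumes "n \<ge> 2"
  shows "gmoment n 0 < 0"
proof -
  have n: "real n > 1" using assms by simp
  have "integral {0..1} (\<lambda>x. gweight (real n) x * sin (pi * x)) > 0"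
  proof (rule integral_pos_continuous[where c = "1/2"])
    show "continuous_on {0..1} (\<lambda>x. gweight (real n) x * sin (pi * x))"
      by (intro continuous_intros continuous_on_gweight n)
    show "gweight (real n) x * sin (pi * x) \<ge> 0" if "x \<in> {0..1}" for x
      using that n by (intro mult_nonneg_nonneg[OF less_imp_le[OF gweight_pos]] sin_ge_zero) auto
    show "gweight (real n) (1/2) * sin (pi * (1/2)) > 0"
      using n by (intro mult_pos_pos gweight_pos sin_gt_zero) auto
  qed auto
  moreover have "gmoment n 0 = - integral {0..1} (\<lambda>x. gweight (real n) x * sin (pi * x))"
    unfolding gmoment_def by simp
  ultimately show ?thesis by simp
qed

lemma mult_sin_pi_nonneg: "\<bar>t\<bar> \<le> 1 \<Longrightarrow> t * sin (pi * t) \<ge> 0" for t :: real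
proof (cases "t \<ge> 0")
  case True
  assume "\<bar>t\<bar> \<le> 1"
  thus ?thesis using True by (intro mult_nonneg_nonneg sin_ge_zero) auto
next
  case False
  assume "\<bar>t\<bar> \<le> 1"
  hence "pi * (- t) \<le> pi * 1" "0 \<le> pi * (- t)"
    using False by (intro mult_left_mono mult_nonneg_nonneg; simp)+
  hence "sin (pi * (- t)) \<ge> 0" by (intro sin_ge_zero) auto
  thus ?thesis using False by (intro mult_nonpos_nonpos) auto
qed

text \<open>The affine factor s - x is split as (e - x) + n. The constant n reproduces the vanishing
  \<open>gmoment n e\<close>, and (e - x) sin (pi (e - x)) is nonnegative for |e - x| \<le>
  1.\<close>

lemma gmoment_Suc_pos:
  assumes n: "n \<ge> 1" and e: "0 < e" "e < 1" and z: "gmoment n e = 0"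
  shows "gmoment (Suc n) e > 0"
proof -
  define s where "s = real n + e"
  have s: "s > 1" using n e by (simp add: s_def)
  have cont: "continuous_on {0..1} (\<lambda>x. gweight s x * sin (pi * (e - x)))"
    "continuous_on {0..1} (\<lambda>x. gweight s x * ((e - x) * sin (pi * (e - x))))"
    by (intro continuous_intros continuous_on_gweight s)+
  have pos: "integral {0..1} (\<lambda>x. gweight s x * ((e - x) * sin (pi * (e - x)))) > 0"
  proof (rule integral_pos_continuous[where c = 0])
    show "gweight s x * ((e - x) * sin (pi * (e - x))) \<ge> 0" if "x \<in> {0..1}" for x
      using that e s by (intro mult_nonneg_nonneg[OF less_imp_le[OF gweight_pos]] mult_sin_pi_nonneg) auto
    show "gweight s 0 * ((e - 0) * sin (pi * (e - 0))) > 0"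
      using e s by (intro mult_pos_pos gweight_pos sin_gt_zero) auto
  qed (use cont in auto)
  have "gmoment (Suc n) e = integral {0..1} (\<lambda>x. 1 / (s + 1) * (gweight s x * ((e - x) * sin (pi * (e - x))))
          + real n / (s + 1) * (gweight s x * sin (pi * (e - x))))"
    unfolding gmoment_def
  proof (intro integral_cong)
    fix x :: real assume x: "x \<in> {0..1}"
    have "gweight (real (Suc n) + e) x = gweight s x * (s - x) / (s + 1)"
      using gweight_plus1[OF x s] by (simp add: s_def add_ac)
    hence "gweight (real (Suc n) + e) x * sin (pi * (e - x)) = gweight s x * ((e - x) + real n) / (s + 1) * sin (pi * (e - x))"
      by (simp add: s_def add_ac add_diff_eq)
    thus "gweight (real (Suc n) + e) x * sin (pi * (e - x)) = 1 / (s + 1) * (gweight s x * ((e - x) * sin (pi * (e - x))))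
          + real n / (s + 1) * (gweight s x * sin (pi * (e - x)))"
      by (simp add: algebra_simps add_divide_distrib diff_divide_distrib)
  qed
  also have "\<dots> = 1 / (s + 1) * integral {0..1} (\<lambda>x. gweight s x * ((e - x) * sin (pi * (e - x))))
                  + real n / (s + 1) * gmoment n e"
    unfolding gmoment_def s_def[symmetric]
    using s by (subst integral_add) (auto intro!: integrable_continuous_interval continuous_intros continuous_on_gweight)
  also have "\<dots> > 0" using pos s z by simp
  finally show ?thesis .
qed

lemma gregory_real_zero_between:
  assumes "a < b" "gregory_real a * gregory_real b < 0"
  shows "\<exists>c. a < c \<and> c < b \<and> gregory_real c = 0"
proof -
  have "\<exists>c. a \<le> c \<and> c \<le> b \<and> gregory_real c = 0"
  proof (cases "gregory_real a < 0")
    case True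
    hence "gregory_real b > 0" using assms by (simp add: mult_less_0_iff)
    thus ?thesis using True assms by (intro IVT' continuous_on_gregory_real) auto
  next
    case False
    hence "gregory_real a > 0" "gregory_real b < 0" using assms by (auto simp: mult_less_0_iff)
    thus ?thesis using assms by (intro IVT2' continuous_on_gregory_real) auto
  qed
  thus ?thesis using assms by (metis less_irrefl mult_zero_left mult_zero_right order_le_less)
qed

text \<open>This yields some zero with a smaller gap. That it is the chosen zero of the next
  interval can be said only when all zeros are known, by
  \<open>gregory_real_zero_unique\<close>.\<close>

lemma gregory_real_zero_next:
  assumes "n \<ge> 1" "0 < e" "e < 1" "gregory_real (real n + e) = 0"
  shows "\<exists>c. real (Suc n) < c \<and> c < real (Suc n) + e \<and> gregory_real c = 0"
proof (rule gregory_real_zero_between)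
  have "gmoment n e = 0" using gregory_real_eq_gmoment[of n e] assms by simp
  hence "gmoment (Suc n) e > 0" using assms by (intro gmoment_Suc_pos) auto
  moreover have "gmoment (Suc n) 0 < 0" using assms by (intro gmoment_0_neg) auto
  moreover have "gregory_real (real (Suc n)) * gregory_real (real (Suc n) + e) =
     gmoment (Suc n) 0 * gmoment (Suc n) e / pi ^ 2"
    using gregory_real_eq_gmoment[of "Suc n" 0] gregory_real_eq_gmoment[of "Suc n" e] assms
    by (simp add: power2_eq_square power_mult_distrib[symmetric])
  ultimately show "gregory_real (real (Suc n)) * gregory_real (real (Suc n) + e) < 0"
    by (simp add: divide_neg_pos mult_neg_pos)
qed (use assms in auto)

lemma gregory_real_zero_interval:
  assumes "n \<ge> 2"
  shows "\<exists>c. real n < c \<and> c < real (Suc n) \<and> gregory_real c = 0"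
proof (rule gregory_real_zero_between)
  have "gmoment n 0 < 0" "gmoment (Suc n) 0 < 0" using assms by (intro gmoment_0_neg; simp)+
  moreover have "gregory_real (real n) * gregory_real (real (Suc n)) = - (gmoment n 0 * gmoment (Suc n) 0) / pi ^ 2"
    using gregory_real_eq_gmoment[of "Suc n" 0] gregory_real_eq_gmoment[of n 0] assms
    by (simp add: power2_eq_square power_mult_distrib[symmetric])
  ultimately show "gregory_real (real n) * gregory_real (real (Suc n)) < 0"
    by (simp add: divide_neg_pos mult_neg_neg)
qed auto

text \<open>The recurrence moves all Gamma arguments that depend on x to the positive half-line,
  leaving a polynomial that is odd about x = 1/2 times a monotone quotient of Gamma values.\<close>

lemma binom_real_half_integer:
  assumes "x \<in> {0..1}"
  shows "binom_real x (3/2) = rGamma (5/2) * ((x - 1/2) * (Gamma (x + 1) / Gamma (x + 1/2)))"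
    and "binom_real x (5/2) = rGamma (7/2) * ((1/2 - x) * (3/2 - x) * (1/2 + x) * (Gamma (x + 1) / Gamma (x + 3/2)))"
proof -
  have 1: "rGamma (x - 1/2) = (x - 1/2) * rGamma (x + 1/2)"
    using rGamma_plus1[of "x - 1/2"] by (simp add: add_ac)
  show "binom_real x (3/2) = rGamma (5/2) * ((x - 1/2) * (Gamma (x + 1) / Gamma (x + 1/2)))"
  proof -
    have "x - 3/2 + 1 = x - 1/2" "(3/2 :: real) + 1 = 5/2" by simp_all
    hence "binom_real x (3/2) = Gamma (x + 1) * rGamma (5/2) * rGamma (x - 1/2)"
      unfolding binom_real_def by (simp only:)
    also have "\<dots> = rGamma (5/2) * ((x - 1/2) * (Gamma (x + 1) * rGamma (x + 1/2)))" by (simp only: 1 mult_ac)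
    finally show ?thesis by (simp only: rGamma_inverse_Gamma divide_inverse)
  qed
  have 2: "rGamma (x - 3/2) = (x - 3/2) * rGamma (x - 1/2)"
    using rGamma_plus1[of "x - 3/2"] by (simp add: add_ac)
  have 3: "rGamma (x + 1/2) = (x + 1/2) * rGamma (x + 3/2)"
    using rGamma_plus1[of "x + 1/2"] by (simp add: add_ac)
  have "x - 5/2 + 1 = x - 3/2" "(5/2 :: real) + 1 = 7/2" by simp_all
  hence "binom_real x (5/2) = Gamma (x + 1) * rGamma (7/2) * rGamma (x - 3/2)"
    unfolding binom_real_def by (simp only:)
  also have "\<dots> = rGamma (7/2) * (((x - 3/2) * (x - 1/2) * (x + 1/2)) * (Gamma (x + 1) * rGamma (x + 3/2)))"
    by (simp only: 2 1 3 mult_ac)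
  also have "(x - 3/2) * (x - 1/2) * (x + 1/2) = (1/2 - x) * (3/2 - x) * (1/2 + x)"
    by (simp add: field_simps)
  finally show "binom_real x (5/2) = rGamma (7/2) * ((1/2 - x) * (3/2 - x) * (1/2 + x) * (Gamma (x + 1) / Gamma (x + 3/2)))"
    by (simp only: rGamma_inverse_Gamma divide_inverse)
qed

lemma Gamma_three_halves_real: "Gamma (3/2 :: real) = sqrt pi / 2"
proof -
  have "(1/2 :: real) \<notin> \<int>\<^sub>\<le>\<^sub>0" by (auto elim!: nonpos_Ints_cases)
  from Gamma_plus1[OF this] show ?thesis by (simp add: Gamma_one_half_real)
qed

text \<open>A correlation inequality: x - 1/2 has mean zero, so \<open>r x\<close> may be replaced
  by \<open>r x - r (1/2)\<close>, and then both factors change sign at 1/2 in the same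
  direction.\<close>

lemma gregory_real_three_halves_pos: "gregory_real (3/2) > 0"
proof -
  define r where "r = (\<lambda>x::real. Gamma (x + 1) / Gamma (x + 1/2))"
  define h where "h = (\<lambda>x. (x - 1/2) * (r x - r (1/2)))"
  have rmono: "r x \<le> r y" if "0 \<le> x" "x \<le> y" for x y
  proof -
    have "Gamma (y + 1/2) / Gamma (y + 1) \<le> Gamma (x + 1/2) / Gamma (x + 1)"
      using Gamma_quotient_antimono[of "x + 1/2" "y + 1/2" "1/2"] that by (simp add: add.assoc)
    moreover have "Gamma (y + 1/2) / Gamma (y + 1) > 0" using that by (intro divide_pos_pos Gamma_real_pos) auto
    ultimately have "inverse (Gamma (x + 1/2) / Gamma (x + 1)) \<le> inverse (Gamma (y + 1/2) / Gamma (y + 1))"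
      by (intro le_imp_inverse_le)
    thus ?thesis by (simp add: r_def)
  qed
  have rcont: "continuous_on {0..1} r" unfolding r_def
    by (intro continuous_intros continuous_on_Gamma_compose) (auto intro!: Gamma_real_pos less_imp_neq[symmetric])
  have hcont: "continuous_on {0..1} h" unfolding h_def by (intro continuous_intros rcont)
  have h: "integral {0..1} h > 0"
  proof (rule integral_pos_continuous[where c = 0])
    show "continuous_on {0..1} h" by (rule hcont)
    show "h x \<ge> 0" if "x \<in> {0..1}" for x
    proof (cases "x \<ge> 1/2")
      case True
      thus ?thesis using rmono[of "1/2" x] unfolding h_def by (intro mult_nonneg_nonneg) auto
    next
      case False
      thus ?thesis using rmono[of x "1/2"] that unfolding h_def by (intro mult_nonpos_nonpos) auto
    qed
    have "r 0 = 1 / sqrt pi" "r (1/2) = sqrt pi / 2"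
      by (simp_all add: r_def Gamma_one_half_real Gamma_three_halves_real)
    \<comment> \<open>Strict positivity is tested at x = 0, where it amounts to pi > 2.\<close>
    moreover have "1 / sqrt pi < sqrt pi / 2" using pi_gt3 by (simp add: field_simps)
    ultimately show "h 0 > 0" by (simp add: h_def)
  qed auto
  have i0: "((\<lambda>x::real. x - 1/2) has_integral 0) {0..1}"
  proof -
    have "((\<lambda>x::real. x - 1/2) has_integral ((1^2/2 - 1/2*1) - (0^2/2 - 1/2*0))) {0..1}"
      by (rule fundamental_theorem_of_calculus)
         (auto intro!: derivative_eq_intros simp flip: has_real_derivative_iff_has_vector_derivative)
    thus ?thesis by simp
  qed
  have "gregory_real (3/2) = integral {0..1} (\<lambda>x. rGamma (5/2) * (h x + (x - 1/2) * r (1/2)))"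
    unfolding gregory_real_def
  proof (intro integral_cong)
    fix x :: real assume x: "x \<in> {0..1}"
    have "h x + (x - 1/2) * r (1/2) = (x - 1/2) * r x" by (simp add: h_def right_diff_distrib)
    thus "binom_real x (3/2) = rGamma (5/2) * (h x + (x - 1/2) * r (1/2))"
      using x by (simp only: binom_real_half_integer r_def)
  qed
  also have "\<dots> = rGamma (5/2) * (integral {0..1} h + 0 * r (1/2))"
    by (intro integral_unique has_integral_mult_right has_integral_add has_integral_mult_left i0
          integrable_integral integrable_continuous_interval hcont)
  finally show ?thesis using h by (simp add: rGamma_inverse_Gamma)
qed

text \<open>As at 3/2, except that now both factors pass from nonnegative to nonpositive at 1/2;
  strictness at x = 0 amounts to pi < 4.\<close>

lemma gregory_real_five_halves_pos: "gregory_real (5/2) > 0"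
proof -
  define q where "q = (\<lambda>x::real. Gamma (x + 1) / Gamma (x + 3/2))"
  define k where "k = (\<lambda>x::real. (1/2 - x) * (3/2 - x) * (1/2 + x))"
  define h where "h = (\<lambda>x. k x * (q x - q (1/2)))"
  have qmono: "q y \<le> q x" if "0 \<le> x" "x \<le> y" for x y
    using Gamma_quotient_antimono[of "x + 1" "y + 1" "1/2"] that by (simp add: q_def add.assoc)
  have qcont: "continuous_on {0..1} q" unfolding q_def
    by (intro continuous_intros continuous_on_Gamma_compose) (auto intro!: Gamma_real_pos less_imp_neq[symmetric])
  have hcont: "continuous_on {0..1} h" unfolding h_def k_def by (intro continuous_intros qcont)
  have h: "integral {0..1} h > 0"
  proof (rule integral_pos_continuous[where c = 0])
    show "continuous_on {0..1} h" by (rule hcont)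
    show "h x \<ge> 0" if "x \<in> {0..1}" for x
    proof (cases "x \<ge> 1/2")
      case True
      thus ?thesis using qmono[of "1/2" x] that unfolding h_def k_def
        by (intro mult_nonpos_nonpos) (auto intro!: mult_nonpos_nonneg)
    next
      case False
      thus ?thesis using qmono[of x "1/2"] that unfolding h_def k_def by (intro mult_nonneg_nonneg) auto
    qed
    have "q 0 = 2 / sqrt pi" "q (1/2) = sqrt pi / 2"
      by (simp_all add: q_def Gamma_three_halves_real Gamma_numeral)
    moreover have "sqrt pi / 2 < 2 / sqrt pi" using pi_less_4 by (simp add: field_simps)
    ultimately show "h 0 > 0" by (simp add: h_def k_def)
  qed auto
  have i0: "(k has_integral 0) {0..1}"
  proof -
    \<comment> \<open>With t = x - 1/2 the primitive is t^4 / 4 - t^2 / 2, which is even in t, so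
      its values at the two ends agree.\<close>
    have "(k has_integral ((1 / 4 * (1 - 1/2)^4 - (1 - 1/2)^2 / 2) - (1 / 4 * (0 - 1/2)^4 - (0 - 1/2)^2 / 2))) {0..1}"
    proof (rule fundamental_theorem_of_calculus)
      fix x :: real assume "x \<in> {0..1}"
      have "((\<lambda>x. 1 / 4 * (x - 1/2)^4 - (x - 1/2)^2 / 2) has_real_derivative k x) (at x within {0..1})"
        unfolding k_def by (auto intro!: derivative_eq_intros) (simp add: field_simps power2_eq_square power3_eq_cube)
      thus "((\<lambda>x. 1 / 4 * (x - 1/2)^4 - (x - 1/2)^2 / 2) has_vector_derivative k x) (at x within {0..1})"
        by (simp flip: has_real_derivative_iff_has_vector_derivative)
    qed auto
    thus ?thesis by (simp add: power2_eq_square)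
  qed
  have "gregory_real (5/2) = integral {0..1} (\<lambda>x. rGamma (7/2) * (h x + k x * q (1/2)))"
    unfolding gregory_real_def
  proof (intro integral_cong)
    fix x :: real assume x: "x \<in> {0..1}"
    have "h x + k x * q (1/2) = k x * q x" by (simp add: h_def right_diff_distrib)
    thus "binom_real x (5/2) = rGamma (7/2) * (h x + k x * q (1/2))"
      using x by (simp only: binom_real_half_integer k_def q_def)
  qed
  also have "\<dots> = rGamma (7/2) * (integral {0..1} h + 0 * q (1/2))"
    by (intro integral_unique has_integral_mult_right has_integral_add has_integral_mult_left i0
          integrable_integral integrable_continuous_interval hcont)
  finally show ?thesis using h by (simp add: rGamma_inverse_Gamma)
qed

text \<open>Only n = 1 and n = 2 need a sharper location, read off from the signs at 3/2, 2 and 5/2.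
  For n > 2 the bound n + 1/2 will be inherited from n = 2.\<close>

lemma gregory_real_zeros_exist:
  "\<exists>\<rho> :: nat \<Rightarrow> real. (\<forall>n\<ge>1. real n < \<rho> n \<and> \<rho> n < real n + 1 \<and> gregory_real (\<rho> n) = 0) \<and>
     3 / 2 < \<rho> 1 \<and> \<rho> 2 < 5 / 2"
proof -
  have neg: "gregory_real 2 < 0"
    using gregory_real_eq_gmoment[of 2 0] gmoment_0_neg[of 2] by (simp add: divide_neg_pos)
  obtain a where a: "3/2 < a" "a < 2" "gregory_real a = 0"
    using gregory_real_zero_between[of "3/2" 2] neg gregory_real_three_halves_pos
    by (auto simp: mult_pos_neg)
  obtain b where b: "2 < b" "b < 5/2" "gregory_real b = 0"
    using gregory_real_zero_between[of 2 "5/2"] neg gregory_real_five_halves_pos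
    by (auto simp: mult_neg_pos)
  obtain c where c: "\<And>n. n \<ge> 2 \<Longrightarrow> real n < c n \<and> c n < real (Suc n) \<and> gregory_real (c n) = 0"
    using gregory_real_zero_interval by metis
  define \<rho> where "\<rho> = (\<lambda>n. if n = 1 then a else if n = 2 then b else c n)"
  have "real n < \<rho> n \<and> \<rho> n < real n + 1 \<and> gregory_real (\<rho> n) = 0" if "n \<ge> 1" for n
    using a b c[of n] that by (auto simp: \<rho>_def)
  thus ?thesis using a b by (intro exI[of _ \<rho>]) (auto simp: \<rho>_def)
qed

section \<open>Products with interlacing zeros\<close>

text \<open>A quadratic polynomial in 1 / t. Its minimum lies at 1 / t = Re z / |z|^2 and has the
  value (Im z / |z|)^2, which accounts for both monotonicity ranges and for the lower bound in the
  next three lemmas.\<close>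

lemma norm_one_minus_divide_sq:
  fixes z :: complex and t :: real
  assumes "t > 0"
  shows "norm (1 - z / of_real t) ^ 2 = 1 - 2 * Re z / t + norm z ^ 2 / t ^ 2"
  using assms unfolding cmod_power2 by (simp add: power2_eq_square add_divide_distrib algebra_simps)

lemma norm_one_minus_divide_antimono:
  fixes z :: complex
  assumes "0 < s" "s \<le> t" "Re z * t \<le> norm z ^ 2"
  shows "norm (1 - z / of_real t) \<le> norm (1 - z / of_real s)"
proof (rule power2_le_imp_le)
  have "Re z \<le> norm z ^ 2 / t" using assms by (simp add: field_simps)
  moreover have "norm z ^ 2 / t \<le> norm z ^ 2 / s" using assms by (intro divide_left_mono) auto
  ultimately have "(1 / s - 1 / t) * (norm z ^ 2 / s + norm z ^ 2 / t - 2 * Re z) \<ge> 0"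
    using assms divide_left_mono[of s t 1] by (intro mult_nonneg_nonneg) (simp, linarith)
  also have "(1 / s - 1 / t) * (norm z ^ 2 / s + norm z ^ 2 / t - 2 * Re z) =
     norm (1 - z / of_real s) ^ 2 - norm (1 - z / of_real t) ^ 2"
  proof -
    have t: "t > 0" using assms by simp
    have "(1 / s - 1 / t) * (n / s + n / t - 2 * x) = (1 - 2 * x / s + n / s ^ 2) - (1 - 2 * x / t + n / t ^ 2)" for n x
      using assms t by (simp add: field_simps power2_eq_square)
    thus ?thesis unfolding norm_one_minus_divide_sq[OF assms(1)] norm_one_minus_divide_sq[OF t] .
  qed
  finally show "norm (1 - z / of_real t) ^ 2 \<le> norm (1 - z / of_real s) ^ 2" by simp
qed auto

lemma norm_one_minus_divide_mono:
  fixes z :: complex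
  assumes "0 < s" "s \<le> t" "norm z ^ 2 \<le> Re z * s"
  shows "norm (1 - z / of_real s) \<le> norm (1 - z / of_real t)"
proof (rule power2_le_imp_le)
  have "norm z ^ 2 / s \<le> Re z" using assms by (simp add: field_simps)
  moreover have "norm z ^ 2 / t \<le> norm z ^ 2 / s" using assms by (intro divide_left_mono) auto
  ultimately have "(1 / s - 1 / t) * (norm z ^ 2 / s + norm z ^ 2 / t - 2 * Re z) \<le> 0"
    using assms divide_left_mono[of s t 1] by (intro mult_nonneg_nonpos) (simp, linarith)
  also have "(1 / s - 1 / t) * (norm z ^ 2 / s + norm z ^ 2 / t - 2 * Re z) =
     norm (1 - z / of_real s) ^ 2 - norm (1 - z / of_real t) ^ 2"
  proof -
    have t: "t > 0" using assms by simp
    have "(1 / s - 1 / t) * (n / s + n / t - 2 * x) = (1 - 2 * x / s + n / s ^ 2) - (1 - 2 * x / t + n / t ^ 2)" for n x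
      using assms t by (simp add: field_simps power2_eq_square)
    thus ?thesis unfolding norm_one_minus_divide_sq[OF assms(1)] norm_one_minus_divide_sq[OF t] .
  qed
  finally show "norm (1 - z / of_real s) ^ 2 \<le> norm (1 - z / of_real t) ^ 2" by simp
qed auto

lemma norm_one_minus_divide_ge:
  fixes z :: complex
  assumes "t > 0" "z \<noteq> 0"
  shows "\<bar>Im z\<bar> / norm z \<le> norm (1 - z / of_real t)"
proof (rule power2_le_imp_le)
  have "norm z ^ 2 * norm (1 - z / of_real t) ^ 2 - (Im z)\<^sup>2 = (Re z - norm z ^ 2 / t) ^ 2"
  proof -
    have "norm z ^ 2 * norm (1 - z / of_real t) ^ 2 - (Im z)\<^sup>2 =
            (norm z ^ 2 - (Im z)\<^sup>2) - 2 * Re z * (norm z ^ 2 / t) + (norm z ^ 2 / t) ^ 2"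
      unfolding norm_one_minus_divide_sq[OF assms(1)]
      by (simp add: algebra_simps power2_eq_square)
    also have "norm z ^ 2 - (Im z)\<^sup>2 = (Re z)\<^sup>2" by (simp add: cmod_power2)
    finally show ?thesis by (simp add: power2_diff)
  qed
  hence "(Im z)\<^sup>2 \<le> norm z ^ 2 * norm (1 - z / of_real t) ^ 2"
    by (smt (verit) zero_le_power2)
  thus "(\<bar>Im z\<bar> / norm z) ^ 2 \<le> norm (1 - z / of_real t) ^ 2"
    using assms by (simp add: power_divide field_simps)
qed auto

text \<open>A comparison that survives near t = 0, where exp t / sinh t grows like 1 / t; the factor
  t is supplied by a power of |Im z|. It is a form of exp (2 t) \<ge> 1 + 2 t.\<close>

lemma exp_le_sinh: "exp t * t \<le> sinh t * (2 * t + 1)" if "t > 0" for t :: real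
proof -
  have "exp (2 * t) \<ge> 1 + 2 * t" by (rule exp_ge_add_one_self)
  hence "exp t * (exp t * exp (- t)) \<ge> exp (- t) * (1 + 2 * t)"
    by (simp add: exp_add[symmetric] exp_minus field_simps)
  hence "exp (- t) * (1 + 2 * t) \<le> exp t" by (simp add: exp_minus)
  thus ?thesis by (simp add: sinh_def algebra_simps)
qed

lemma norm_square_diff_cnj:
  "norm (of_real (norm z ^ 2) - z ^ 2) = 2 * norm z * \<bar>Im z\<bar>"
proof -
  have "of_real (norm z ^ 2) - z ^ 2 = z * (cnj z - z)"
    by (simp only: complex_norm_square) (simp add: power2_eq_square algebra_simps)
  also have "norm \<dots> = norm z * norm (cnj z - z)" by (simp add: norm_mult)
  also have "cnj z - z = - \<i> * of_real (2 * Im z)" by (simp add: complex_eq_iff)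
  also have "norm \<dots> = 2 * \<bar>Im z\<bar>" by (simp add: norm_mult)
  finally show ?thesis by simp
qed

text \<open>
  Multiplying by \<open>(R\<^sup>2 - z\<^sup>2)\<^sup>2\<close> turns a bound that degenerates at the real axis
  into a uniform bound on the circle of radius \<open>R\<close>, since
  \<open>\<bar>R\<^sup>2 - z\<^sup>2\<bar> = 2 R \<bar>Im z\<bar>\<close> there.
\<close>
lemma norm_le_if_weighted_Im:
  assumes hol: "Q holomorphic_on UNIV"
    and bd: "\<And>z. (Im z)\<^sup>2 * norm (Q z) \<le> B * (1 + norm z) ^ 4"
    and B: "B \<ge> 0" and z: "norm z \<ge> 1"
  shows "norm (Q z) \<le> 144 * B * norm z ^ 2"
proof -
  \<comment> \<open>On a circle of twice the radius the weight satisfies |R^2 - z^2| \<ge> 3/4 R^2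
    at the inner point z, so it can be divided out again; also R \<ge> 2 gives 1 + R \<le> 3/2
    R.\<close>
  define R where "R = 2 * norm z"
  define F where "F = (\<lambda>w. Q w * (of_real (R ^ 2) - w ^ 2) ^ 2)"
  have R: "R > 0" "R \<ge> 2" using z by (auto simp: R_def)
  have holF: "F holomorphic_on UNIV" unfolding F_def by (intro holomorphic_intros hol)
  have F: "norm (F w) \<le> 4 * R ^ 2 * (B * (1 + R) ^ 4)" if "norm w = R" for w
  proof -
    have "norm (F w) = norm (Q w) * (2 * R * \<bar>Im w\<bar>) ^ 2"
      unfolding F_def using norm_square_diff_cnj[of w] that by (simp add: norm_mult norm_power)
    also have "\<dots> = 4 * R ^ 2 * ((Im w)\<^sup>2 * norm (Q w))" by (simp add: power_mult_distrib)
    also have "\<dots> \<le> 4 * R ^ 2 * (B * (1 + R) ^ 4)"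
      using bd[of w] that by (intro mult_left_mono) auto
    finally show ?thesis .
  qed
  have "norm (F z) \<le> 4 * R ^ 2 * (B * (1 + R) ^ 4)"
  proof (rule maximum_modulus_frontier[where f = F and S = "ball 0 R" and \<xi> = z])
    show "F holomorphic_on interior (ball 0 R)" by (rule holomorphic_on_subset[OF holF]) auto
    show "continuous_on (closure (ball 0 R)) F"
      by (rule continuous_on_subset[OF holomorphic_on_imp_continuous_on[OF holF]]) auto
    show "z \<in> ball 0 R" using z by (auto simp: R_def)
  qed (use F R in \<open>auto simp: frontier_ball\<close>)
  also have "4 * R ^ 2 * (B * (1 + R) ^ 4) \<le> 4 * R ^ 2 * (B * (3 / 2 * R) ^ 4)"
    using R B by (intro mult_left_mono power_mono) auto
  also have "\<dots> = 81 / 4 * B * R ^ 6" by (simp add: power_mult_distrib power_divide flip: power_add)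
  finally have 1: "norm (F z) \<le> 81 / 4 * B * R ^ 6" .
  have "norm (of_real (R ^ 2) - z ^ 2) \<ge> 3 / 4 * R ^ 2"
  proof -
    have "norm (of_real (R ^ 2) - z ^ 2) \<ge> norm (of_real (R ^ 2) :: complex) - norm (z ^ 2)"
      by (rule norm_triangle_ineq2)
    also have "norm (of_real (R ^ 2) :: complex) - norm (z ^ 2) = 3 / 4 * R ^ 2"
      by (simp only: norm_of_real norm_power) (simp add: R_def power_mult_distrib)
    finally show ?thesis .
  qed
  hence "norm (Q z) * (3 / 4 * R ^ 2) ^ 2 \<le> norm (F z)"
    unfolding F_def norm_mult norm_power by (intro mult_left_mono power_mono) auto
  with 1 have "norm (Q z) * (3 / 4 * R ^ 2) ^ 2 \<le> 81 / 4 * B * R ^ 6" by linarith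
  also have "\<dots> = 36 * B * R ^ 2 * (3 / 4 * R ^ 2) ^ 2"
    by (simp add: power_mult_distrib power_divide flip: power_mult power_add)
  finally have "norm (Q z) \<le> 36 * B * R ^ 2"
    using R by (subst (asm) mult_le_cancel_right) auto
  also have "\<dots> = 144 * B * norm z ^ 2" by (simp add: R_def power_mult_distrib)
  finally show ?thesis .
qed

text \<open>The preceding bound makes Q a polynomial of degree at most 2 by Liouville. The growth
  along the imaginary axis then removes first the quadratic and then the linear coefficient.\<close>

lemma constant_if_weighted_Im:
  assumes hol: "Q holomorphic_on UNIV"
    and bd: "\<And>z. (Im z)\<^sup>2 * norm (Q z) \<le> B * (1 + norm z) ^ 4" and B: "B \<ge> 0"
    and lim: "((\<lambda>y. norm (Q (\<i> * of_real y)) / y) \<longlongrightarrow> 0) at_top"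
  shows "Q z = Q 0"
proof -
  define c where "c = (\<lambda>k. (deriv ^^ k) Q 0 / fact k)"
  have Q: "Q z = c 0 + c 1 * z + c 2 * z ^ 2" for z
  proof -
    have "Q z = (\<Sum>k\<le>2. (deriv ^^ k) Q 0 / fact k * z ^ k)"
      by (rule Liouville_polynomial[OF hol norm_le_if_weighted_Im[OF hol bd B]])
    thus ?thesis by (simp add: c_def eval_nat_numeral)
  qed
  have L: "((\<lambda>y. Q (\<i> * of_real y) / of_real y) \<longlongrightarrow> 0) at_top"
  proof (rule tendsto_norm_zero_cancel, rule Lim_transform_eventually[OF lim])
    show "\<forall>\<^sub>F y in at_top. norm (Q (\<i> * of_real y)) / y = norm (Q (\<i> * of_real y) / of_real y)"
      using eventually_gt_at_top[of 0] by eventually_elim (simp add: norm_divide)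
  qed
  have inv: "((\<lambda>y::real. 1 / complex_of_real y) \<longlongrightarrow> 0) at_top"
    using tendsto_of_real[OF tendsto_inverse_0_at_top[OF filterlim_ident], where 'a = complex]
    by (simp add: divide_inverse)
  have L2: "((\<lambda>y. (Q (\<i> * of_real y) / of_real y) * (1 / of_real y)) \<longlongrightarrow> 0 * 0) at_top"
    by (intro tendsto_mult L inv)
  have M2: "((\<lambda>y. c 0 * ((1 / of_real y) * (1 / of_real y)) + \<i> * c 1 * (1 / of_real y) - c 2) \<longlongrightarrow>
     c 0 * (0 * 0) + \<i> * c 1 * 0 - c 2) (at_top :: real filter)"
    by (intro tendsto_add tendsto_diff tendsto_mult tendsto_const inv)
  have "eventually (\<lambda>y::real. c 0 * ((1 / of_real y) * (1 / of_real y)) + \<i> * c 1 * (1 / of_real y) - c 2 =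
      (Q (\<i> * of_real y) / of_real y) * (1 / of_real y)) at_top"
    using eventually_gt_at_top[of 0]
    by eventually_elim (simp add: Q power2_eq_square field_simps)
  from tendsto_unique[OF _ Lim_transform_eventually[OF M2 this] L2] have "- c 2 = 0" by simp
  hence c2: "c 2 = 0" by simp
  have M1: "((\<lambda>y. c 0 * (1 / of_real y) + \<i> * c 1) \<longlongrightarrow> c 0 * 0 + \<i> * c 1) (at_top :: real filter)"
    by (intro tendsto_add tendsto_diff tendsto_mult tendsto_const inv)
  have "eventually (\<lambda>y::real. c 0 * (1 / of_real y) + \<i> * c 1 = Q (\<i> * of_real y) / of_real y) at_top"
    using eventually_gt_at_top[of 0]
    by eventually_elim (simp add: Q c2 field_simps)
  from tendsto_unique[OF _ Lim_transform_eventually[OF M1 this] L] have "c 1 = 0" by simp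
  with c2 show ?thesis by (simp add: Q)
qed

text \<open>The product theory depends only on one point in each interval (n, n + 1), not on the
  Gregory function; this is what makes the lower bounds available before its zeros are
  known.\<close>

locale interlacing =
  fixes \<rho> :: "nat \<Rightarrow> real"
  assumes rho: "n \<ge> 1 \<Longrightarrow> real n < \<rho> n" "n \<ge> 1 \<Longrightarrow> \<rho> n < real n + 1"
begin

text \<open>The negative integers and the points \<open>\<rho> n\<close> alternate, so that the
  first 2 N Weierstrass factors are exactly N pairs.\<close>

definition zseq :: "nat \<Rightarrow> complex" where
  "zseq k = (if even k then - of_nat (Suc (k div 2)) else of_real (\<rho> (Suc (k div 2))))"

definition pprod :: "nat \<Rightarrow> complex \<Rightarrow> complex" where
  "pprod N z = (\<Prod>n=1..N. (1 + z / of_nat n) * (1 - z / of_real (\<rho> n)))"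

text \<open>The exponent by which the paired product differs from the Weierstrass product: the two
  convergence factors of the n-th pair multiply to exp (- (1 / n - 1 / \<open>\<rho> n\<close>)
  z).\<close>

definition sigma :: real where
  "sigma = (\<Sum>n. 1 / real (Suc n) - 1 / \<rho> (Suc n))"

lemma rho_pos: "n \<ge> 1 \<Longrightarrow> \<rho> n > 0"
  using rho(1)[of n] by linarith

lemma zseq_simps: "zseq (2 * n) = - of_nat (Suc n)" "zseq (Suc (2 * n)) = of_real (\<rho> (Suc n))"
  by (auto simp: zseq_def)

lemma range_zseq: "range zseq = {- of_nat n | n. n \<ge> 1} \<union> {of_real (\<rho> n) | n. n \<ge> 1}"
proof safe
  fix k
  assume *: "\<not> (\<exists>n. zseq k = of_real (\<rho> n) \<and> 1 \<le> n)"
  show "\<exists>n. zseq k = - of_nat n \<and> 1 \<le> n"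
    using * by (cases "even k") (auto simp: zseq_def intro!: exI[of _ "Suc (k div 2)"])
next
  fix n :: nat assume "1 \<le> n"
  thus "- of_nat n \<in> range zseq" "of_real (\<rho> n) \<in> range zseq"
    using zseq_simps[of "n - 1"] by (metis One_nat_def Suc_pred' less_eq_Suc_le rangeI)+
qed

lemma norm_zseq_ge: "norm (zseq k) \<ge> real (Suc k) / 2"
proof -
  have k: "real (Suc k) / 2 \<le> real (Suc (k div 2))"
    by (cases "even k") (auto elim!: evenE oddE)
  have "norm (zseq k) \<ge> real (Suc (k div 2))"
    using rho(1)[of "Suc (k div 2)"] unfolding zseq_def by (auto simp del: of_nat_Suc)
  with k show ?thesis by linarith
qed

lemma rho_eq_iff: "m \<ge> 1 \<Longrightarrow> n \<ge> 1 \<Longrightarrow> \<rho> m = \<rho> n \<longleftrightarrow> m = n"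
proof
  assume "m \<ge> 1" "n \<ge> 1" "\<rho> m = \<rho> n"
  hence "real m < real n + 1" "real n < real m + 1" using rho[of m] rho[of n] by linarith+
  thus "m = n" by linarith
qed auto

lemma inj_zseq: "inj zseq"
proof (rule injI)
  fix j k assume eq: "zseq j = zseq k"
  have neg: "- of_nat (Suc m) \<noteq> (of_real (\<rho> (Suc n)) :: complex)" for m n
  proof
    assume "- of_nat (Suc m) = (of_real (\<rho> (Suc n)) :: complex)"
    hence "Re (- of_nat (Suc m)) = \<rho> (Suc n)" by simp
    with rho_pos[of "Suc n"] show False by simp
  qed
  have "even j = even k" "j div 2 = k div 2"
    using eq neg[of "j div 2" "k div 2"] neg[of "k div 2" "j div 2"] rho_eq_iff[of "Suc (j div 2)" "Suc (k div 2)"]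
    by (auto simp: zseq_def simp del: of_nat_Suc split: if_splits)
  thus "j = k" by (metis even_two_times_div_two odd_two_times_div_two_succ)
qed

lemma summable_zseq: "summable (\<lambda>n. (r / norm (zseq n)) ^ Suc 1)" if "r > 0" for r
proof (rule summable_comparison_test')
  have "summable (\<lambda>n. 1 / real (n + 1) ^ 2)"
    using inverse_squares_sums sums_summable by auto
  thus "summable (\<lambda>n. (2 * r) ^ 2 * (1 / real (n + 1) ^ 2))" by (rule summable_mult)
  fix n :: nat
  have "r / norm (zseq n) \<le> r / (real (Suc n) / 2)"
    using that norm_zseq_ge[of n] by (intro divide_left_mono mult_pos_pos) auto
  also have "\<dots> = 2 * r / real (n + 1)" by simp
  finally have "(r / norm (zseq n)) ^ 2 \<le> (2 * r / real (n + 1)) ^ 2"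
    using that by (intro power_mono) auto
  thus "norm ((r / norm (zseq n)) ^ Suc 1) \<le> (2 * r) ^ 2 * (1 / real (n + 1) ^ 2)"
    by (simp add: power_divide numeral_2_eq_2)
qed

sublocale W: weierstrass_product zseq "\<lambda>_. 1"
proof
  show "zseq n \<noteq> 0" for n using norm_zseq_ge[of n] by auto
  have "filterlim (\<lambda>n. real (Suc n) / 2) at_top sequentially" by real_asymp
  hence "filterlim (\<lambda>n. norm (zseq n)) at_top sequentially"
    by (rule filterlim_at_top_mono) (auto intro!: always_eventually norm_zseq_ge[simplified])
  thus "filterlim zseq at_infinity sequentially"
    by (rule filterlim_norm_at_top_imp_at_infinity)
qed (rule summable_zseq)

definition canon :: "complex \<Rightarrow> complex" where
  "canon z = exp (of_real sigma * z) * W.f z"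

lemma holomorphic_canon: "canon holomorphic_on A"
  unfolding canon_def by (intro holomorphic_intros W.holomorphic)

lemma canon_eq_0_iff: "canon z = 0 \<longleftrightarrow> z \<in> range zseq"
  using W.zero[of z] by (simp add: canon_def)

lemma eventually_canon_nonzero: "eventually (\<lambda>w. canon w \<noteq> 0) (at z)"
  using W.not_islimpt_range_a[of z] by (auto simp: islimpt_iff_eventually canon_eq_0_iff)

lemma zorder_canon: "z \<in> range zseq \<Longrightarrow> zorder canon z = 1"
proof -
  assume z: "z \<in> range zseq"
  have "zorder (\<lambda>z. exp (of_real sigma * z) * W.f z) z = zorder (\<lambda>z. exp (of_real sigma * z)) z + zorder W.f z"
  proof (rule zorder_times_analytic)
    show "eventually (\<lambda>z. exp (of_real sigma * z) * W.f z \<noteq> 0) (at z)"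
      using eventually_canon_nonzero[of z] by (simp add: canon_def)
    show "W.f analytic_on {z}" by (rule W.analytic)
  qed (auto intro!: analytic_intros)
  also have "zorder (\<lambda>z. exp (of_real sigma * z)) z = 0"
    by (rule zorder_eq_0I) (auto intro!: analytic_intros)
  also have "zorder W.f z = card (zseq -` {z})" by (rule W.zorder)
  also have "\<exists>k. zseq -` {z} = {k}"
    using z inj_zseq by (auto simp: inj_def)
  hence "card (zseq -` {z}) = 1" by auto
  finally show ?thesis by (simp add: canon_def[abs_def])
qed

lemma reciprocal_diff_bounds: "0 \<le> 1 / real (Suc n) - 1 / \<rho> (Suc n)"
    "1 / real (Suc n) - 1 / \<rho> (Suc n) \<le> 1 / real (n + 1) ^ 2"
proof -
  note r = rho[of "Suc n"]
  have "1 / \<rho> (Suc n) \<le> 1 / real (Suc n)" using r by (intro divide_left_mono) auto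
  thus "0 \<le> 1 / real (Suc n) - 1 / \<rho> (Suc n)" by simp
  have "1 / \<rho> (Suc n) \<ge> 1 / (real (Suc n) + 1)" using r by (intro divide_left_mono) auto
  hence "1 / real (Suc n) - 1 / \<rho> (Suc n) \<le> 1 / real (Suc n) - 1 / (real (Suc n) + 1)" by simp
  also have "\<dots> = 1 / (real (Suc n) * (real (Suc n) + 1))" by (simp add: field_simps)
  also have "\<dots> \<le> 1 / real (n + 1) ^ 2" unfolding power2_eq_square by (intro divide_left_mono mult_left_mono) auto
  finally show "1 / real (Suc n) - 1 / \<rho> (Suc n) \<le> 1 / real (n + 1) ^ 2" .
qed

lemma sigma_sums: "(\<lambda>n. 1 / real (Suc n) - 1 / \<rho> (Suc n)) sums sigma"
  unfolding sigma_def
proof (rule summable_sums, rule summable_comparison_test')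
  show "summable (\<lambda>n. 1 / real (n + 1) ^ 2)"
    using inverse_squares_sums sums_summable by auto
qed (use reciprocal_diff_bounds in \<open>auto simp del: of_nat_Suc\<close>)

lemma pprod_eq:
  "pprod N z = exp (of_real (\<Sum>n<N. 1 / real (Suc n) - 1 / \<rho> (Suc n)) * z) *
     (\<Prod>n<2*N. weierstrass_factor 1 (z / zseq n))"
proof (induction N)
  case (Suc N)
  have e: "exp (z / zseq (2 * N)) * exp (z / zseq (Suc (2 * N))) *
     exp (of_real (1 / real (Suc N) - 1 / \<rho> (Suc N)) * z) = 1"
  proof -
    have "z / (- c) + z / d + (1 / c - 1 / d) * z = 0" for c d by (simp add: algebra_simps)
    from this[of "of_nat (Suc N)" "of_real (\<rho> (Suc N))"] show ?thesis
      unfolding zseq_simps exp_add[symmetric] by (simp del: of_nat_Suc)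
  qed
  have "exp (of_real (\<Sum>n<Suc N. 1 / real (Suc n) - 1 / \<rho> (Suc n)) * z) *
     (\<Prod>n<2*Suc N. weierstrass_factor 1 (z / zseq n)) = 
     pprod N z * ((1 - z / zseq (2 * N)) * (1 - z / zseq (Suc (2 * N)))) *
     (exp (z / zseq (2 * N)) * exp (z / zseq (Suc (2 * N))) *
      exp (of_real (1 / real (Suc N) - 1 / \<rho> (Suc N)) * z))"
  proof -
    have wf: "weierstrass_factor 1 w = (1 - w) * exp w" for w by (simp add: weierstrass_factor_def)
    have "2 * Suc N = Suc (Suc (2 * N))" by simp
    thus ?thesis
      unfolding Suc.IH
      by (simp only: wf prod.lessThan_Suc sum.lessThan_Suc of_real_add distrib_right distrib_left exp_add mult_ac)
  qed
  also have "\<dots> = pprod N z * ((1 - z / zseq (2 * N)) * (1 - z / zseq (Suc (2 * N))))"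
    unfolding e by simp
  also have "\<dots> = pprod (Suc N) z" unfolding zseq_simps by (simp add: pprod_def del: of_nat_Suc)
  finally show ?case by simp
qed (simp add: pprod_def)

lemma uniform_limit_pprod_cball:
  assumes R: "R > 0"
  shows "uniform_limit (cball 0 R) pprod canon sequentially"
proof -
  define s where "s = (\<lambda>N. complex_of_real (\<Sum>n<N. 1 / real (Suc n) - 1 / \<rho> (Suc n)))"
  have s: "s \<longlonglongrightarrow> of_real sigma"
    unfolding s_def using sigma_sums by (intro tendsto_of_real) (simp add: sums_def)
  have lin: "uniform_limit (cball 0 R) (\<lambda>N z. s N * z) (\<lambda>z. of_real sigma * z) sequentially"
  proof (rule uniform_limitI)
    fix e :: real assume e: "e > 0"
    have "eventually (\<lambda>N. dist (s N) (of_real sigma) < e / R) sequentially"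
      using s e R by (intro tendstoD) auto
    thus "\<forall>\<^sub>F N in sequentially. \<forall>z\<in>cball 0 R. dist (s N * z) (of_real sigma * z) < e"
    proof eventually_elim
      case (elim N)
      show ?case
      proof
        fix z :: complex assume "z \<in> cball 0 R"
        hence "dist (s N * z) (of_real sigma * z) \<le> dist (s N) (of_real sigma) * R"
          by (simp add: dist_norm norm_mult left_diff_distrib[symmetric] mult_left_mono)
        also have "\<dots> < e" using elim R by (simp add: field_simps)
        finally show "dist (s N * z) (of_real sigma * z) < e" .
      qed
    qed
  qed
  obtain M where M: "M > 0" "\<And>N. norm (s N) \<le> M"
    using convergent_imp_bounded[OF s] by (auto simp: bounded_pos)
  have "uniform_limit (cball 0 R) (\<lambda>N z. exp (s N * z)) (\<lambda>z. exp (of_real sigma * z)) sequentially"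
  proof (rule uniform_limit_compose_uniformly_continuous_on[OF lin])
    show "uniformly_continuous_on (cball 0 (M * R)) (exp :: complex \<Rightarrow> complex)"
      by (intro compact_uniformly_continuous continuous_intros) auto
    show "\<forall>\<^sub>F N in sequentially. \<forall>z\<in>cball 0 R. s N * z \<in> cball 0 (M * R)"
      using M R by (intro always_eventually) (auto simp: norm_mult intro!: mult_mono)
  qed auto
  moreover have "uniform_limit (cball 0 R) (\<lambda>N z. \<Prod>n<2*N. weierstrass_factor 1 (z / zseq n)) W.f sequentially"
    using filterlim_compose[OF W.uniform_limit[OF R], of "\<lambda>N. 2 * N" sequentially]
    by (simp add: filterlim_subseq strict_mono_def o_def)
  ultimately have "uniform_limit (cball 0 R)
     (\<lambda>N z. exp (s N * z) * (\<Prod>n<2*N. weierstrass_factor 1 (z / zseq n)))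
     (\<lambda>z. exp (of_real sigma * z) * W.f z) sequentially"
    by (rule uniform_lim_mult)
       (intro compact_imp_bounded compact_continuous_image continuous_intros
          holomorphic_on_imp_continuous_on W.holomorphic compact_cball)+
  moreover have "pprod = (\<lambda>N z. exp (s N * z) * (\<Prod>n<2*N. weierstrass_factor 1 (z / zseq n)))"
    by (simp add: fun_eq_iff pprod_eq s_def)
  ultimately show ?thesis by (simp add: canon_def[abs_def])
qed

lemma compact_subset_cball_0:
  fixes K :: "complex set"
  assumes "compact K" obtains R where "R > 0" "K \<subseteq> cball 0 R"
  using compact_imp_bounded[OF assms] by (auto simp: bounded_pos subset_iff)

lemma locally_uniform_limit_pprod: "locally_uniform_limit pprod canon sequentially"
  unfolding locally_uniform_limit_def
  by (metis compact_subset_cball_0 uniform_limit_on_subset uniform_limit_pprod_cball)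

lemma pprod_LIMSEQ: "(\<lambda>N. pprod N z) \<longlonglongrightarrow> canon z"
  by (rule tendsto_uniform_limitI[OF uniform_limit_pprod_cball[of "norm z + 1"]]) (auto intro: add_nonneg_pos)

text \<open>Convergence of the partial products alone does not give \<open>has_prod\<close>, hence
  the absolute estimate: a pair of factors is 1 + O(1 / n^2), because its linear terms nearly
  cancel.\<close>

lemma has_prod_canon:
  "(\<lambda>n. (1 + z / of_nat (Suc n)) * (1 - z / of_real (\<rho> (Suc n)))) has_prod canon z"
proof (rule convergent_prod_tendsto_imp_has_prod)
  show "convergent_prod (\<lambda>n. (1 + z / of_nat (Suc n)) * (1 - z / of_real (\<rho> (Suc n))))"
  proof (rule abs_convergent_prod_imp_convergent_prod, unfold abs_convergent_prod_conv_summable,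
         rule summable_comparison_test')
    have "summable (\<lambda>n. 1 / real (n + 1) ^ 2)"
      using inverse_squares_sums sums_summable by auto
    thus "summable (\<lambda>n. (norm z + norm z ^ 2) * (1 / real (n + 1) ^ 2))" by (rule summable_mult)
    fix n :: nat
    have r: "\<rho> (Suc n) \<ge> real (n + 1)" "\<rho> (Suc n) > 0" using rho(1)[of "Suc n"] rho_pos[of "Suc n"] by auto
    have "(1 + z / of_nat (Suc n)) * (1 - z / of_real (\<rho> (Suc n))) - 1 =
       of_real (1 / real (Suc n) - 1 / \<rho> (Suc n)) * z - of_real (1 / (real (n + 1) * \<rho> (Suc n))) * z ^ 2"
    proof -
      have "(1 + z / a) * (1 - z / b) - 1 = (1 / a - 1 / b) * z - 1 / (a * b) * z ^ 2"
        if "a \<noteq> 0" "b \<noteq> 0" for a b using that by (simp add: field_simps power2_eq_square)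
      from this[of "of_nat (Suc n)" "of_real (\<rho> (Suc n))"] show ?thesis
        using r by (simp del: of_nat_Suc)
    qed
    also have "norm \<dots> \<le> norm (of_real (1 / real (Suc n) - 1 / \<rho> (Suc n)) * z) + norm (of_real (1 / (real (n + 1) * \<rho> (Suc n))) * z ^ 2)"
      by (rule norm_triangle_ineq4)
    also have "\<dots> = (1 / real (Suc n) - 1 / \<rho> (Suc n)) * norm z + 1 / (real (n + 1) * \<rho> (Suc n)) * norm z ^ 2"
      using reciprocal_diff_bounds(1)[of n] r unfolding norm_mult norm_of_real norm_power by simp
    also have "\<dots> \<le> 1 / real (n + 1) ^ 2 * norm z + 1 / real (n + 1) ^ 2 * norm z ^ 2"
      using r unfolding power2_eq_square[of "real (n + 1)"]
      by (intro add_mono mult_right_mono reciprocal_diff_bounds(2)[unfolded power2_eq_square]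
           divide_left_mono mult_left_mono mult_pos_pos) auto
    also have "\<dots> = (norm z + norm z ^ 2) * (1 / real (n + 1) ^ 2)" by (simp add: add_divide_distrib)
    finally show "norm (norm ((1 + z / of_nat (Suc n)) * (1 - z / of_real (\<rho> (Suc n))) - 1)) \<le>
       (norm z + norm z ^ 2) * (1 / real (n + 1) ^ 2)" by simp
  qed
  have "(\<Prod>i\<le>n. (1 + z / of_nat (Suc i)) * (1 - z / of_real (\<rho> (Suc i)))) = pprod (Suc n) z" for n
    unfolding pprod_def by (rule prod.reindex_bij_witness[of _ "\<lambda>i. i - 1" Suc]) auto
  thus "(\<lambda>n. \<Prod>i\<le>n. (1 + z / of_nat (Suc i)) * (1 - z / of_real (\<rho> (Suc i)))) \<longlonglongrightarrow> canon z"
    using LIMSEQ_Suc[OF pprod_LIMSEQ[of z]] by simp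
qed

lemma canon_0 [simp]: "canon 0 = 1"
proof -
  have "pprod N 0 = 1" for N by (simp add: pprod_def)
  with pprod_LIMSEQ[of 0] show ?thesis by (simp add: LIMSEQ_const_iff)
qed

text \<open>By \<open>norm_pprod\<close> this is |1 - z| times the quotient of the paired product by
  the partial sine product. The factor |1 - z| cancels the denominator at n = 1, after which
  \<open>\<rho> n\<close> can be compared with n + 1.\<close>

definition ratio :: "complex \<Rightarrow> nat \<Rightarrow> real" where
  "ratio z N = norm (1 - z) * (\<Prod>n=1..N. norm (1 - z / of_real (\<rho> n)) / norm (1 - z / of_nat n))"

text \<open>As long as |1 - z / t| decreases in t, the factor at \<open>\<rho> n\<close> is at least
  the one at n + 1, and the product telescopes to its last term.\<close>

lemma ratio_decreasing:
  assumes ne: "\<And>n. n \<ge> 1 \<Longrightarrow> z \<noteq> of_nat n" and "Re z * real (Suc N) \<le> norm z ^ 2"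
  shows "ratio z N \<ge> norm (1 - z / of_nat (Suc N))"
  using assms(2)
proof (induction N)
  case (Suc N)
  note r = rho[of "Suc N"]
  have pos: "norm (1 - z / of_nat (Suc N)) > 0" using ne[of "Suc N"] by (simp add: field_simps del: of_nat_Suc)
  have le: "Re z * real (Suc N) \<le> norm z ^ 2"
  proof (cases "Re z \<ge> 0")
    case True
    hence "Re z * real (Suc N) \<le> Re z * real (Suc (Suc N))" by (intro mult_left_mono) auto
    with Suc.prems show ?thesis by linarith
  next
    case False
    hence "Re z * real (Suc N) \<le> 0" by (intro mult_nonpos_nonneg) auto
    thus ?thesis by (rule order.trans) auto
  qed
  have "norm (1 - z / of_nat (Suc (Suc N))) \<le> norm (1 - z / of_real (\<rho> (Suc N)))"
    using norm_one_minus_divide_antimono[of "\<rho> (Suc N)" "real (Suc (Suc N))" z] r Suc.prems by simp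
  also have "\<dots> = norm (1 - z / of_nat (Suc N)) * (norm (1 - z / of_real (\<rho> (Suc N))) / norm (1 - z / of_nat (Suc N)))"
    using pos by simp
  also have "\<dots> \<le> ratio z N * (norm (1 - z / of_real (\<rho> (Suc N))) / norm (1 - z / of_nat (Suc N)))"
    using Suc.IH[OF le] by (intro mult_right_mono) auto
  also have "\<dots> = ratio z (Suc N)" by (simp add: ratio_def)
  finally show ?case .
qed (simp add: ratio_def)

text \<open>Beyond the turning point t = |z|^2 / Re z each new quotient is at least 1. Before it,
  the telescoped bound cancels the last denominator and leaves |1 - z / \<open>\<rho> n\<close>|,
  which is at least the minimum |Im z| / |z| over all t.\<close>

lemma ratio_ge:
  assumes "Im z \<noteq> 0"
  shows "ratio z N \<ge> \<bar>Im z\<bar> / norm z"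
proof (induction N)
  case 0
  have "z \<noteq> 0" using assms by auto
  thus ?case using norm_one_minus_divide_ge[of 1 z] by (simp add: ratio_def)
next
  case (Suc N)
  have ne: "z \<noteq> of_nat n" for n using assms by auto
  have z0: "z \<noteq> 0" using assms by auto
  note r = rho[of "Suc N"]
  have pos: "norm (1 - z / of_nat (Suc N)) > 0" using ne[of "Suc N"] by (simp add: field_simps del: of_nat_Suc)
  have S: "ratio z (Suc N) = ratio z N * (norm (1 - z / of_real (\<rho> (Suc N))) / norm (1 - z / of_nat (Suc N)))"
    by (simp add: ratio_def)
  show ?case
  proof (cases "Re z * real (Suc N) \<le> norm z ^ 2")
    case True
    have "\<bar>Im z\<bar> / norm z \<le> norm (1 - z / of_real (\<rho> (Suc N)))"
      using r z0 by (intro norm_one_minus_divide_ge) auto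
    also have "\<dots> = norm (1 - z / of_nat (Suc N)) * (norm (1 - z / of_real (\<rho> (Suc N))) / norm (1 - z / of_nat (Suc N)))"
      using pos by simp
    also have "\<dots> \<le> ratio z (Suc N)"
      unfolding S using ratio_decreasing[OF ne True] by (intro mult_right_mono) auto
    finally show ?thesis .
  next
    case False
    hence "norm (1 - z / of_real (real (Suc N))) \<le> norm (1 - z / of_real (\<rho> (Suc N)))"
      using r by (intro norm_one_minus_divide_mono) auto
    hence "ratio z N * 1 \<le> ratio z (Suc N)"
      unfolding S using pos by (intro mult_left_mono) (auto simp: ratio_def intro!: prod_nonneg mult_nonneg_nonneg)
    with Suc.IH show ?thesis by simp
  qed
qed

lemma norm_pprod:
  assumes "\<And>n. n \<ge> 1 \<Longrightarrow> z \<noteq> of_nat n"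
  shows "norm (1 - z) * norm (pprod N z) = norm (\<Prod>k=1..N. 1 - z ^ 2 / of_nat k ^ 2) * ratio z N"
proof -
  have "norm (pprod N z) = (\<Prod>n=1..N. norm (1 - z ^ 2 / of_nat n ^ 2) * (norm (1 - z / of_real (\<rho> n)) / norm (1 - z / of_nat n)))"
    unfolding pprod_def prod_norm[symmetric]
  proof (intro prod.cong refl)
    fix n assume n: "n \<in> {1..N}"
    hence d: "norm (1 - z / of_nat n) \<noteq> 0" using assms[of n] by (auto simp: field_simps)
    have e: "1 - z ^ 2 / of_nat n ^ 2 = (1 + z / of_nat n) * (1 - z / of_nat n)"
      by (simp add: algebra_simps power2_eq_square)
    have "p * r = p * q * (r / q)" if "q \<noteq> 0" for p q r :: real using that by simp
    from this[OF d] show "norm ((1 + z / of_nat n) * (1 - z / of_real (\<rho> n))) =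
        norm (1 - z ^ 2 / of_nat n ^ 2) * (norm (1 - z / of_real (\<rho> n)) / norm (1 - z / of_nat n))"
      by (simp only: e norm_mult)
  qed
  thus ?thesis unfolding ratio_def prod.distrib prod_norm by (simp add: mult_ac)
qed

text \<open>The bound for \<open>ratio\<close> is uniform in N, so \<open>norm_pprod\<close> passes
  to the limit, where Euler's product supplies the sine.\<close>

lemma norm_canon_ge:
  assumes ne: "\<And>n. n \<ge> 1 \<Longrightarrow> z \<noteq> of_nat n" and c: "\<And>N. ratio z N \<ge> c"
  shows "norm (sin (of_real pi * z)) * c \<le> pi * norm z * (norm (1 - z) * norm (canon z))"
proof -
  let ?p = "\<lambda>N. \<Prod>k=1..N. 1 - z ^ 2 / of_nat k ^ 2"
  show ?thesis
  proof (rule tendsto_le)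
    show "(\<lambda>N. norm (of_real pi * z * ?p N) * c) \<longlonglongrightarrow> norm (sin (of_real pi * z)) * c"
      by (intro tendsto_intros sin_product_formula_complex)
    show "(\<lambda>N. pi * norm z * (norm (1 - z) * norm (pprod N z))) \<longlonglongrightarrow> pi * norm z * (norm (1 - z) * norm (canon z))"
      by (intro tendsto_intros pprod_LIMSEQ)
    show "\<forall>\<^sub>F N in sequentially. norm (of_real pi * z * ?p N) * c \<le>
        pi * norm z * (norm (1 - z) * norm (pprod N z))"
    proof (intro always_eventually allI)
      fix N
      have "norm (of_real pi * z * ?p N) * c =
              pi * norm z * (norm (?p N) * c)"
        by (simp only: norm_mult norm_of_real mult.assoc abs_of_pos[OF pi_gt_zero])
      also have "\<dots> \<le> pi * norm z * (norm (?p N) * ratio z N)"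
        using c by (intro mult_left_mono) auto
      also have "norm (?p N) * ratio z N = norm (1 - z) * norm (pprod N z)"
        using norm_pprod[of z N] ne by metis
      finally show "norm (of_real pi * z * ?p N) * c \<le>
        pi * norm z * (norm (1 - z) * norm (pprod N z))" .
    qed
  qed auto
qed

text \<open>For Re z \<le> 0 the increasing range is never reached, and the telescoped term has real
  part at least 1. The bound thus has no |Im z| loss and serves on the imaginary and the negative
  real axis.\<close>

lemma norm_canon_ge_left:
  assumes "Re z \<le> 0"
  shows "norm (sin (of_real pi * z)) \<le> pi * norm z * (norm (1 - z) * norm (canon z))"
proof -
  have ne: "z \<noteq> of_nat n" if "n \<ge> 1" for n using assms that by auto
  have "ratio z N \<ge> 1" for N
  proof -
    have "Re z * real (Suc N) \<le> 0" using assms by (intro mult_nonpos_nonneg) auto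
    hence "Re z * real (Suc N) \<le> norm z ^ 2" by (rule order.trans) auto
    hence "ratio z N \<ge> norm (1 - z / of_nat (Suc N))" using ne by (intro ratio_decreasing)
    moreover have "norm (1 - z / of_nat (Suc N)) \<ge> Re (1 - z / of_nat (Suc N))" by (rule complex_Re_le_cmod)
    moreover have "Re (1 - z / of_nat (Suc N)) \<ge> 1"
      using assms by (simp add: Re_divide_of_nat divide_nonpos_pos del: of_nat_Suc)
    ultimately show ?thesis by linarith
  qed
  from norm_canon_ge[OF ne this] show ?thesis by simp
qed

lemma norm_canon_ge_Im:
  assumes "Im z \<noteq> 0"
  shows "norm (sin (of_real pi * z)) * \<bar>Im z\<bar> \<le> pi * norm z ^ 2 * (norm (1 - z) * norm (canon z))"
proof -
  have "norm (sin (of_real pi * z)) * (\<bar>Im z\<bar> / norm z) \<le> pi * norm z * (norm (1 - z) * norm (canon z))"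
    using assms by (intro norm_canon_ge ratio_ge) auto
  hence "norm (sin (of_real pi * z)) * (\<bar>Im z\<bar> / norm z) * norm z \<le> pi * norm z * (norm (1 - z) * norm (canon z)) * norm z"
    by (intro mult_right_mono) auto
  moreover have "z \<noteq> 0" using assms by auto
  ultimately show ?thesis by (simp add: power2_eq_square mult_ac)
qed

end

section \<open>Uniqueness of an entire function with the given zeros, and the genus-one
  product\<close>

context interlacing
begin

lemma zseq_real: "zseq k \<in> \<real>" by (auto simp: zseq_def)

lemma canon_nonzero_Im: "Im z \<noteq> 0 \<Longrightarrow> canon z \<noteq> 0"
  using zseq_real unfolding canon_eq_0_iff by (auto simp: complex_is_Real_iff)

text \<open>The quotient \<open>Q\<close> is entire because the zeros of \<open>canon\<close> are
  simple and G vanishes at them. Comparing numerator and denominator with |sin (pi z)| bounds it off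
  the axis, and \<open>lim\<close> yields Q (i y) = o(y), since on the imaginary axis
  \<open>canon\<close> loses only a factor of order y^2 against the sine.\<close>

lemma eq_canon_if_bounds:
  assumes hol: "G holomorphic_on UNIV" and zero: "\<And>k. G (zseq k) = 0"
    and bd: "\<And>z. norm (G z) \<le> C * exp (pi * \<bar>Im z\<bar>)" and C: "C \<ge> 0"
    and lim: "((\<lambda>y. norm (G (\<i> * of_real y)) * y / norm (sin (of_real pi * (\<i> * of_real y)))) \<longlongrightarrow> 0) at_top"
  shows "G z = G 0 * canon z"
proof -
  define Q where "Q = remove_sings (\<lambda>z. G z / canon z)"
  have ana: "(\<lambda>z. G z / canon z) analytic_on {z}" if "canon z \<noteq> 0" for z
    using that by (intro analytic_on_divide holomorphic_on_imp_analytic_at[OF hol] 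
        holomorphic_on_imp_analytic_at[OF holomorphic_canon[of UNIV]]) auto
  have Qeq: "Q z = G z / canon z" if "canon z \<noteq> 0" for z
    unfolding Q_def by (rule remove_sings_at_analytic[OF ana[OF that]])
  have holQ: "Q holomorphic_on UNIV"
  proof -
    have "Q analytic_on {z}" for z
    proof (cases "canon z = 0")
      case False
      thus ?thesis unfolding Q_def by (intro remove_sings_analytic_on ana)
    next
      case True
      hence zr: "z \<in> range zseq" by (simp add: canon_eq_0_iff)
      have "\<exists>w. canon w \<noteq> 0" by (intro exI[of _ 0]) simp
      then obtain r where r: "r > 0" "zor_poly canon z holomorphic_on cball z r"
        "\<And>w. w \<in> cball z r \<Longrightarrow> canon w = zor_poly canon z w * (w - z) ^ nat (zorder canon z) \<and> zor_poly canon z w \<noteq> 0"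
        using zorder_exist_zero[of canon UNIV z] holomorphic_canon[of UNIV] connected_UNIV by blast
      define g where "g = zor_poly canon z"
      have canon: "canon w = g w * (w - z)" "g w \<noteq> 0" if "w \<in> cball z r" for w
        using r(3)[OF that] zorder_canon[OF zr] by (simp_all add: g_def)
      have "((\<lambda>w. canon w) has_field_derivative g z) (at z)"
      proof (rule has_field_derivative_transform_within[where d = r])
        have "g field_differentiable at z"
          using r by (metis centre_in_ball g_def holomorphic_on_imp_differentiable_at holomorphic_on_subset open_ball ball_subset_cball)
        then obtain g' where "(g has_field_derivative g') (at z)" by (auto simp: field_differentiable_def)
        thus "((\<lambda>w. g w * (w - z)) has_field_derivative g z) (at z)"
          by (auto intro!: derivative_eq_intros)
        show "g w * (w - z) = canon w" if "dist w z < r" for w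
          using canon(1)[of w] that by (simp add: dist_commute)
      qed (use r in auto)
      moreover have "(G has_field_derivative deriv G z) (at z)"
        using holomorphic_derivI[OF hol] by auto
      moreover have "G z = 0" using zr zero by auto
      \<comment> \<open>At a simple zero the derivative \<open>g z\<close> of \<open>canon\<close>
        is nonzero, so the quotient has a finite limit and the singularity is removable.\<close>
      ultimately have "((\<lambda>w. G w / canon w) \<longlongrightarrow> deriv G z / g z) (at z)"
        using True canon(2)[of z] r(1) by (intro lhopital_complex_simple) auto
      moreover have "isolated_singularity_at (\<lambda>w. G w / canon w) z"
        using eventually_canon_nonzero[of z]
        by (intro isolated_singularity_at_divide isolated_singularity_at_analytic
              holomorphic_on_imp_analytic_at[OF hol] holomorphic_on_imp_analytic_at[OF holomorphic_canon[of UNIV]]) 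
           (auto intro!: not_essential_analytic holomorphic_on_imp_analytic_at[OF holomorphic_canon[of UNIV]])
      ultimately show ?thesis unfolding Q_def by (intro remove_sings_analytic_at)
    qed
    thus ?thesis by (metis UNIV_I analytic_imp_holomorphic analytic_on_analytic_at)
  qed
  have QG: "Q z * canon z = G z" for z
  proof (cases "canon z = 0")
    case True
    thus ?thesis using zero by (auto simp: canon_eq_0_iff)
  qed (simp add: Qeq)
  have weight: "(Im z)\<^sup>2 * norm (Q z) \<le> (8 * C) * (1 + norm z) ^ 4" for z
  proof (cases "Im z = 0")
    case True
    thus ?thesis using C by simp
  next
    case False
    define t where "t = pi * \<bar>Im z\<bar>"
    have t: "t > 0" using False by (simp add: t_def)
    have sp: "sinh t > 0" using t by simp
    have "sinh t * \<bar>Im z\<bar> \<le> norm (sin (of_real pi * z)) * \<bar>Im z\<bar>"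
      using norm_sin_ge_sinh[of "of_real pi * z"] by (intro mult_right_mono) (auto simp: t_def abs_mult)
    also have "\<dots> \<le> pi * norm z ^ 2 * (norm (1 - z) * norm (canon z))"
      by (rule norm_canon_ge_Im[OF False])
    finally have 1: "norm (Q z) * (sinh t * \<bar>Im z\<bar>) \<le> norm (Q z) * (pi * norm z ^ 2 * (norm (1 - z) * norm (canon z)))"
      by (intro mult_left_mono) auto
    \<comment> \<open>One factor |Im z| is consumed by the lower bound for \<open>canon\<close>; the
      second becomes the t that keeps exp t / sinh t under control near the axis.\<close>
    have "sinh t * ((Im z)\<^sup>2 * norm (Q z)) = \<bar>Im z\<bar> * (norm (Q z) * (sinh t * \<bar>Im z\<bar>))"
    proof -
      have "(Im z)\<^sup>2 = \<bar>Im z\<bar> * \<bar>Im z\<bar>" by (simp add: power2_eq_square)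
      thus ?thesis by (simp only: mult_ac)
    qed
    also have "\<dots> \<le> \<bar>Im z\<bar> * (norm (Q z) * (pi * norm z ^ 2 * (norm (1 - z) * norm (canon z))))"
      by (intro mult_left_mono 1) auto
    also have "\<dots> = t * norm z ^ 2 * norm (1 - z) * norm (G z)"
      unfolding QG[symmetric] norm_mult by (simp add: t_def)
    also have "\<dots> \<le> t * norm z ^ 2 * norm (1 - z) * (C * exp t)"
      using bd[of z] t by (intro mult_left_mono) (auto simp: t_def)
    also have "\<dots> = (norm z ^ 2 * norm (1 - z) * C) * (exp t * t)" by simp
    also have "\<dots> \<le> (norm z ^ 2 * norm (1 - z) * C) * (sinh t * (2 * t + 1))"
      using C by (intro mult_left_mono exp_le_sinh t) auto
    also have "\<dots> = sinh t * (norm z ^ 2 * norm (1 - z) * C * (2 * t + 1))" by simp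
    finally have "(Im z)\<^sup>2 * norm (Q z) \<le> norm z ^ 2 * norm (1 - z) * C * (2 * t + 1)"
      using sp by simp
    also have "\<dots> \<le> (1 + norm z) ^ 2 * (1 + norm z) * C * (8 * (1 + norm z))"
    proof (intro mult_mono power_mono)
      show "norm (1 - z) \<le> 1 + norm z" using norm_triangle_ineq4[of 1 z] by simp
      have "2 * t \<le> 2 * (4 * norm z)"
        unfolding t_def using pi_less_4 abs_Im_le_cmod[of z] by (intro mult_left_mono mult_mono) auto
      thus "2 * t + 1 \<le> 8 * (1 + norm z)" by simp
    qed (use C t in auto)
    also have "\<dots> = (8 * C) * (1 + norm z) ^ 4" by (simp add: eval_nat_numeral)
    finally show ?thesis .
  qed
  have limQ: "((\<lambda>y. norm (Q (\<i> * of_real y)) / y) \<longlongrightarrow> 0) at_top"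
  proof (rule tendsto_sandwich[OF _ _ tendsto_const])
    show "((\<lambda>y. 2 * pi * (norm (G (\<i> * of_real y)) * y / norm (sin (of_real pi * (\<i> * of_real y))))) \<longlongrightarrow> 0) at_top"
      using tendsto_mult_left[OF lim, of "2 * pi"] by simp
    show "\<forall>\<^sub>F y in at_top. 0 \<le> norm (Q (\<i> * of_real y)) / y"
      using eventually_gt_at_top[of 0] by eventually_elim auto
    show "\<forall>\<^sub>F y in at_top. norm (Q (\<i> * of_real y)) / y \<le>
       2 * pi * (norm (G (\<i> * of_real y)) * y / norm (sin (of_real pi * (\<i> * of_real y))))"
      using eventually_gt_at_top[of 1]
    proof eventually_elim
      case (elim y)
      define z where "z = \<i> * of_real y"
      have z: "Re z = 0" "Im z = y" "norm z = y" using elim by (simp_all add: z_def norm_mult)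
      have nz: "norm (canon z) > 0" using canon_nonzero_Im[of z] elim z by simp
      have "sinh (pi * y) > 0" using elim by simp
      also have "sinh (pi * y) \<le> norm (sin (of_real pi * z))"
        using norm_sin_ge_sinh[of "of_real pi * z"] z elim by (simp add: abs_mult)
      finally have sp: "norm (sin (of_real pi * z)) > 0" .
      have "norm (sin (of_real pi * z)) \<le> pi * norm z * (norm (1 - z) * norm (canon z))"
        by (rule norm_canon_ge_left) (simp add: z)
      also have "\<dots> \<le> pi * y * (2 * y * norm (canon z))"
        using norm_triangle_ineq4[of 1 z] elim z unfolding z(3) by (intro mult_left_mono mult_right_mono) auto
      finally have "norm (Q z) * norm (sin (of_real pi * z)) \<le> norm (Q z) * (pi * y * (2 * y * norm (canon z)))"
        by (intro mult_left_mono) auto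
      also have "\<dots> = 2 * pi * y ^ 2 * norm (G z)"
        unfolding QG[symmetric] norm_mult by (simp add: power2_eq_square)
      finally show ?case
        unfolding z_def[symmetric] using sp elim by (simp add: field_simps power2_eq_square)
    qed
  qed
  have "Q z = Q 0"
    by (rule constant_if_weighted_Im[OF holQ weight _ limQ]) (use C in simp)
  moreover have "Q 0 = G 0" using Qeq[of 0] by simp
  ultimately show ?thesis using QG[of z] by simp
qed

text \<open>A genus-one factor (1 - w) exp w is 1 + O(w^2), so only the exponential in front
  contributes at 0.\<close>

lemma deriv_canon_0: "deriv canon 0 = of_real sigma"
proof -
  define P where "P = (\<lambda>N z. \<Prod>n<N. weierstrass_factor 1 (z / zseq n))"
  have wf: "weierstrass_factor 1 w = (1 - w) * exp w" for w by (simp add: weierstrass_factor_def)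
  have dP: "(P N has_field_derivative 0) (at 0) \<and> P N 0 = 1" for N
  proof (induction N)
    case (Suc N)
    have "((\<lambda>z. weierstrass_factor 1 (z / zseq N)) has_field_derivative 0) (at 0)"
      unfolding wf by (auto intro!: derivative_eq_intros simp: W.a_nonzero)
    from DERIV_mult[OF conjunct1[OF Suc.IH] this] Suc.IH show ?case
      by (simp add: P_def wf)
  qed (simp add: P_def)
  have "((\<lambda>N. (deriv ^^ 1) (P N) 0) \<longlongrightarrow> (deriv ^^ 1) W.f 0) sequentially"
  proof (rule higher_deriv_complex_uniform_limit[where A = "ball 0 1"])
    show "uniform_limit (ball 0 1) P W.f sequentially"
      unfolding P_def by (rule uniform_limit_on_subset[OF W.uniform_limit[of 1]]) auto
    show "\<forall>\<^sub>F N in sequentially. P N holomorphic_on ball 0 1"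
      unfolding P_def by (intro always_eventually allI holomorphic_intros) (auto simp: W.a_nonzero)
  qed auto
  moreover have "deriv (P N) 0 = 0" for N using dP[of N] by (auto intro: DERIV_imp_deriv)
  ultimately have f0: "deriv W.f 0 = 0" by (simp add: LIMSEQ_const_iff)
  have "W.f field_differentiable at 0"
    using W.holomorphic[of UNIV] by (auto simp: holomorphic_on_def)
  hence "(W.f has_field_derivative 0) (at 0)" using f0 by (metis DERIV_deriv_iff_field_differentiable)
  moreover have "W.f 0 = 1" using canon_0 by (simp add: canon_def)
  ultimately have "(canon has_field_derivative of_real sigma) (at 0)"
    unfolding canon_def[abs_def] by (auto intro!: derivative_eq_intros)
  thus ?thesis by (rule DERIV_imp_deriv)
qed

text \<open>The Weierstrass product converges along initial segments, whereas here the limit is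
  along the net of finite sets of zeros. If F contains the first m zeros, the product of its other
  factors differs from 1 by at most exp (tail) - 1, uniformly in F and on the disc.\<close>

lemma locally_uniform_limit_genus_one:
  "locally_uniform_limit (\<lambda>F z. \<Prod>w\<in>F. (1 - z / w) * exp (z / w)) W.f (finite_subsets_at_top (range zseq))"
  unfolding locally_uniform_limit_def
proof safe
  fix K :: "complex set" assume "compact K"
  then obtain R where R: "R > 0" "K \<subseteq> cball 0 R" by (rule compact_subset_cball_0)
  define wf where "wf = (\<lambda>k z. weierstrass_factor 1 (z / zseq k))"
  have wf: "(1 - z / zseq k) * exp (z / zseq k) = wf k z" for k z
    by (simp add: wf_def weierstrass_factor_def)
  define b where "b = (\<lambda>k. 3 * (R / norm (zseq k)) ^ Suc 1)"
  have sb: "summable b" unfolding b_def by (intro summable_mult summable_zseq R)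
  have b0: "b k \<ge> 0" for k unfolding b_def using R by simp
  have "eventually (\<lambda>k. norm (zseq k) \<ge> 2 * R) sequentially"
    using W.filterlim_a by (metis filterlim_at_infinity_imp_norm_at_top filterlim_at_top)
  then obtain k0 where k0: "\<And>k. k \<ge> k0 \<Longrightarrow> norm (zseq k) \<ge> 2 * R"
    by (auto simp: eventually_at_top_linorder)
  have wfb: "norm (wf k z - 1) \<le> b k" if "k \<ge> k0" "z \<in> cball 0 R" for k z
  proof -
    have pos: "norm (zseq k) > 0" using W.a_nonzero by simp
    have zR: "norm z \<le> R" using that by simp
    have "norm (z / zseq k) \<le> 1 / 2" using k0[OF that(1)] zR pos by (simp add: norm_divide field_simps)
    hence "norm (wf k z - 1) \<le> 3 * norm (z / zseq k) ^ Suc 1"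
      unfolding wf_def by (rule weierstrass_factor_bound)
    also have "\<dots> \<le> b k" unfolding b_def norm_divide using zR
      by (intro mult_left_mono power_mono divide_right_mono) auto
    finally show ?thesis .
  qed
  have "bounded (W.f ` cball 0 R)"
    by (intro compact_imp_bounded compact_continuous_image holomorphic_on_imp_continuous_on W.holomorphic) auto
  then obtain M where M: "M > 0" "\<And>z. z \<in> cball 0 R \<Longrightarrow> norm (W.f z) \<le> M"
    by (auto simp: bounded_pos)
  have U: "uniform_limit (cball 0 R) (\<lambda>N z. \<Prod>n<N. wf n z) W.f sequentially"
    using W.uniform_limit[OF R(1)] by (simp add: wf_def)
  show "uniform_limit K (\<lambda>F z. \<Prod>w\<in>F. (1 - z / w) * exp (z / w)) W.f (finite_subsets_at_top (range zseq))"
  proof (rule uniform_limitI)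
    fix e :: real assume e: "e > 0"
    have tail: "(\<lambda>m. \<Sum>k. b (k + m)) \<longlonglongrightarrow> 0" by (rule suminf_exist_split2[OF sb])
    hence "(\<lambda>m. (M + 1) * (exp (\<Sum>k. b (k + m)) - 1)) \<longlonglongrightarrow> (M + 1) * (exp 0 - 1)"
      by (intro tendsto_intros)
    hence "eventually (\<lambda>m. (M + 1) * (exp (\<Sum>k. b (k + m)) - 1) < e / 2) sequentially"
      using e by (intro order_tendstoD) auto
    \<comment> \<open>The 1 in the minimum bounds the initial product by M + 1.\<close>
    moreover have "eventually (\<lambda>N. \<forall>z\<in>cball 0 R. dist (\<Prod>n<N. wf n z) (W.f z) < min 1 (e / 2)) sequentially"
      using e by (intro uniform_limitD[OF U]) auto
    ultimately have "eventually (\<lambda>m. (M + 1) * (exp (\<Sum>k. b (k + m)) - 1) < e / 2 \<and>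
        (\<forall>z\<in>cball 0 R. dist (\<Prod>n<m. wf n z) (W.f z) < min 1 (e / 2)) \<and> m \<ge> k0) sequentially"
      using eventually_ge_at_top[of k0] by eventually_elim auto
    then obtain m where m: "(M + 1) * (exp (\<Sum>k. b (k + m)) - 1) < e / 2" "m \<ge> k0"
      "\<And>z. z \<in> cball 0 R \<Longrightarrow> dist (\<Prod>n<m. wf n z) (W.f z) < min 1 (e / 2)"
      by (auto simp: eventually_at_top_linorder)
    show "\<forall>\<^sub>F F in finite_subsets_at_top (range zseq). \<forall>z\<in>K. dist (\<Prod>w\<in>F. (1 - z / w) * exp (z / w)) (W.f z) < e"
      unfolding eventually_finite_subsets_at_top
    proof (intro exI[of _ "zseq ` {..<m}"] conjI allI impI ballI)
      fix F z assume F: "finite F \<and> zseq ` {..<m} \<subseteq> F \<and> F \<subseteq> range zseq" and z: "z \<in> K"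
      have zR: "z \<in> cball 0 R" using z R by auto
      define J where "J = zseq -` F"
      have J: "F = zseq ` J" "{..<m} \<subseteq> J" using F by (auto simp: J_def)
      have finJ: "finite J" unfolding J_def using F inj_zseq by (intro finite_vimageI) auto
      have "(\<Prod>w\<in>F. (1 - z / w) * exp (z / w)) = (\<Prod>k\<in>J. wf k z)"
        unfolding J(1) by (subst prod.reindex) (auto intro: inj_on_subset[OF inj_zseq] simp: wf)
      also have "\<dots> = (\<Prod>k<m. wf k z) * (\<Prod>k\<in>J-{..<m}. wf k z)"
        using prod.subset_diff[OF J(2) finJ, of "\<lambda>k. wf k z"] by (simp add: mult.commute)
      finally have split: "(\<Prod>w\<in>F. (1 - z / w) * exp (z / w)) = (\<Prod>k<m. wf k z) * (\<Prod>k\<in>J-{..<m}. wf k z)" .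
      have "norm ((\<Prod>k\<in>J-{..<m}. 1 + (wf k z - 1)) - 1) \<le> (\<Prod>k\<in>J-{..<m}. 1 + norm (wf k z - 1)) - 1"
        by (rule norm_prod_minus1_le_prod_minus1)
      also have "(\<Prod>k\<in>J-{..<m}. 1 + norm (wf k z - 1)) \<le> exp (\<Sum>k\<in>J-{..<m}. norm (wf k z - 1))"
        by (rule prod_le_exp_sum) auto
      also have "(\<Sum>k\<in>J-{..<m}. norm (wf k z - 1)) \<le> (\<Sum>k\<in>J-{..<m}. b k)"
        using m(2) zR by (intro sum_mono wfb) auto
      also have "\<dots> = (\<Sum>k\<in>(\<lambda>k. k - m) ` (J - {..<m}). b (k + m))"
        by (subst sum.reindex) (auto simp: inj_on_def)
      also have "\<dots> \<le> (\<Sum>k. b (k + m))"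
        using finJ b0 summable_ignore_initial_segment[OF sb, of m] by (intro sum_le_suminf) auto
      finally have rest: "norm ((\<Prod>k\<in>J-{..<m}. wf k z) - 1) \<le> exp (\<Sum>k. b (k + m)) - 1" by simp
      have d: "norm ((\<Prod>k<m. wf k z) - W.f z) < min 1 (e / 2)" using m(3)[OF zR] by (simp add: dist_norm)
      have "norm (\<Prod>k<m. wf k z) \<le> norm (W.f z) + norm ((\<Prod>k<m. wf k z) - W.f z)"
        using norm_triangle_ineq[of "W.f z" "(\<Prod>k<m. wf k z) - W.f z"] by simp
      hence Mb: "norm (\<Prod>k<m. wf k z) \<le> M + 1" using d M(2)[OF zR] by linarith
      have "dist (\<Prod>w\<in>F. (1 - z / w) * exp (z / w)) (W.f z) =
         norm ((\<Prod>k<m. wf k z) * ((\<Prod>k\<in>J-{..<m}. wf k z) - 1) + ((\<Prod>k<m. wf k z) - W.f z))"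
        unfolding split dist_norm by (simp add: algebra_simps)
      also have "\<dots> \<le> norm (\<Prod>k<m. wf k z) * norm ((\<Prod>k\<in>J-{..<m}. wf k z) - 1) + norm ((\<Prod>k<m. wf k z) - W.f z)"
        by (rule order.trans[OF norm_triangle_ineq]) (simp add: norm_mult)
      also have "norm (\<Prod>k<m. wf k z) * norm ((\<Prod>k\<in>J-{..<m}. wf k z) - 1) \<le> (M + 1) * (exp (\<Sum>k. b (k + m)) - 1)"
        using Mb rest M by (intro mult_mono) auto
      finally show "dist (\<Prod>w\<in>F. (1 - z / w) * exp (z / w)) (W.f z) < e" using m(1) d by simp
    qed (auto)
  qed
qed

lemma has_genus_one_product_canon: "has_genus_one_product canon (of_real sigma) (range zseq)"
  unfolding has_genus_one_product_def
proof (intro conjI)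
  have "(\<lambda>n. 1 / norm (zseq n) ^ 2) summable_on UNIV"
  proof (rule norm_summable_imp_summable_on)
    show "summable (\<lambda>n. norm (1 / norm (zseq n) ^ 2))"
      using summable_zseq[of 1] by (simp add: power_divide numeral_2_eq_2)
  qed
  thus "(\<lambda>w. 1 / norm w ^ 2) summable_on range zseq"
    using summable_on_reindex[OF inj_zseq, of "\<lambda>w. 1 / norm w ^ 2"] by (simp add: o_def)
  show "\<not> (\<lambda>w. 1 / norm w) summable_on range zseq"
  proof
    assume "(\<lambda>w. 1 / norm w) summable_on range zseq"
    \<comment> \<open>The negative integers alone already produce the harmonic series.\<close>
    hence "(\<lambda>w. 1 / norm w) summable_on (range (\<lambda>n. zseq (2 * n)))"
      by (rule summable_on_subset_banach) auto
    moreover have "inj (\<lambda>n. zseq (2 * n))" by (auto simp: inj_def dest: injD[OF inj_zseq])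
    ultimately have "((\<lambda>w. 1 / norm w) \<circ> (\<lambda>n. zseq (2 * n))) summable_on UNIV"
      using summable_on_reindex[of "\<lambda>n. zseq (2 * n)" UNIV "\<lambda>w. 1 / norm w"] by simp
    hence "(\<lambda>n. 1 / real (Suc n)) summable_on UNIV"
      by (simp add: o_def zseq_simps del: of_nat_Suc)
    hence "summable (\<lambda>n. 1 / real (Suc n))" by (rule summable_on_UNIV_nonneg_real_iff[THEN iffD1, rotated]) auto
    hence "summable (\<lambda>n. 1 / real n)" by (subst (asm) summable_Suc_iff)
    thus False using not_summable_harmonic[where 'a = real] by (simp add: divide_inverse)
  qed
  show "locally_uniform_limit (\<lambda>F z. exp (of_real sigma * z) * (\<Prod>w\<in>F. (1 - z / w) * exp (z / w))) canon
     (finite_subsets_at_top (range zseq))"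
    unfolding locally_uniform_limit_def canon_def[abs_def]
  proof safe
    fix K :: "complex set" assume K: "compact K"
    show "uniform_limit K (\<lambda>F z. exp (of_real sigma * z) * (\<Prod>w\<in>F. (1 - z / w) * exp (z / w)))
       (\<lambda>z. exp (of_real sigma * z) * W.f z) (finite_subsets_at_top (range zseq))"
    proof (rule uniform_lim_mult[OF uniform_limit_const])
      show "uniform_limit K (\<lambda>F z. \<Prod>w\<in>F. (1 - z / w) * exp (z / w)) W.f (finite_subsets_at_top (range zseq))"
        using K locally_uniform_limit_genus_one by (simp add: locally_uniform_limit_def)
      show "bounded ((\<lambda>z. exp (of_real sigma * z)) ` K)"
        by (intro compact_imp_bounded compact_continuous_image continuous_intros K)
      show "bounded (W.f ` K)"
        by (intro compact_imp_bounded compact_continuous_image holomorphic_on_imp_continuous_on W.holomorphic K)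
    qed
  qed
qed

lemma map_poly_of_real_mult:
  "map_poly of_real (p * q) = map_poly of_real p * (map_poly of_real q :: complex poly)"
  by (rule poly_eqI) (simp add: coeff_map_poly coeff_mult)

lemma map_poly_of_real_prod:
  "map_poly of_real (\<Prod>i\<in>A. p i) = (\<Prod>i\<in>A. map_poly of_real (p i) :: complex poly)"
  by (induction A rule: infinite_finite_induct) (simp_all add: map_poly_of_real_mult)

text \<open>The partial paired products are themselves real polynomials with real zeros.\<close>

lemma canon_laguerre_polya: "canon \<in> laguerre_polya_class"
proof -
  define p where "p = (\<lambda>N. \<Prod>n=1..N. [:1, 1 / real n:] * [:1, - 1 / \<rho> n:])"
  have "poly (map_poly of_real (p N)) z = pprod N z" for N z
  proof -
    have "map_poly of_real (p N) = (\<Prod>n=1..N. [:1, 1 / of_nat n:] * [:1, - 1 / of_real (\<rho> n):] :: complex poly)"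
      unfolding p_def by (simp add: map_poly_of_real_prod map_poly_pCons map_poly_of_real_mult del: mult_pCons_left mult_pCons_right)
    thus ?thesis by (simp add: poly_prod pprod_def del: mult_pCons_left mult_pCons_right)
  qed
  hence eq: "poly (map_poly of_real (p N)) = pprod N" for N by (simp add: fun_eq_iff)
  have zr: "zeros (pprod N) \<subseteq> \<real>" for N
  proof
    fix z assume "z \<in> zeros (pprod N)"
    then obtain n where n: "n \<in> {1..N}" "1 + z / of_nat n = 0 \<or> 1 - z / of_real (\<rho> n) = 0"
      by (auto simp: zeros_def pprod_def)
    have "z = - of_nat n \<or> z = of_real (\<rho> n)"
      using n rho_pos[of n] by (auto simp: field_simps add_eq_0_iff)
    thus "z \<in> \<real>" by auto
  qed
  thus ?thesis unfolding laguerre_polya_class_def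
    using locally_uniform_limit_pprod zr by (intro CollectI exI[of _ p]) (simp add: eq)
qed

end

section \<open>The Gregory function as a product\<close>

text \<open>Log-convexity of Gamma, used twice: s - x lies between s - 1 and s, and s lies between s
  - x and s + 1.\<close>

lemma Gamma_ratio_bounds:
  fixes s x :: real
  assumes s: "s > 1" and x: "x \<in> {0..1}"
  shows "s powr (- x) \<le> Gamma (s - x) / Gamma s" "Gamma (s - x) / Gamma s \<le> (s - 1) powr (- x)"
proof -
  note cv = log_convex_Gamma_real
  have pos: "Gamma (s - x) > 0" "Gamma s > 0" "Gamma (s - 1) > 0" using s x by (auto intro!: Gamma_real_pos)
  have G1: "Gamma s = (s - 1) * Gamma (s - 1)"
  proof -
    have "s - 1 \<notin> \<int>\<^sub>\<le>\<^sub>0" using s by (auto elim!: nonpos_Ints_cases)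
    from Gamma_plus1[OF this] show ?thesis by simp
  qed
  have G2: "Gamma (s + 1) = s * Gamma s"
  proof -
    have "s \<notin> \<int>\<^sub>\<le>\<^sub>0" using s by (auto elim!: nonpos_Ints_cases)
    from Gamma_plus1[OF this] show ?thesis .
  qed
  have "ln (Gamma ((1 - x) * s + x * (s - 1))) \<le> (1 - x) * ln (Gamma s) + x * ln (Gamma (s - 1))"
    using convex_onD[OF cv, of x s "s - 1"] s x by simp
  also have "(1 - x) * s + x * (s - 1) = s - x" by (simp add: algebra_simps)
  also have "ln (Gamma (s - 1)) = ln (Gamma s) - ln (s - 1)"
    unfolding G1 using s pos(3) ln_mult_pos[of "s - 1" "Gamma (s - 1)"] by simp
  finally have "ln (Gamma (s - x)) - ln (Gamma s) \<le> - x * ln (s - 1)" by (simp add: algebra_simps)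
  hence "exp (ln (Gamma (s - x)) - ln (Gamma s)) \<le> exp (- x * ln (s - 1))" by (subst exp_le_cancel_iff)
  thus "Gamma (s - x) / Gamma s \<le> (s - 1) powr (- x)"
    using pos s by (simp add: exp_diff powr_def)
  \<comment> \<open>Chosen so that (1 - t) (s - x) + t (s + 1) = s.\<close>
  define t where "t = x / (1 + x)"
  have t: "0 \<le> t" "t \<le> 1" "(1 + x) * t = x" "(1 + x) * (1 - t) = 1" using x by (auto simp: t_def field_simps)
  have "ln (Gamma ((1 - t) * (s - x) + t * (s + 1))) \<le> (1 - t) * ln (Gamma (s - x)) + t * ln (Gamma (s + 1))"
    using convex_onD[OF cv, of t "s - x" "s + 1"] s x t by simp
  also have "(1 - t) * (s - x) + t * (s + 1) = s - x + (1 + x) * t" by (simp add: algebra_simps)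
  also have "\<dots> = s" using t(3) by simp
  finally have "(1 + x) * ln (Gamma s) \<le> (1 + x) * ((1 - t) * ln (Gamma (s - x)) + t * ln (Gamma (s + 1)))"
    using x by (intro mult_left_mono) auto
  also have "\<dots> = ((1 + x) * (1 - t)) * ln (Gamma (s - x)) + ((1 + x) * t) * ln (Gamma (s + 1))"
    by (simp only: distrib_left mult.assoc)
  also have "\<dots> = ln (Gamma (s - x)) + x * ln (Gamma (s + 1))" unfolding t by simp
  also have "ln (Gamma (s + 1)) = ln s + ln (Gamma s)"
    unfolding G2 using s pos(2) ln_mult_pos[of s "Gamma s"] by simp
  finally have "- x * ln s \<le> ln (Gamma (s - x)) - ln (Gamma s)" by (simp add: algebra_simps)
  hence "exp (- x * ln s) \<le> exp (ln (Gamma (s - x)) - ln (Gamma s))" by (subst exp_le_cancel_iff)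
  thus "s powr (- x) \<le> Gamma (s - x) / Gamma s"
    using pos s by (simp add: exp_diff powr_def)
qed

text \<open>At z = 0 the integrand is \<gamma> + Digamma (x + 1), with primitive \<gamma> x + ln
  Gamma (x + 1); the logarithm vanishes at both ends.\<close>

lemma gregory_has_field_derivative_0: "(gregory has_field_derivative of_real euler_mascheroni) (at 0)"
proof -
  define g' :: "real \<Rightarrow> complex" where "g' = (\<lambda>x. of_real (Gamma (x + 1)) *
    (deriv rGamma (0 + 1) * rGamma (of_real x - 0 + 1) - rGamma (0 + 1) * deriv rGamma (of_real x - 0 + 1)))"
  have "(gregory has_field_derivative integral {0..1} g') (at 0)"
    unfolding g'_def by (rule gregory_has_field_derivative)
  moreover have "(g' has_integral of_real euler_mascheroni) {0..1}"
  proof -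
    have "((\<lambda>x. euler_mascheroni + Digamma (x + 1)) has_integral
             ((euler_mascheroni * 1 + ln_Gamma (1 + 1)) - (euler_mascheroni * 0 + ln_Gamma (0 + 1 :: real)))) {0..1}"
    proof (rule fundamental_theorem_of_calculus)
      fix x :: real assume x: "x \<in> {0..1}"
      have "((\<lambda>x. euler_mascheroni * x + ln_Gamma (x + 1)) has_real_derivative
               (euler_mascheroni + Digamma (x + 1))) (at x within {0..1})"
        using x by (auto intro!: derivative_eq_intros)
      thus "((\<lambda>x. euler_mascheroni * x + ln_Gamma (x + 1)) has_vector_derivative
               (euler_mascheroni + Digamma (x + 1))) (at x within {0..1})"
        by (simp flip: has_real_derivative_iff_has_vector_derivative)
    qed auto
    hence "((\<lambda>x::real. euler_mascheroni + Digamma (x + 1) :: real) has_integral euler_mascheroni) {0..1}"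
      by (simp add: ln_Gamma_real_pos Gamma_numeral)
    hence "((\<lambda>x. complex_of_real (euler_mascheroni + Digamma (x + 1))) has_integral of_real euler_mascheroni) {0..1}"
      by (rule has_integral_of_real)
    moreover have "g' x = complex_of_real (euler_mascheroni + Digamma (x + 1))" if "x \<in> {0..1}" for x
    proof -
      have dr: "deriv rGamma w = - rGamma w * Digamma w" if "Re w > 0" for w :: complex
        using that by (intro DERIV_imp_deriv has_field_derivative_rGamma_no_nonpos_int)
          (auto elim!: nonpos_Ints_cases)
      have gr: "complex_of_real (Gamma (x + 1)) * rGamma (of_real x + 1) = 1"
      proof -
        have "Gamma (x + 1) > 0" using that by simp
        thus ?thesis using rGamma_complex_of_real[of "x + 1"] by (simp add: rGamma_inverse_Gamma)
      qed
      have dg: "Digamma (of_real x + 1) = complex_of_real (Digamma (x + 1))"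
        using Polygamma_of_real[of "x + 1" 0, where 'a = complex] that by simp
      have "g' x = (complex_of_real (Gamma (x + 1)) * rGamma (of_real x + 1)) * (of_real euler_mascheroni + Digamma (of_real x + 1))"
        using that dr[of 1] dr[of "of_real x + 1"] unfolding g'_def by (simp add: algebra_simps)
      thus ?thesis unfolding gr dg by simp
    qed
    ultimately show ?thesis by (subst has_integral_cong) auto
  qed
  hence "integral {0..1} g' = of_real euler_mascheroni" by (rule integral_unique)
  ultimately show ?thesis by simp
qed

text \<open>The first N factors of the Gamma quotient are split off. Each costs at most 1 + 1 / y
  because |w + k| \<ge> y. The rest is a quotient at real part N + 1; multiplied by Gamma (1 + x),
  it is bounded by the reciprocal of the product of 1 + x / k over k \<le> N, hence by 1 / (1 + x H)
  with the harmonic number H. For fixed N and large y this is a real gain.\<close>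

lemma norm_rGamma_vertical_le:
  assumes y: "y > 0" and x: "x \<in> {0..1}"
  defines "w \<equiv> 1 - \<i> * of_real y"
  shows "Gamma (1 + x) * norm (rGamma (w + of_real x)) \<le> (1 + 1 / y) ^ N / (1 + x * harm N) * norm (rGamma w)"
proof -
  have Re: "Re w = 1" "Im w = - y" by (simp_all add: w_def)
  have wk: "norm (w + of_nat k) \<ge> y" for k using abs_Im_le_cmod[of "w + of_nat k"] y Re by simp
  have wnz: "w + of_nat k \<noteq> 0" for k using wk[of k] y by auto
  have ph: "norm (pochhammer (w + of_real x) N) \<le> norm (pochhammer w N) * (1 + 1 / y) ^ N"
  proof -
    have "norm (pochhammer (w + of_real x) N) = (\<Prod>k=0..<N. norm (w + of_real x + of_nat k))"
      by (simp add: pochhammer_prod prod_norm)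
    also have "\<dots> \<le> (\<Prod>k=0..<N. norm (w + of_nat k) * (1 + 1 / y))"
    proof (intro prod_mono conjI norm_ge_zero)
      fix k
      have "norm (w + of_real x + of_nat k) \<le> norm (w + of_nat k) + norm (of_real x :: complex)"
        using norm_triangle_ineq[of "w + of_nat k" "of_real x"] by (simp add: add_ac)
      also have "norm (of_real x :: complex) \<le> y * (1 / y)" unfolding norm_of_real using x y by simp
      also have "y * (1 / y) \<le> norm (w + of_nat k) * (1 / y)" using wk[of k] y by (intro mult_right_mono) auto
      finally show "norm (w + of_real x + of_nat k) \<le> norm (w + of_nat k) * (1 + 1 / y)"
        by (simp add: distrib_left)
    qed
    also have "\<dots> = norm (pochhammer w N) * (1 + 1 / y) ^ N"
      by (simp add: prod.distrib pochhammer_prod prod_norm)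
    finally show ?thesis .
  qed
  have pos: "Gamma (1 + x) > 0" "Gamma (1 + real N + x) > 0" "Gamma (1 + real N) > 0"
    using x by (auto intro!: Gamma_real_pos)
  have harm: "harm N \<ge> (0::real)" by (rule harm_nonneg)
  hence h1: "1 + x * harm N > 0" using x by (intro add_pos_nonneg mult_nonneg_nonneg) auto
  have Gr: "Gamma (1 + x) * (Gamma (1 + real N) / Gamma (1 + real N + x)) \<le> 1 / (1 + x * harm N)"
  proof -
    have ni: "1 + x \<notin> \<int>\<^sub>\<le>\<^sub>0" using x by (auto elim!: nonpos_Ints_cases)
    have G: "Gamma (1 + real N + x) = pochhammer (1 + x) N * Gamma (1 + x)"
      using pochhammer_Gamma[OF ni, of N] pos by (simp add: add_ac)
    have F: "Gamma (1 + real N) = fact N" using Gamma_fact[of N, where 'a = real] by simp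
    have "1 + x * harm N = 1 + (\<Sum>k=1..N. x / real k)"
      by (simp add: harm_def sum_distrib_left divide_inverse)
    also have "\<dots> \<le> (\<Prod>k=1..N. 1 + x / real k)"
    proof -
      have "1 + (\<Sum>k=1..N. x / real k) \<le> (\<Prod>k=1..N. 1 + x / real k)" for N
      proof (induction N)
        case (Suc N)
        have "1 + (\<Sum>k=1..Suc N. x / real k) \<le> (1 + (\<Sum>k=1..N. x / real k)) * (1 + x / real (Suc N))"
        proof -
          have "(\<Sum>k=1..N. x / real k) * (x / real (Suc N)) \<ge> 0"
            using x by (intro mult_nonneg_nonneg sum_nonneg) auto
          thus ?thesis by (simp add: algebra_simps del: of_nat_Suc)
        qed
        also have "\<dots> \<le> (\<Prod>k=1..N. 1 + x / real k) * (1 + x / real (Suc N))"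
          using Suc.IH x by (intro mult_right_mono) auto
        finally show ?case by simp
      qed auto
      thus ?thesis .
    qed
    also have "\<dots> = pochhammer (1 + x) N / fact N"
    proof -
      have "(\<Prod>k=1..N. 1 + x / real k) = (\<Prod>k=1..N. (real k + x) / real k)"
        by (intro prod.cong) (auto simp: field_simps)
      also have "\<dots> = (\<Prod>k=1..N. real k + x) / fact N" by (simp add: prod_dividef fact_prod)
      also have "(\<Prod>k=1..N. real k + x) = pochhammer (1 + x) N"
        unfolding pochhammer_prod
        by (rule prod.reindex_bij_witness[of _ Suc "\<lambda>i. i - 1"]) (auto simp: of_nat_diff)
      finally show ?thesis .
    qed
    finally have le: "1 + x * harm N \<le> pochhammer (1 + x) N / fact N" .
    have pp: "pochhammer (1 + x) N > 0" using x by (intro pochhammer_pos) auto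
    have "Gamma (1 + x) * (Gamma (1 + real N) / Gamma (1 + real N + x)) = 1 / (pochhammer (1 + x) N / fact N)"
      unfolding G F using pos by simp
    also have "\<dots> \<le> 1 / (1 + x * harm N)" using le h1 pp by (intro divide_left_mono) auto
    finally show ?thesis .
  qed
  have ni: "w + of_nat N \<notin> \<int>\<^sub>\<le>\<^sub>0"
    using Re by (auto elim!: nonpos_Ints_cases simp: complex_eq_iff)
  hence gnz: "norm (Gamma (w + of_nat N)) > 0" by (simp add: Gamma_eq_zero_iff)
  have "norm (Gamma (w + of_nat N) / Gamma (w + of_nat N + of_real x)) \<le> Gamma (1 + real N) / Gamma (1 + real N + x)"
    using x Re by (intro norm_Gamma_quotient_le) auto
  hence "norm (Gamma (w + of_nat N)) * norm (rGamma (w + of_nat N + of_real x)) \<le> Gamma (1 + real N) / Gamma (1 + real N + x)"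
    by (simp only: rGamma_inverse_Gamma norm_mult norm_inverse divide_inverse)
  hence "norm (rGamma (w + of_nat N + of_real x)) \<le> Gamma (1 + real N) / Gamma (1 + real N + x) / norm (Gamma (w + of_nat N))"
    using gnz by (simp only: pos_le_divide_eq mult.commute)
  hence "norm (rGamma (w + of_nat N + of_real x)) \<le> Gamma (1 + real N) / Gamma (1 + real N + x) * norm (rGamma (w + of_nat N))"
    by (simp only: rGamma_inverse_Gamma norm_inverse divide_inverse)
  hence "Gamma (1 + x) * norm (rGamma (w + of_nat N + of_real x)) \<le>
      Gamma (1 + x) * (Gamma (1 + real N) / Gamma (1 + real N + x) * norm (rGamma (w + of_nat N)))"
    using pos by (intro mult_left_mono) auto
  also have "\<dots> = Gamma (1 + x) * (Gamma (1 + real N) / Gamma (1 + real N + x)) * norm (rGamma (w + of_nat N))"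
    by simp
  also have "\<dots> \<le> 1 / (1 + x * harm N) * norm (rGamma (w + of_nat N))"
    by (intro mult_right_mono Gr) auto
  finally have main: "Gamma (1 + x) * norm (rGamma (w + of_nat N + of_real x)) \<le> 1 / (1 + x * harm N) * norm (rGamma (w + of_nat N))" .
  have "Gamma (1 + x) * norm (rGamma (w + of_real x)) =
     norm (pochhammer (w + of_real x) N) * (Gamma (1 + x) * norm (rGamma (w + of_nat N + of_real x)))"
    by (subst pochhammer_rGamma[of "w + of_real x" N]) (simp add: norm_mult add_ac)
  also have "\<dots> \<le> (norm (pochhammer w N) * (1 + 1 / y) ^ N) * (1 / (1 + x * harm N) * norm (rGamma (w + of_nat N)))"
    using y pos by (intro mult_mono ph main) auto
  also have "\<dots> = (1 + 1 / y) ^ N / (1 + x * harm N) * norm (rGamma w)"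
  proof -
    have "norm (rGamma w) = norm (pochhammer w N) * norm (rGamma (w + of_nat N))"
      by (subst pochhammer_rGamma[of w N]) (rule norm_mult)
    thus ?thesis by simp
  qed
  finally show ?thesis .
qed

text \<open>Integrating 1 / (1 + x H) over x gives ln (1 + H) / H, and the factor y completes the
  two reciprocal Gamma values to the sine.\<close>

lemma norm_gregory_vertical_le:
  assumes y: "y > 0" and N: "N > 0"
  shows "norm (gregory (\<i> * of_real y)) * y / norm (sin (of_real pi * (\<i> * of_real y)))
           \<le> 1 / pi * ((1 + 1 / y) ^ N * (ln (1 + harm N) / harm N))"
proof -
  define z where "z = \<i> * complex_of_real y"
  define H where "H = (harm N :: real)"
  define A where "A = norm (rGamma (1 + z) * rGamma (1 - z))"
  have H: "H > 0" unfolding H_def using N by (rule harm_pos)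
  have int: "((\<lambda>x. A * (1 + 1 / y) ^ N * (1 / (1 + x * H))) has_integral (A * (1 + 1 / y) ^ N * (ln (1 + 1 * H) / H - ln (1 + 0 * H) / H))) {0..1}"
  proof (intro has_integral_mult_right fundamental_theorem_of_calculus)
    fix x :: real assume x: "x \<in> {0..1}"
    have "1 + x * H > 0" using x H by (intro add_pos_nonneg) auto
    hence "((\<lambda>x. ln (1 + x * H) / H) has_real_derivative (1 / (1 + x * H))) (at x within {0..1})"
      using H by (auto intro!: derivative_eq_intros)
    thus "((\<lambda>x. ln (1 + x * H) / H) has_vector_derivative (1 / (1 + x * H))) (at x within {0..1})"
      by (simp flip: has_real_derivative_iff_has_vector_derivative)
  qed auto
  have "norm (gregory z) \<le> integral {0..1} (\<lambda>x. A * (1 + 1 / y) ^ N * (1 / (1 + x * H)))"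
    unfolding gregory_def
  proof (rule integral_norm_bound_integral[OF integrable_binom])
    show "(\<lambda>x. A * (1 + 1 / y) ^ N * (1 / (1 + x * H))) integrable_on {0..1}" using int by blast
    fix x :: real assume x: "x \<in> {0..1}"
    have "norm (binom x z) \<le> norm (rGamma (1 + z)) * (Gamma (1 + x) * norm (rGamma (1 - z + of_real x)))"
      by (rule norm_binom_le_left[OF x]) (simp add: z_def)
    also have "\<dots> \<le> norm (rGamma (1 + z)) * ((1 + 1 / y) ^ N / (1 + x * harm N) * norm (rGamma (1 - z)))"
      unfolding z_def by (intro mult_left_mono norm_rGamma_vertical_le y x) auto
    also have "\<dots> = A * (1 + 1 / y) ^ N * (1 / (1 + x * H))" by (simp add: A_def norm_mult H_def)
    finally show "norm (binom x z) \<le> A * (1 + 1 / y) ^ N * (1 / (1 + x * H))" .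
  qed
  also have "\<dots> = A * (1 + 1 / y) ^ N * (ln (1 + H) / H)" using int by (simp add: integral_unique)
  finally have "norm (gregory z) * y \<le> (A * (1 + 1 / y) ^ N * (ln (1 + H) / H)) * y"
    using y by (intro mult_right_mono) auto
  also have "\<dots> = (A * y) * ((1 + 1 / y) ^ N * (ln (1 + H) / H))" by (simp only: mult_ac)
  also have "A * y = norm (z * (rGamma (1 + z) * rGamma (1 - z)))"
    using y by (simp add: A_def norm_mult z_def)
  also have "\<dots> = norm (sin (of_real pi * z)) / pi"
    unfolding rGamma_add_mult_rGamma_minus by (simp add: norm_divide)
  finally have le: "norm (gregory z) * y \<le> norm (sin (of_real pi * z)) / pi * ((1 + 1 / y) ^ N * (ln (1 + H) / H))" .
  have "sinh (pi * y) > 0" using y by simp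
  also have "sinh (pi * y) \<le> norm (sin (of_real pi * z))"
    using norm_sin_ge_sinh[of "of_real pi * z"] y by (simp add: z_def abs_mult)
  finally show ?thesis using le unfolding z_def[symmetric] H_def[symmetric] by (simp add: field_simps)
qed

text \<open>The order of the choices matters: first N, through the divergence of the harmonic
  numbers, and then y, so that (1 + 1 / y)^N < 2.\<close>

lemma gregory_vertical_limit:
  "((\<lambda>y. norm (gregory (\<i> * of_real y)) * y / norm (sin (of_real pi * (\<i> * of_real y)))) \<longlongrightarrow> 0) at_top"
proof (rule tendstoI)
  fix e :: real assume e: "e > 0"
  have "((\<lambda>h::real. ln (1 + h) / h) \<longlongrightarrow> 0) at_top" by real_asymp
  hence "(\<lambda>N. ln (1 + harm N) / harm N :: real) \<longlonglongrightarrow> 0"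
    by (rule filterlim_compose[OF _ harm_at_top])
  hence "eventually (\<lambda>N. ln (1 + harm N) / harm N < (e / 2 :: real)) sequentially"
    using e by (intro order_tendstoD) auto
  hence "eventually (\<lambda>N. ln (1 + harm N) / harm N < (e / 2 :: real) \<and> N > 0) sequentially"
    using eventually_gt_at_top[of 0] by eventually_elim auto
  then obtain N where N: "N > 0" "ln (1 + harm N) / harm N < e / 2" 
    by (auto simp: eventually_at_top_linorder)
  have "((\<lambda>y::real. 1 / y) \<longlongrightarrow> 0) at_top" by real_asymp
  hence "((\<lambda>y::real. (1 + 1 / y) ^ N) \<longlongrightarrow> (1 + 0) ^ N) at_top"
    by (intro tendsto_power tendsto_add tendsto_const)
  hence "eventually (\<lambda>y::real. (1 + 1 / y) ^ N < 2) at_top" by (intro order_tendstoD) auto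
  thus "\<forall>\<^sub>F y in at_top. dist (norm (gregory (\<i> * of_real y)) * y / norm (sin (of_real pi * (\<i> * of_real y)))) 0 < e"
    using eventually_gt_at_top[of 0]
  proof eventually_elim
    case (elim y)
    have "norm (gregory (\<i> * of_real y)) * y / norm (sin (of_real pi * (\<i> * of_real y)))
           \<le> 1 / pi * ((1 + 1 / y) ^ N * (ln (1 + harm N) / harm N))"
      using elim N by (intro norm_gregory_vertical_le) auto
    also have "\<dots> \<le> 1 * (2 * (ln (1 + harm N) / harm N))"
    proof (intro mult_mono)
      have h: "harm N > (0::real)" using N(1) by (rule harm_pos)
      thus "0 \<le> ln (1 + harm N) / (harm N :: real)" by (intro divide_nonneg_pos ln_ge_zero) linarith+
      thus "0 \<le> (1 + 1 / y) ^ N * (ln (1 + harm N) / harm N)"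
        using elim by (intro mult_nonneg_nonneg) auto
    qed (use elim pi_gt3 in auto)
    also have "\<dots> < e" using N by linarith
    finally show ?case using elim by simp
  qed
qed

locale gregory_zeros = interlacing \<rho> for \<rho> :: "nat \<Rightarrow> real" +
  assumes rho_zero: "n \<ge> 1 \<Longrightarrow> gregory_real (\<rho> n) = 0"
begin

lemma gregory_eq_canon: "gregory = canon"
proof
  fix z
  obtain C where C: "C > 0" "\<And>z. norm (gregory z) \<le> C * exp (pi * \<bar>Im z\<bar>)" by (rule gregory_exp_bound) blast
  have zero: "gregory (zseq k) = 0" for k
    using rho_zero[of "Suc (k div 2)"] gregory_neg_nat[of "Suc (k div 2)"]
    by (auto simp: zseq_def gregory_real_eq_0_iff)
  have "gregory z = gregory 0 * canon z"
    using C by (intro eq_canon_if_bounds[OF holomorphic_gregory zero _ _ gregory_vertical_limit]) auto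
  thus "gregory z = canon z" by simp
qed

lemma sigma_eq: "sigma = euler_mascheroni"
proof -
  have "deriv gregory 0 = of_real euler_mascheroni" by (rule DERIV_imp_deriv[OF gregory_has_field_derivative_0])
  with deriv_canon_0 have "complex_of_real sigma = of_real euler_mascheroni"
    by (simp only: gregory_eq_canon)
  thus ?thesis by (simp only: of_real_eq_iff)
qed

lemma zeros_gregory: "zeros gregory = range zseq"
  by (auto simp: zeros_def gregory_eq_canon canon_eq_0_iff)

lemma gregory_real_zero_unique:
  assumes "n \<ge> 1" "real n < c" "c < real n + 1" "gregory_real c = 0"
  shows "c = \<rho> n"
proof -
  have "complex_of_real c \<in> range zseq"
    using assms(4) zeros_gregory unfolding zeros_def gregory_real_eq_0_iff by auto
  then obtain m where m: "m \<ge> 1" "complex_of_real c = - of_nat m \<or> complex_of_real c = of_real (\<rho> m)"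
    unfolding range_zseq by auto
  moreover have "complex_of_real c \<noteq> - of_nat m"
  proof
    assume "complex_of_real c = - of_nat m"
    hence "c = - real m" by (simp add: complex_eq_iff)
    with assms show False by simp
  qed
  ultimately have "c = \<rho> m" by simp
  moreover have "m = n"
  proof -
    have "real m < real n + 1" "real n < real m + 1" using rho[OF m(1)] assms \<open>c = \<rho> m\<close> by linarith+
    thus ?thesis by linarith
  qed
  ultimately show ?thesis by simp
qed

lemma rho_gap_decreasing:
  assumes "n \<ge> 1"
  shows "\<rho> (Suc n) - real (Suc n) < \<rho> n - real n"
proof -
  obtain c where c: "real (Suc n) < c" "c < real (Suc n) + (\<rho> n - real n)" "gregory_real c = 0"
    using gregory_real_zero_next[of n "\<rho> n - real n"] assms rho[OF assms] rho_zero[OF assms] by auto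
  hence "c = \<rho> (Suc n)" using rho[OF assms] by (intro gregory_real_zero_unique) auto
  with c show ?thesis by simp
qed

end

section \<open>Growth\<close>

lemma elog_le: "0 \<le> x \<Longrightarrow> x \<le> exp t \<Longrightarrow> elog x \<le> ereal t"
  using ln_ge_iff[of "exp t"] by (auto simp: elog_def) (metis exp_gt_zero less_eq_real_def ln_exp ln_le_cancel_iff)

lemma elog_ge: "exp t \<le> x \<Longrightarrow> ereal t \<le> elog x"
  using exp_gt_zero[of t] by (auto simp: elog_def) (metis exp_gt_zero less_le_trans ln_exp ln_le_cancel_iff)

lemma Limsup_elog_le:
  assumes C: "C > 0" and "eventually (\<lambda>r. 0 \<le> f r \<and> f r \<le> C * exp (a * r)) at_top"
  shows "Limsup at_top (\<lambda>r. elog (f r) / ereal r) \<le> ereal a"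
proof -
  have "eventually (\<lambda>r. elog (f r) / ereal r \<le> ereal ((ln C + a * r) / r)) at_top"
    using assms(2) eventually_gt_at_top[of 0]
  proof eventually_elim
    case (elim r)
    have "C * exp (a * r) = exp (ln C + a * r)" using C by (simp add: exp_add)
    hence "elog (f r) \<le> ereal (ln C + a * r)" using elim by (intro elog_le) auto
    hence "elog (f r) / ereal r \<le> ereal (ln C + a * r) / ereal r"
      using elim by (intro ereal_divide_right_mono) auto
    thus ?case using elim by simp
  qed
  hence "Limsup at_top (\<lambda>r. elog (f r) / ereal r) \<le> Limsup at_top (\<lambda>r. ereal ((ln C + a * r) / r))"
    by (rule Limsup_mono)
  also have "((\<lambda>r. (ln C + a * r) / r) \<longlongrightarrow> a) at_top" by real_asymp
  hence "Limsup at_top (\<lambda>r. ereal ((ln C + a * r) / r)) = ereal a"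
    by (intro lim_imp_Limsup) auto
  finally show ?thesis .
qed

text \<open>A polynomial factor does not change the exponential rate, and for a limsup it suffices
  that the bound recurs. On the real axis it cannot hold for all large r, as there are zeros
  arbitrarily far out.\<close>

lemma Limsup_elog_ge:
  assumes c: "c > 0" and fr: "frequently (\<lambda>r. c * exp (a * r) \<le> r ^ 4 * f r) at_top"
  shows "ereal a \<le> Limsup at_top (\<lambda>r. elog (f r) / ereal r)"
proof (rule ccontr)
  assume "\<not> ?thesis"
  hence "Limsup at_top (\<lambda>r. elog (f r) / ereal r) < ereal a" by simp
  then obtain b where b: "Limsup at_top (\<lambda>r. elog (f r) / ereal r) < ereal b" "b < a"
    using ereal_dense2[of "Limsup at_top (\<lambda>r. elog (f r) / ereal r)" "ereal a"] by auto
  from Limsup_lessD[OF b(1)] have ev: "eventually (\<lambda>r. elog (f r) / ereal r < ereal b) at_top" .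
  define d where "d = a - b"
  have d: "d > 0" using b by (simp add: d_def)
  have "((\<lambda>r. r ^ 4 / exp (d * r)) \<longlongrightarrow> 0) at_top" using d by real_asymp
  hence "eventually (\<lambda>r. r ^ 4 / exp (d * r) < c) at_top" using c by (intro order_tendstoD)
  with ev have "eventually (\<lambda>r. \<not> (c * exp (a * r) \<le> r ^ 4 * f r)) at_top"
    using eventually_gt_at_top[of 0]
  proof eventually_elim
    case (elim r)
    have "exp (d * r) = exp (a * r) / exp (b * r)" by (simp add: d_def left_diff_distrib exp_diff)
    hence e: "exp (a * r) = exp (d * r) * exp (b * r)" by simp
    have "r ^ 4 < c * exp (d * r)" using elim(2) by (simp add: pos_divide_less_eq)
    hence lt: "r ^ 4 * exp (b * r) < c * exp (a * r)" unfolding e mult.assoc[symmetric] by simp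
    show ?case
    proof
      assume le: "c * exp (a * r) \<le> r ^ 4 * f r"
      have "r ^ 4 * exp (b * r) < r ^ 4 * f r" using lt le by linarith
      hence "exp (b * r) \<le> f r" using elim(3) by (simp add: mult_less_cancel_left_pos)
      hence "ereal (b * r) \<le> elog (f r)" by (rule elog_ge)
      hence "ereal (b * r) / ereal r \<le> elog (f r) / ereal r"
        using elim(3) by (intro ereal_divide_right_mono) auto
      hence "ereal b \<le> elog (f r) / ereal r" using elim(3) by simp
      thus False using elim(1) by simp
    qed
  qed
  thus False using fr by (simp add: frequently_def)
qed

lemma frequently_at_topI:
  assumes "\<And>R :: real. \<exists>r>R. P r"
  shows "frequently P at_top"
  using assms unfolding frequently_def eventually_at_top_dense by blast

lemma sinh_ge_exp: "t \<ge> 1 \<Longrightarrow> exp t / 4 \<le> sinh t" for t :: real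
proof -
  assume "t \<ge> 1"
  hence "exp (- t) \<le> 1" by simp
  moreover have "exp t \<ge> 2" using exp_ge_add_one_self[of t] \<open>t \<ge> 1\<close> by linarith
  moreover have "a / 4 \<le> (a - b) / 2" if "b \<le> 1" "a \<ge> 2" for a b :: real
    using that by (simp add: field_simps)
  ultimately show ?thesis unfolding sinh_field_def by blast
qed

lemma max_modulus_upper:
  assumes "\<And>z. norm z = r \<Longrightarrow> norm (f z) \<le> B" "r \<ge> 0"
  shows "max_modulus f r \<le> B"
proof -
  have "of_real r \<in> sphere (0::complex) r" using assms(2) by simp
  thus ?thesis unfolding max_modulus_def using assms by (intro cSUP_least) auto
qed

lemma max_modulus_lower:
  assumes "continuous_on UNIV f" "norm z = r"
  shows "norm (f z) \<le> max_modulus f r"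
  unfolding max_modulus_def
proof (rule cSUP_upper)
  have "compact ((\<lambda>z. norm (f z)) ` sphere 0 r)"
    using assms(1) by (intro compact_continuous_image continuous_intros) (auto intro: continuous_on_subset)
  thus "bdd_above ((\<lambda>z. norm (f z)) ` sphere 0 r)"
    by (intro bounded_imp_bdd_above compact_imp_bounded)
qed (use assms in auto)

section \<open>Order, type, indicator and Cartwright integral\<close>

context gregory_zeros
begin

lemma continuous_on_gregory: "continuous_on A gregory"
  using holomorphic_on_imp_continuous_on[OF holomorphic_gregory] .

text \<open>
  Off the real axis the lower bound comes from the product; on the two real half-axes
  it is only available at suitable points between the zeros.
\<close>
lemma norm_gregory_ge_Im:
  assumes "norm z = r" "r \<ge> 1" "pi * \<bar>Im z\<bar> \<ge> 1"
  shows "\<bar>Im z\<bar> * exp (pi * \<bar>Im z\<bar>) \<le> 8 * pi * r ^ 3 * norm (gregory z)"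
proof -
  have "exp (pi * \<bar>Im z\<bar>) / 4 \<le> norm (sin (of_real pi * z))"
    using norm_sin_ge_sinh[of "of_real pi * z"] sinh_ge_exp[OF assms(3)] by (simp add: abs_mult)
  hence "exp (pi * \<bar>Im z\<bar>) / 4 * \<bar>Im z\<bar> \<le> norm (sin (of_real pi * z)) * \<bar>Im z\<bar>"
    by (intro mult_right_mono) auto
  also have "\<dots> \<le> pi * norm z ^ 2 * (norm (1 - z) * norm (gregory z))"
    unfolding gregory_eq_canon using assms by (intro norm_canon_ge_Im) auto
  also have "\<dots> \<le> pi * r ^ 2 * ((2 * r) * norm (gregory z))"
    using norm_triangle_ineq4[of 1 z] assms by (intro mult_mono) auto
  finally show ?thesis by (simp add: power3_eq_cube power2_eq_square mult_ac)
qed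

text \<open>The lower bound is taken at the point i r. Nonnegativity is stated at |r| because the
  sphere of negative radius is empty.\<close>

lemma max_modulus_gregory_bounds:
  obtains C where "C > 0" "\<And>r. r \<ge> 0 \<Longrightarrow> max_modulus gregory r \<le> C * exp (pi * r)"
    "\<And>r. r \<ge> 1 \<Longrightarrow> exp (pi * r) \<le> 8 * pi * r ^ 2 * max_modulus gregory r"
    "\<And>r. max_modulus gregory \<bar>r\<bar> \<ge> 0"
proof -
  obtain C where C: "C > 0" "\<And>z. norm (gregory z) \<le> C * exp (pi * \<bar>Im z\<bar>)" by (rule gregory_exp_bound) blast
  show ?thesis
  proof (rule that[OF C(1)])
    fix r :: real assume r: "r \<ge> 0"
    show "max_modulus gregory r \<le> C * exp (pi * r)"
    proof (rule max_modulus_upper)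
      fix z :: complex assume z: "norm z = r"
      have "norm (gregory z) \<le> C * exp (pi * \<bar>Im z\<bar>)" by (rule C)
      also have "\<dots> \<le> C * exp (pi * r)" using z abs_Im_le_cmod[of z] C by (intro mult_left_mono) auto
      finally show "norm (gregory z) \<le> C * exp (pi * r)" .
    qed fact
  next
    fix r :: real assume r: "r \<ge> 1"
    have "pi * r \<ge> 3 * 1" using pi_gt3 r by (intro mult_mono) auto
    hence "r * exp (pi * r) \<le> 8 * pi * r ^ 3 * norm (gregory (\<i> * of_real r))"
      using norm_gregory_ge_Im[of "\<i> * of_real r" r] r by (simp add: norm_mult)
    also have "\<dots> \<le> 8 * pi * r ^ 3 * max_modulus gregory r"
      using r by (intro mult_left_mono max_modulus_lower continuous_on_gregory) (auto simp: norm_mult)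
    also have "\<dots> = r * (8 * pi * r ^ 2 * max_modulus gregory r)" by (simp add: power3_eq_cube power2_eq_square)
    finally show "exp (pi * r) \<le> 8 * pi * r ^ 2 * max_modulus gregory r" using r by simp
  next
    fix r :: real
    have "norm (gregory (of_real r)) \<le> max_modulus gregory \<bar>r\<bar>"
      by (intro max_modulus_lower continuous_on_gregory) auto
    thus "max_modulus gregory \<bar>r\<bar> \<ge> 0" using norm_ge_zero order.trans by blast
  qed
qed

lemma exponential_type_gregory: "exponential_type gregory = ereal pi"
proof -
  obtain C where C: "C > 0" "\<And>r. r \<ge> 0 \<Longrightarrow> max_modulus gregory r \<le> C * exp (pi * r)"
    "\<And>r. r \<ge> 1 \<Longrightarrow> exp (pi * r) \<le> 8 * pi * r ^ 2 * max_modulus gregory r"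
    "\<And>r. max_modulus gregory \<bar>r\<bar> \<ge> 0" by (rule max_modulus_gregory_bounds) blast
  have nn: "max_modulus gregory r \<ge> 0" if "r \<ge> 0" for r using C(4)[of r] that by simp
  have "Limsup at_top (\<lambda>r. elog (max_modulus gregory r) / ereal r) \<le> ereal pi"
    by (rule Limsup_elog_le[OF C(1)]) (use C(2) nn in \<open>auto intro!: eventually_at_top_linorderI[of 0]\<close>)
  moreover have "ereal pi \<le> Limsup at_top (\<lambda>r. elog (max_modulus gregory r) / ereal r)"
  proof (rule Limsup_elog_ge[of "1 / (8 * pi)"])
    have "eventually (\<lambda>r. 1 / (8 * pi) * exp (pi * r) \<le> r ^ 4 * max_modulus gregory r) at_top"
      using eventually_ge_at_top[of 1]
    proof eventually_elim
      case (elim r)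
      have "1 / (8 * pi) * exp (pi * r) \<le> 1 / (8 * pi) * (8 * pi * r ^ 2 * max_modulus gregory r)"
        using C(3)[OF elim] by (intro mult_left_mono) auto
      also have "\<dots> = r ^ 2 * max_modulus gregory r" by simp
      also have "\<dots> \<le> r ^ 4 * max_modulus gregory r"
        using elim nn[of r] by (intro mult_right_mono power_increasing) auto
      finally show ?case .
    qed
    thus "frequently (\<lambda>r. 1 / (8 * pi) * exp (pi * r) \<le> r ^ 4 * max_modulus gregory r) at_top"
      by (rule eventually_frequently[rotated]) simp
  qed simp
  ultimately show ?thesis unfolding exponential_type_def by (rule antisym)
qed

text \<open>An exponent below 1 would force the maximum modulus below exp r, against the lower bound
  exp (pi r) / (8 pi r^2), since pi > 1.\<close>

lemma growth_order_gregory: "growth_order gregory = 1"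
proof -
  obtain C where C: "C > 0" "\<And>r. r \<ge> 0 \<Longrightarrow> max_modulus gregory r \<le> C * exp (pi * r)"
    "\<And>r. r \<ge> 1 \<Longrightarrow> exp (pi * r) \<le> 8 * pi * r ^ 2 * max_modulus gregory r"
    "\<And>r. max_modulus gregory \<bar>r\<bar> \<ge> 0" by (rule max_modulus_gregory_bounds) blast
  define S where "S = {ereal a | a. a \<ge> 0 \<and> (\<forall>\<^sub>F r in at_top. max_modulus gregory r \<le> exp (r powr a))}"
  have upper: "ereal a \<in> S" if "a > 1" for a
  proof -
    have "((\<lambda>r. (ln C + pi * r) / r powr a) \<longlongrightarrow> 0) at_top" using that by real_asymp
    hence "eventually (\<lambda>r. (ln C + pi * r) / r powr a < 1) at_top" by (intro order_tendstoD) auto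
    hence "\<forall>\<^sub>F r in at_top. max_modulus gregory r \<le> exp (r powr a)"
      using eventually_gt_at_top[of 0]
    proof eventually_elim
      case (elim r)
      have "max_modulus gregory r \<le> C * exp (pi * r)" using elim by (intro C(2)) auto
      also have "\<dots> = exp (ln C + pi * r)" using C by (simp add: exp_add)
      also have "\<dots> \<le> exp (r powr a)" using elim by (simp add: field_simps)
      finally show ?case .
    qed
    thus ?thesis using that by (auto simp: S_def)
  qed
  have lower: "a \<ge> 1" if "\<forall>\<^sub>F r in at_top. max_modulus gregory r \<le> exp (r powr a)" for a
  proof (rule ccontr)
    assume "\<not> a \<ge> 1"
    hence a: "a < 1" by simp
    have "((\<lambda>r. 8 * pi * r ^ 2 / exp ((pi - 1) * r)) \<longlongrightarrow> 0) at_top" using pi_gt3 by real_asymp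
    hence "eventually (\<lambda>r. 8 * pi * r ^ 2 / exp ((pi - 1) * r) < 1) at_top" by (intro order_tendstoD) auto
    with that have "eventually (\<lambda>r::real. False) at_top"
      using eventually_ge_at_top[of 1]
    proof eventually_elim
      case (elim r)
      have "r powr a \<le> r powr 1" using elim a by (intro powr_mono) auto
      hence "exp (r powr a) \<le> exp r" using elim by simp
      hence "max_modulus gregory r \<le> exp r" using elim(1) by linarith
      hence "exp (pi * r) \<le> 8 * pi * r ^ 2 * exp r"
        using C(3)[of r] elim(3) by (smt (verit) mult_left_mono mult_nonneg_nonneg pi_ge_zero zero_le_power2)
      also have "8 * pi * r ^ 2 < exp ((pi - 1) * r)" using elim(2) by simp
      hence "8 * pi * r ^ 2 * exp r < exp ((pi - 1) * r) * exp r" by simp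
      also have "exp ((pi - 1) * r) * exp r = exp (pi * r)" by (simp add: exp_add[symmetric] algebra_simps)
      finally show False by simp
    qed
    thus False by simp
  qed
  have "Inf S = 1"
  proof (rule antisym)
    show "1 \<le> Inf S" by (rule Inf_greatest) (use lower in \<open>auto simp: S_def\<close>)
    show "Inf S \<le> 1"
    proof (rule ccontr)
      assume "\<not> Inf S \<le> 1"
      hence "1 < Inf S" by simp
      then obtain a where a: "1 < ereal a" "ereal a < Inf S"
        using ereal_dense2[of 1 "Inf S"] by auto
      hence "ereal a \<in> S" by (intro upper) (simp add: one_ereal_def)
      hence "Inf S \<le> ereal a" by (rule Inf_lower)
      with a show False by simp
    qed
  qed
  thus ?thesis by (simp add: growth_order_def S_def)
qed

text \<open>At an integer n \<ge> 2 the integrand keeps one sign, and the lower Gamma bound makes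
  the weight at least Gamma (1 + x) / n^2.\<close>

lemma frequently_gregory_positive_axis:
  "\<exists>c>0. frequently (\<lambda>r. c * exp (0 * r) \<le> r ^ 4 * norm (gregory (of_real r))) at_top"
proof -
  define c where "c = integral {0..1} (\<lambda>x::real. Gamma (1 + x) * sin (pi * x)) / pi"
  have cont: "continuous_on {0..1} (\<lambda>x::real. Gamma (1 + x) * sin (pi * x))"
    by (intro continuous_intros continuous_on_Gamma_compose) auto
  have "integral {0..1} (\<lambda>x::real. Gamma (1 + x) * sin (pi * x)) > 0"
  proof (rule integral_pos_continuous[OF cont, of "1/2"])
    show "Gamma (1 + x) * sin (pi * x) \<ge> 0" if "x \<in> {0..1}" for x :: real
      using that by (intro mult_nonneg_nonneg sin_ge_zero) auto
  qed auto
  hence c: "c > 0" by (simp add: c_def)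
  have ge: "c \<le> real n ^ 2 * norm (gregory (of_real (real n)))" if n: "n \<ge> 2" for n
  proof -
    have n1: "real n > 1" using n by simp
    have "c * pi = integral {0..1} (\<lambda>x::real. Gamma (1 + x) * sin (pi * x))" by (simp add: c_def)
    also have "\<dots> \<le> integral {0..1} (\<lambda>x. real n ^ 2 * (gweight (real n) x * sin (pi * x)))"
    proof (rule integral_le)
      fix x :: real assume x: "x \<in> {0..1}"
      have "1 / real n = real n powr (- 1)" using n by (simp add: powr_minus divide_inverse)
      also have "\<dots> \<le> real n powr (- x)" using x n by (intro powr_mono) auto
      also have "\<dots> \<le> Gamma (real n - x) / Gamma (real n)" by (rule Gamma_ratio_bounds[OF n1 x])
      finally have g: "1 / real n \<le> Gamma (real n - x) / Gamma (real n)" .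
      have ni: "real n \<notin> \<int>\<^sub>\<le>\<^sub>0" using n by (auto elim!: nonpos_Ints_cases)
      have "real n ^ 2 * gweight (real n) x = Gamma (1 + x) * (real n * (Gamma (real n - x) / Gamma (real n)))"
        unfolding gweight_def Gamma_plus1[OF ni] using n by (simp add: power2_eq_square)
      moreover have "1 \<le> real n * (Gamma (real n - x) / Gamma (real n))" using g n by (simp add: field_simps)
      moreover have "Gamma (1 + x) > 0" using x by simp
      ultimately have "Gamma (1 + x) * 1 \<le> real n ^ 2 * gweight (real n) x" by (simp only:) (intro mult_left_mono; simp)
      moreover have "sin (pi * x) \<ge> 0" using x by (intro sin_ge_zero) auto
      ultimately have "Gamma (1 + x) * sin (pi * x) \<le> (real n ^ 2 * gweight (real n) x) * sin (pi * x)"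
        by (intro mult_right_mono) auto
      thus "Gamma (1 + x) * sin (pi * x) \<le> real n ^ 2 * (gweight (real n) x * sin (pi * x))" by (simp add: mult.assoc)
    qed (auto intro!: integrable_continuous_interval continuous_intros cont continuous_on_gweight n1)
    also have "\<dots> = real n ^ 2 * (- gmoment n 0)" by (simp add: gmoment_def)
    also have "- gmoment n 0 = \<bar>gmoment n 0\<bar>" using gmoment_0_neg[OF n] by simp
    also have "\<dots> = pi * norm (gregory (of_real (real n)))"
      using gregory_real_eq_gmoment[of n 0] n1 unfolding gregory_of_real norm_of_real
      by (simp add: abs_mult power_abs)
    finally have "c * pi \<le> (real n ^ 2 * norm (gregory (of_real (real n)))) * pi" by (simp only: mult_ac)
    thus ?thesis by simp
  qed
  have "frequently (\<lambda>r. c * exp (0 * r) \<le> r ^ 4 * norm (gregory (of_real r))) at_top"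
  proof (rule frequently_at_topI)
    fix R :: real
    obtain n :: nat where n: "real n > max R 2" using reals_Archimedean2 by blast
    have "c \<le> real n ^ 2 * norm (gregory (of_real (real n)))" using n by (intro ge) auto
    also have "\<dots> \<le> real n ^ 4 * norm (gregory (of_real (real n)))" using n by (intro mult_right_mono power_increasing) auto
    finally show "\<exists>r>R. c * exp (0 * r) \<le> r ^ 4 * norm (gregory (of_real r))"
      using n by (intro exI[of _ "real n"]) auto
  qed
  with c show ?thesis by blast
qed

text \<open>The half-integers are the points where |sin (pi r)| = 1, and the lower bound for the
  left half-plane does not degenerate there.\<close>

lemma frequently_gregory_negative_axis:
  "frequently (\<lambda>r. 1 / (2 * pi) * exp (0 * r) \<le> r ^ 4 * norm (gregory (of_real (- r)))) at_top"
proof (rule frequently_at_topI)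
  fix R :: real
  obtain n :: nat where n: "real n > max R 2" using reals_Archimedean2 by blast
  define r where "r = real n + 1 / 2"
  have r: "r > R" "r \<ge> 1" using n by (auto simp: r_def)
  have "\<bar>sin (pi * r)\<bar> = 1"
    using sin_pi_nat_add[of n "1/2"] by (simp add: r_def abs_mult power_abs)
  hence "norm (sin (of_real pi * complex_of_real (- r))) = 1"
    using norm_of_real[of "sin (pi * (- r))", where 'a = complex] unfolding sin_of_real[symmetric] by simp
  moreover have "norm (sin (of_real pi * complex_of_real (- r))) \<le> pi * norm (complex_of_real (- r)) * (norm (1 - complex_of_real (- r)) * norm (gregory (of_real (- r))))"
    unfolding gregory_eq_canon using r by (intro norm_canon_ge_left) auto
  ultimately have "1 \<le> pi * r * (norm (1 - complex_of_real (- r)) * norm (gregory (of_real (- r))))"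
    using r by (simp only: norm_of_real abs_minus_cancel abs_of_nonneg)
  also have "\<dots> \<le> pi * r * (2 * r * norm (gregory (of_real (- r))))"
    using norm_triangle_ineq4[of 1 "complex_of_real (- r)"] r
    by (intro mult_left_mono mult_right_mono) auto
  finally have "1 / (2 * pi) \<le> r ^ 2 * norm (gregory (of_real (- r)))" by (simp add: field_simps power2_eq_square)
  also have "\<dots> \<le> r ^ 4 * norm (gregory (of_real (- r)))" using r by (intro mult_right_mono power_increasing) auto
  finally show "\<exists>r>R. 1 / (2 * pi) * exp (0 * r) \<le> r ^ 4 * norm (gregory (of_real (- r)))"
    using r by (intro exI[of _ r]) auto
qed

lemma pl_indicator_gregory: "pl_indicator gregory \<theta> = ereal (pi * \<bar>sin \<theta>\<bar>)"
proof -
  let ?g = "\<lambda>r. norm (gregory (of_real r * cis \<theta>))"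
  obtain C where C: "C > 0" "\<And>z. norm (gregory z) \<le> C * exp (pi * \<bar>Im z\<bar>)" by (rule gregory_exp_bound) blast
  have "Limsup at_top (\<lambda>r. elog (?g r) / ereal r) \<le> ereal (pi * \<bar>sin \<theta>\<bar>)"
  proof (rule Limsup_elog_le[OF C(1)])
    show "eventually (\<lambda>r. 0 \<le> ?g r \<and>
       ?g r \<le> C * exp (pi * \<bar>sin \<theta>\<bar> * r)) at_top"
      using eventually_ge_at_top[of 0]
    proof eventually_elim
      case (elim r)
      show ?case using C(2)[of "of_real r * cis \<theta>"] elim by (simp add: abs_mult mult_ac)
    qed
  qed
  moreover have "ereal (pi * \<bar>sin \<theta>\<bar>) \<le> Limsup at_top (\<lambda>r. elog (?g r) / ereal r)"
  proof (cases "sin \<theta> = 0")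
    case False
    define s where "s = \<bar>sin \<theta>\<bar>"
    have s: "s > 0" using False by (simp add: s_def)
    show ?thesis
    proof (rule Limsup_elog_ge[of "s / (8 * pi)"])
      have "eventually (\<lambda>r. s / (8 * pi) * exp (pi * \<bar>sin \<theta>\<bar> * r) \<le> r ^ 4 * ?g r) at_top"
        using eventually_ge_at_top[of "max 1 (1 / (pi * s))"]
      proof eventually_elim
        case (elim r)
        have r: "r \<ge> 1" "pi * (s * r) \<ge> 1" using elim s by (auto simp: field_simps)
        have Im: "\<bar>Im (of_real r * cis \<theta>)\<bar> = s * r" using r by (simp add: s_def abs_mult)
        have "s * r * exp (pi * (s * r)) \<le> 8 * pi * r ^ 3 * ?g r"
          using norm_gregory_ge_Im[of "of_real r * cis \<theta>" r] r unfolding Im by (simp add: norm_mult)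
        hence "s / (8 * pi) * exp (pi * s * r) * r \<le> r ^ 3 * ?g r"
          by (simp add: field_simps)
        moreover have "s / (8 * pi) * exp (pi * s * r) * 1 \<le> s / (8 * pi) * exp (pi * s * r) * r"
          using r s by (intro mult_left_mono) auto
        moreover have "r ^ 3 * ?g r \<le> r ^ 4 * ?g r"
          using r by (intro mult_right_mono power_increasing) auto
        ultimately show ?case unfolding s_def[symmetric] by linarith
      qed
      thus "frequently (\<lambda>r. s / (8 * pi) * exp (pi * \<bar>sin \<theta>\<bar> * r) \<le> r ^ 4 * ?g r) at_top"
        by (rule eventually_frequently[rotated]) simp
    qed (use s in simp)
  next
    case True
    hence "cos \<theta> = 1 \<or> cos \<theta> = -1" using sin_cos_squared_add[of \<theta>] by (simp add: power2_eq_1_iff)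
    thus ?thesis
    proof
      assume "cos \<theta> = 1"
      hence "cis \<theta> = 1" using True by (simp add: complex_eq_iff)
      with frequently_gregory_positive_axis show ?thesis
        using Limsup_elog_ge[of _ 0 "\<lambda>r. norm (gregory (of_real r))"] True by (auto simp: zero_ereal_def)
    next
      assume "cos \<theta> = -1"
      hence "cis \<theta> = -1" using True by (simp add: complex_eq_iff)
      with frequently_gregory_negative_axis show ?thesis
        using Limsup_elog_ge[of "1 / (2 * pi)" 0 "\<lambda>r. norm (gregory (of_real (- r)))"] True by (simp add: zero_ereal_def)
    qed
  qed
  ultimately show ?thesis unfolding pl_indicator_def by (rule antisym)
qed

text \<open>The function is bounded on the real axis, so the integrand is dominated by a multiple of
  1 / (1 + x^2).\<close>

lemma gregory_cartwright: "gregory \<in> cartwright_class"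
proof -
  let ?l = "\<lambda>x::real. ln (max 1 (norm (gregory (of_real x))))"
  obtain C where C: "C > 0" "\<And>z. norm (gregory z) \<le> C * exp (pi * \<bar>Im z\<bar>)" by (rule gregory_exp_bound) blast
  have 1: "integrable lborel (\<lambda>x::real. inverse (1 + x\<^sup>2))"
    using integrable_inverse_1_plus_square by (simp add: set_integrable_def)
  have 2: "integrable lborel (\<lambda>x::real. ln (max 1 C) * inverse (1 + x\<^sup>2))"
    using 1 by (rule integrable_mult_right)
  have "integrable lborel (\<lambda>x::real. ?l x / (1 + x\<^sup>2))"
  proof (rule Bochner_Integration.integrable_bound[OF 2])
    have nz: "1 + x\<^sup>2 \<noteq> 0" for x :: real by (smt (verit) zero_le_power2)
    have "continuous_on UNIV (\<lambda>x::real. ?l x / (1 + x\<^sup>2))"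
      by (intro continuous_intros continuous_on_compose2[OF continuous_on_gregory[of UNIV]]) (auto simp: nz)
    thus "(\<lambda>x::real. ?l x / (1 + x\<^sup>2)) \<in> borel_measurable lborel"
      by (simp add: borel_measurable_continuous_onI)
    show "AE x in lborel. norm (?l x / (1 + x\<^sup>2)) \<le> norm (ln (max 1 C) * inverse (1 + x\<^sup>2))"
    proof (intro always_eventually allI)
      fix x :: real
      have le: "norm (gregory (of_real x)) \<le> C" using C(2)[of "of_real x"] by simp
      have "?l x \<le> ln (max 1 C)" using le by (subst ln_le_cancel_iff) auto
      moreover have "0 \<le> ?l x" by (intro ln_ge_zero) auto
      moreover have "1 + x\<^sup>2 > 0" by (smt (verit) zero_le_power2)
      ultimately show "norm (?l x / (1 + x\<^sup>2)) \<le> norm (ln (max 1 C) * inverse (1 + x\<^sup>2))"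
        by (simp add: divide_inverse abs_mult mult_right_mono)
    qed
  qed
  thus ?thesis by (simp add: cartwright_class_def holomorphic_gregory exponential_type_gregory)
qed

lemma real_entire_gregory: "real_entire gregory"
  unfolding real_entire_def by (auto simp: holomorphic_gregory gregory_of_real elim!: Reals_cases)

end

section \<open>Expansions in inverse powers\<close>

text \<open>
  \<open>inv_expansion K f A\<close> says \<open>f L = (\<Sum>k<K. A\<^sub>k / L\<^sup>k) + O(1 / L\<^sup>K)\<close>. Peeling off one coefficient
  at a time makes closure under products, inverses and composition an induction on \<open>K\<close>.
\<close>
primrec inv_expansion :: "nat \<Rightarrow> (real \<Rightarrow> real) \<Rightarrow> real fps \<Rightarrow> bool" where
  "inv_expansion 0 f A \<longleftrightarrow> f \<in> O[at_top](\<lambda>_. 1)"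
| "inv_expansion (Suc K) f A \<longleftrightarrow> inv_expansion K (\<lambda>L. L * (f L - fps_nth A 0)) (fps_shift 1 A)"

lemma inv_expansion_cong:
  assumes "eventually (\<lambda>L. f L = g L) at_top"
  shows "inv_expansion K f A \<longleftrightarrow> inv_expansion K g A"
  using assms
proof (induction K arbitrary: f g A)
  case 0
  thus ?case unfolding inv_expansion.simps by (rule landau_o.big.in_cong)
next
  case (Suc K)
  have "eventually (\<lambda>L. L * (f L - fps_nth A 0) = L * (g L - fps_nth A 0)) at_top"
    using Suc.prems by eventually_elim simp
  thus ?case using Suc.IH by simp
qed

lemma inv_expansion_SucD: "inv_expansion (Suc K) f A \<Longrightarrow> inv_expansion K f A"
proof (induction K arbitrary: f A)
  case 0
  hence "(\<lambda>L. L * (f L - fps_nth A 0)) \<in> O[at_top](\<lambda>_. 1)" by simp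
  moreover have "(\<lambda>L::real. 1 / L) \<in> O[at_top](\<lambda>_. 1)" by real_asymp
  ultimately have "(\<lambda>L. (L * (f L - fps_nth A 0)) * (1 / L)) \<in> O[at_top](\<lambda>_. 1 * 1)"
    by (rule landau_o.big.mult)
  moreover have "eventually (\<lambda>L. (L * (f L - fps_nth A 0)) * (1 / L) = f L - fps_nth A 0) at_top"
    using eventually_gt_at_top[of 0] by eventually_elim simp
  ultimately have "(\<lambda>L. f L - fps_nth A 0) \<in> O[at_top](\<lambda>_. 1)"
    by (simp add: landau_o.big.in_cong)
  hence "(\<lambda>L. (f L - fps_nth A 0) + fps_nth A 0) \<in> O[at_top](\<lambda>_. 1)"
    by (rule sum_in_bigo) simp
  thus ?case by simp
next
  case (Suc K)
  thus ?case by simp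
qed

lemma inv_expansion_add:
  "inv_expansion K f A \<Longrightarrow> inv_expansion K g B \<Longrightarrow> inv_expansion K (\<lambda>L. f L + g L) (A + B)"
proof (induction K arbitrary: f g A B)
  case 0
  thus ?case by (auto intro: sum_in_bigo)
next
  case (Suc K)
  from Suc.IH[OF Suc.prems[unfolded inv_expansion.simps]] show ?case
    by (simp add: algebra_simps fps_shift_add)
qed

lemma inv_expansion_cmult: "inv_expansion K f A \<Longrightarrow> inv_expansion K (\<lambda>L. c * f L) (fps_const c * A)"
proof (induction K arbitrary: f A)
  case (Suc K)
  have "fps_shift 1 (fps_const c * A) = fps_const c * fps_shift 1 A" by (simp add: fps_eq_iff)
  with Suc.IH[OF Suc.prems[unfolded inv_expansion.simps]] show ?case
    by (simp add: algebra_simps)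
qed auto

text \<open>The formal counterpart of L (f g - a b) = a L (g - b) + L (f - a) g, where a and b are
  the constant coefficients; the induction for products runs on this pair of identities.\<close>

lemma fps_shift_1_mult:
  "fps_shift 1 (A * B) = fps_const (fps_nth A 0) * fps_shift 1 B + fps_shift 1 A * (B :: real fps)"
proof -
  have A: "A = fps_const (fps_nth A 0) + fps_X * fps_shift 1 A" by (simp add: fps_eq_iff)
  have B: "B = fps_const (fps_nth B 0) + fps_X * fps_shift 1 B" by (simp add: fps_eq_iff)
  have "A * B = fps_const (fps_nth A 0) * B + fps_X * (fps_shift 1 A * B)"
    by (subst A) (simp add: algebra_simps)
  also have "fps_const (fps_nth A 0) * B = fps_const (fps_nth A 0 * fps_nth B 0) + fps_X * (fps_const (fps_nth A 0) * fps_shift 1 B)"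
    by (subst B) (simp add: algebra_simps)
  finally have "A * B = fps_const (fps_nth A 0 * fps_nth B 0) + fps_X * (fps_const (fps_nth A 0) * fps_shift 1 B + fps_shift 1 A * B)"
    by (simp add: algebra_simps)
  thus ?thesis by (simp add: fps_eq_iff)
qed

lemma inv_expansion_mult:
  "inv_expansion K f A \<Longrightarrow> inv_expansion K g B \<Longrightarrow> inv_expansion K (\<lambda>L. f L * g L) (A * B)"
proof (induction K arbitrary: f g A B)
  case 0
  thus ?case using landau_o.big.mult[of f at_top "\<lambda>_. 1" g "\<lambda>_. 1"] by simp
next
  case (Suc K)
  have 1: "inv_expansion K (\<lambda>L. fps_nth A 0 * (L * (g L - fps_nth B 0))) (fps_const (fps_nth A 0) * fps_shift 1 B)"
    using Suc.prems(2) by (intro inv_expansion_cmult) simp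
  have 2: "inv_expansion K (\<lambda>L. L * (f L - fps_nth A 0) * g L) (fps_shift 1 A * B)"
    by (rule Suc.IH) (use Suc.prems(1) inv_expansion_SucD[OF Suc.prems(2)] in auto)
  show ?case using inv_expansion_add[OF 1 2] fps_shift_1_mult[of A B] by (simp add: algebra_simps)
qed

lemma inv_expansion_tendsto: "inv_expansion 1 f A \<Longrightarrow> (f \<longlongrightarrow> fps_nth A 0) at_top"
proof -
  assume "inv_expansion 1 f A"
  hence "(\<lambda>L. L * (f L - fps_nth A 0)) \<in> O[at_top](\<lambda>_. 1)" by simp
  moreover have "(\<lambda>L::real. 1 / L) \<in> o[at_top](\<lambda>_. 1)" by real_asymp
  ultimately have "(\<lambda>L. (L * (f L - fps_nth A 0)) * (1 / L)) \<in> o[at_top](\<lambda>_. 1 * 1)"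
    by (rule landau_o.big_small_mult)
  moreover have "eventually (\<lambda>L. (L * (f L - fps_nth A 0)) * (1 / L) = f L - fps_nth A 0) at_top"
    using eventually_gt_at_top[of 0] by eventually_elim simp
  ultimately have "(\<lambda>L. f L - fps_nth A 0) \<in> o[at_top](\<lambda>_. 1)"
    by (simp add: landau_o.small.in_cong)
  hence "((\<lambda>L. f L - fps_nth A 0) \<longlongrightarrow> 0) at_top" using smalloD_tendsto by fastforce
  thus ?thesis by (simp add: LIM_zero_iff)
qed

text \<open>From L (1/f - 1/a) = - (1/a) (L (f - a)) (1/f): order K + 1 of the inverse follows from
  order K of the inverse and order K + 1 of f. The coefficients satisfy the same identity because A
  times its inverse has zero shift.\<close>

lemma inv_expansion_inverse:
  assumes f: "\<And>K. inv_expansion K f A" and nz: "fps_nth A 0 \<noteq> 0"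
  shows "inv_expansion K (\<lambda>L. inverse (f L)) (inverse A)"
proof (induction K)
  case 0
  have "((\<lambda>L. inverse (f L)) \<longlongrightarrow> inverse (fps_nth A 0)) at_top"
    using inv_expansion_tendsto[OF f] nz by (rule tendsto_inverse)
  thus ?case using nz by (simp add: bigoI_tendsto[of _ _ "inverse (fps_nth A 0)"])
next
  case (Suc K)
  define a where "a = fps_nth A 0"
  have "fps_shift 1 (A * inverse A) = 0"
    using nz by (subst inverse_mult_eq_1') (auto simp: fps_eq_iff)
  hence "fps_const a * fps_shift 1 (inverse A) + fps_shift 1 A * inverse A = 0"
    unfolding fps_shift_1_mult a_def .
  hence "fps_const (inverse a) * (fps_const a * fps_shift 1 (inverse A) + fps_shift 1 A * inverse A) = 0" by simp
  hence "(fps_const (inverse a) * fps_const a) * fps_shift 1 (inverse A) + fps_const (inverse a) * (fps_shift 1 A * inverse A) = 0"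
    by (simp only: distrib_left mult.assoc)
  hence "fps_shift 1 (inverse A) = - (fps_const (inverse a) * (fps_shift 1 A * inverse A))"
    using nz by (simp add: a_def eq_neg_iff_add_eq_0)
  hence "fps_shift 1 (inverse A) = fps_const (- inverse a) * (fps_shift 1 A * inverse A)"
    by (simp flip: fps_const_neg)
  note sh = this
  have E: "inv_expansion K (\<lambda>L. (- inverse a) * ((L * (f L - a)) * inverse (f L))) (fps_const (- inverse a) * (fps_shift 1 A * inverse A))"
    using f[of "Suc K"] by (intro inv_expansion_cmult inv_expansion_mult Suc.IH) (simp add: a_def)
  have "eventually (\<lambda>L. f L \<noteq> 0) at_top"
    using inv_expansion_tendsto[OF f] nz by (rule tendsto_imp_eventually_ne)
  hence "eventually (\<lambda>L. (- inverse a) * ((L * (f L - a)) * inverse (f L)) = L * (inverse (f L) - inverse a)) at_top"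
    by eventually_elim (use nz in \<open>simp add: a_def field_simps\<close>)
  from inv_expansion_cong[OF this, THEN iffD1, OF E]
  have "inv_expansion K (\<lambda>L. L * (inverse (f L) - inverse a)) (fps_shift 1 (inverse A))"
    unfolding sh .
  thus ?case by (simp add: a_def)
qed

text \<open>The induction varies the offset j: removing the constant term \<open>b j\<close> leaves
  w times the series with offset j + 1, and L w again has an expansion because W has no constant
  term.\<close>

lemma inv_expansion_compose:
  fixes b :: "nat \<Rightarrow> real"
  assumes b: "\<And>k. \<bar>b k\<bar> \<le> 1" and w: "\<And>K. inv_expansion K w W" and W0: "fps_nth W 0 = 0"
  shows "inv_expansion K (\<lambda>L. \<Sum>k. b (j + k) * w L ^ k) (fps_compose (Abs_fps (\<lambda>k. b (j + k))) W)"
proof -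
  have "(w \<longlongrightarrow> 0) at_top" using inv_expansion_tendsto[OF w] W0 by simp
  hence "((\<lambda>L. \<bar>w L\<bar>) \<longlongrightarrow> 0) at_top" by (rule tendsto_rabs_zero)
  hence small: "eventually (\<lambda>L. \<bar>w L\<bar> < 1 / 2) at_top" by (intro order_tendstoD) auto
  have bd: "norm (b (j + k) * x ^ k) \<le> (1 / 2) ^ k" if "\<bar>x\<bar> < 1 / 2" for j k x
  proof -
    have "norm (b (j + k) * x ^ k) \<le> 1 * (1 / 2) ^ k"
      unfolding norm_mult norm_power using that b[of "j + k"] by (intro mult_mono power_mono) auto
    thus ?thesis by simp
  qed
  have summ: "summable (\<lambda>k. b (j + k) * x ^ k)" if "\<bar>x\<bar> < 1 / 2" for j x
    by (rule summable_comparison_test'[OF summable_geometric[of "1/2"] bd[OF that]]) auto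
  show ?thesis
  proof (induction K arbitrary: j)
    case 0
    have "eventually (\<lambda>L. norm (\<Sum>k. b (j + k) * w L ^ k) \<le> 2 * norm (1::real)) at_top"
      using small
    proof eventually_elim
      case (elim L)
      have "norm (\<Sum>k. b (j + k) * w L ^ k) \<le> (\<Sum>k. (1 / 2 :: real) ^ k)"
        by (rule norm_suminf_le[OF bd[OF elim]]) auto
      thus ?case using suminf_geometric[of "1 / 2 :: real"] by simp
    qed
    thus ?case by (auto intro: bigoI)
  next
    case (Suc K)
    have e: "Abs_fps (\<lambda>k. b (j + k)) = fps_const (b j) + fps_X * Abs_fps (\<lambda>k. b (Suc j + k))"
      by (simp add: fps_eq_iff)
    have W: "W = fps_X * fps_shift 1 W" using W0 by (simp add: fps_eq_iff)
    have c: "fps_compose (Abs_fps (\<lambda>k. b (j + k))) W = fps_const (b j) + W * fps_compose (Abs_fps (\<lambda>k. b (Suc j + k))) W"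
      using W0 by (subst e) (simp add: fps_compose_add_distrib fps_compose_mult_distrib)
    have sh: "fps_shift 1 (fps_compose (Abs_fps (\<lambda>k. b (j + k))) W) = fps_shift 1 W * fps_compose (Abs_fps (\<lambda>k. b (Suc j + k))) W"
      unfolding c by (subst W) (simp add: fps_eq_iff mult.assoc)
    have E: "inv_expansion K (\<lambda>L. (L * w L) * (\<Sum>k. b (Suc j + k) * w L ^ k)) (fps_shift 1 W * fps_compose (Abs_fps (\<lambda>k. b (Suc j + k))) W)"
      using w[of "Suc K"] W0 by (intro inv_expansion_mult Suc.IH) simp
    have "eventually (\<lambda>L. (L * w L) * (\<Sum>k. b (Suc j + k) * w L ^ k) = L * ((\<Sum>k. b (j + k) * w L ^ k) - b j)) at_top"
      using small
    proof eventually_elim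
      case (elim L)
      from powser_split_head(1)[OF summ[OF elim, of j]] show ?case by simp
    qed
    from inv_expansion_cong[OF this, THEN iffD1, OF E] show ?case unfolding inv_expansion.simps sh by simp
  qed
qed

definition arctan_coeff :: "nat \<Rightarrow> real" where
  "arctan_coeff n = (if even n then 0 else (-1) ^ (n div 2) / real n)"

lemma arctan_powser:
  assumes "\<bar>x\<bar> < 1"
  shows "arctan x = (\<Sum>k. arctan_coeff k * x ^ k)"
proof -
  have s: "summable (\<lambda>k. (-1)^k * (1 / real (k * 2 + 1) * x ^ (k * 2 + 1)))"
    using assms by (intro summable_arctan_series) auto
  hence "(\<lambda>k. (-1)^k * (1 / real (k * 2 + 1) * x ^ (k * 2 + 1))) sums arctan x"
    using arctan_series[of x] assms by (simp add: sums_iff)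
  moreover have "(\<lambda>k. (-1)^k * (1 / real (k * 2 + 1) * x ^ (k * 2 + 1))) = (\<lambda>k. arctan_coeff (k * 2 + 1) * x ^ (k * 2 + 1))"
    by (simp add: fun_eq_iff arctan_coeff_def)
  ultimately have "(\<lambda>k. arctan_coeff (k * 2 + 1) * x ^ (k * 2 + 1)) sums arctan x" by simp
  moreover have "strict_mono (\<lambda>k::nat. k * 2 + 1)" by (auto simp: strict_mono_def)
  ultimately have "(\<lambda>k. arctan_coeff k * x ^ k) sums arctan x"
    by (subst (asm) sums_mono_reindex[where f = "\<lambda>k. arctan_coeff k * x ^ k"])
       (auto simp: arctan_coeff_def elim!: oddE)
  thus ?thesis by (simp add: sums_iff)
qed

lemma inv_expansion_arctan:
  assumes w: "\<And>K. inv_expansion K w W" and W0: "fps_nth W 0 = 0"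
  shows "inv_expansion K (\<lambda>L. arctan (w L)) (fps_compose (Abs_fps arctan_coeff) W)"
proof -
  have b: "\<bar>arctan_coeff k\<bar> \<le> 1" for k
    by (auto simp: arctan_coeff_def abs_mult power_abs elim!: oddE)
  have E: "inv_expansion K (\<lambda>L. \<Sum>k. arctan_coeff (0 + k) * w L ^ k) (fps_compose (Abs_fps (\<lambda>k. arctan_coeff (0 + k))) W)"
    by (rule inv_expansion_compose[OF b w W0])
  have "(w \<longlongrightarrow> 0) at_top" using inv_expansion_tendsto[OF w] W0 by simp
  hence "((\<lambda>L. \<bar>w L\<bar>) \<longlongrightarrow> 0) at_top" by (rule tendsto_rabs_zero)
  hence "eventually (\<lambda>L. \<bar>w L\<bar> < 1) at_top" by (intro order_tendstoD) auto
  hence "eventually (\<lambda>L. (\<Sum>k. arctan_coeff (0 + k) * w L ^ k) = arctan (w L)) at_top"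
    by eventually_elim (simp add: arctan_powser)
  from inv_expansion_cong[OF this, THEN iffD1, OF E] show ?thesis by simp
qed

lemma inv_expansion_imp_bigo:
  "inv_expansion K f A \<Longrightarrow> (\<lambda>L. f L - (\<Sum>k<K. fps_nth A k / L ^ k)) \<in> O[at_top](\<lambda>L. 1 / L ^ K)"
proof (induction K arbitrary: f A)
  case (Suc K)
  from Suc.IH[OF Suc.prems[unfolded inv_expansion.simps]]
  have "(\<lambda>L. L * (f L - fps_nth A 0) - (\<Sum>k<K. fps_nth A (Suc k) / L ^ k)) \<in> O[at_top](\<lambda>L. 1 / L ^ K)"
    by simp
  hence "(\<lambda>L. (L * (f L - fps_nth A 0) - (\<Sum>k<K. fps_nth A (Suc k) / L ^ k)) * (1 / L)) \<in> O[at_top](\<lambda>L. 1 / L ^ K * (1 / L))"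
    by (rule landau_o.big.mult) simp
  moreover have "eventually (\<lambda>L. (L * (f L - fps_nth A 0) - (\<Sum>k<K. fps_nth A (Suc k) / L ^ k)) * (1 / L) =
      f L - (\<Sum>k<Suc K. fps_nth A k / L ^ k)) at_top"
    using eventually_gt_at_top[of 0]
  proof eventually_elim
    case (elim L)
    have "(\<Sum>k<K. fps_nth A (Suc k) / L ^ k) * (1 / L) = (\<Sum>k<K. fps_nth A (Suc k) / L ^ Suc k)"
      unfolding sum_distrib_right by (intro sum.cong) (auto simp: mult.commute)
    moreover have "L * (f L - fps_nth A 0) * (1 / L) = f L - fps_nth A 0" using elim by simp
    ultimately show ?case unfolding left_diff_distrib sum.lessThan_Suc_shift by simp
  qed
  ultimately show ?case by (simp add: landau_o.big.in_cong mult.commute)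
qed simp

text \<open>The power m is there for the induction, since peeling off a coefficient multiplies by
  L.\<close>

lemma inv_expansion_exp_neg: "inv_expansion K (\<lambda>L. c * L ^ m * exp (- L)) 0"
proof (induction K arbitrary: m)
  case 0
  have "(\<lambda>L::real. L ^ m * exp (- L)) \<in> O(\<lambda>_. 1)" by real_asymp
  from landau_o.big.mult[OF _ this, of "\<lambda>_. c" "\<lambda>_. 1"] show ?case by (simp add: mult.assoc)
next
  case (Suc K)
  from Suc.IH[of "Suc m"] show ?case by (simp add: mult_ac)
qed

section \<open>Watson's lemma on the unit interval\<close>

locale watson =
  fixes H :: "nat \<Rightarrow> complex \<Rightarrow> complex"
  assumes deriv: "x \<in> {0..1} \<Longrightarrow> (H k has_field_derivative H (Suc k) (of_real x)) (at (of_real x))"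
begin

definition laplace :: "nat \<Rightarrow> real \<Rightarrow> complex" where
  "laplace k L = integral {0..1} (\<lambda>x. H k (of_real x) * of_real (exp (- L * x)))"

lemma continuous_on_H: "continuous_on {0..1} (\<lambda>x. H k (of_real x))"
proof (rule continuous_at_imp_continuous_on, rule ballI)
  fix x :: real assume "x \<in> {0..1}"
  hence "isCont (H k) (of_real x)" using DERIV_isCont[OF deriv] by blast
  moreover have "isCont complex_of_real x" by (intro continuous_intros)
  ultimately show "isCont (\<lambda>x. H k (of_real x)) x" by (intro isCont_o2[of x complex_of_real "H k"])
qed

lemma laplace_integrable: "(\<lambda>x. H k (of_real x) * of_real (exp (- L * x))) integrable_on {0..1}"
  by (intro integrable_continuous_interval continuous_intros continuous_on_H)

lemma laplace_parts:
  "of_real L * laplace k L = H k 0 - H k 1 * of_real (exp (- L)) + laplace (Suc k) L"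
proof -
  have 1: "((\<lambda>x. H (Suc k) (of_real x) * of_real (exp (- L * x)) - of_real L * (H k (of_real x) * of_real (exp (- L * x))))
     has_integral (H k (of_real 1) * of_real (exp (- L * 1)) - H k (of_real 0) * of_real (exp (- L * 0)))) {0..1}"
  proof (rule fundamental_theorem_of_calculus)
    fix x :: real assume x: "x \<in> {0..1}"
    have "((\<lambda>z. H k z * exp (- of_real L * z)) has_field_derivative
       (H (Suc k) (of_real x) * exp (- of_real L * of_real x) - of_real L * (H k (of_real x) * exp (- of_real L * of_real x)))) (at (of_real x))"
      by (rule derivative_eq_intros deriv[OF x] refl)+ (simp add: algebra_simps)
    from has_vector_derivative_real_field[OF this, of "{0..1}"]
    show "((\<lambda>x. H k (of_real x) * of_real (exp (- L * x))) has_vector_derivative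
      (H (Suc k) (of_real x) * of_real (exp (- L * x)) - of_real L * (H k (of_real x) * of_real (exp (- L * x))))) (at x within {0..1})"
      by (simp flip: exp_of_real)
  qed auto
  have 2: "((\<lambda>x. H (Suc k) (of_real x) * of_real (exp (- L * x)) - of_real L * (H k (of_real x) * of_real (exp (- L * x))))
     has_integral (laplace (Suc k) L - of_real L * laplace k L)) {0..1}"
    unfolding laplace_def by (intro has_integral_diff has_integral_mult_right integrable_integral laplace_integrable)
  from has_integral_unique[OF 2 1] have "laplace (Suc k) L - of_real L * laplace k L = H k 1 * of_real (exp (- L)) - H k 0"
    by simp
  thus ?thesis by (simp add: algebra_simps)
qed

lemma laplace_bound: "\<exists>M. \<forall>L>0. norm (of_real L * laplace k L) \<le> M"
proof -
  have "compact ((\<lambda>x. H k (of_real x)) ` {0..1})" by (intro compact_continuous_image continuous_on_H) auto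
  hence "bounded ((\<lambda>x. H k (of_real x)) ` {0..1})" by (rule compact_imp_bounded)
  then obtain M where M: "M > 0" "\<And>x. x \<in> {0..1} \<Longrightarrow> norm (H k (of_real x)) \<le> M"
    unfolding bounded_pos by blast
  have "norm (of_real L * laplace k L) \<le> M" if L: "L > 0" for L
  proof -
    have I: "((\<lambda>x. M * exp (- L * x)) has_integral (M * (- exp (- L * 1) / L - (- exp (- L * 0) / L)))) {0..1}"
    proof (intro has_integral_mult_right fundamental_theorem_of_calculus)
      fix x :: real
      have "((\<lambda>x. - exp (- L * x) / L) has_real_derivative exp (- L * x)) (at x within {0..1})"
        using L by (auto intro!: derivative_eq_intros)
      thus "((\<lambda>x. - exp (- L * x) / L) has_vector_derivative exp (- L * x)) (at x within {0..1})"
        by (simp flip: has_real_derivative_iff_has_vector_derivative)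
    qed auto
    have "norm (laplace k L) \<le> integral {0..1} (\<lambda>x. M * exp (- L * x))"
      unfolding laplace_def
      by (rule integral_norm_bound_integral[OF laplace_integrable])
         (use I M in \<open>auto simp: norm_mult intro!: mult_right_mono\<close>)
    also have "\<dots> = M * (1 - exp (- L)) / L" unfolding integral_unique[OF I] by (simp add: diff_divide_distrib right_diff_distrib)
    also have "\<dots> \<le> M * 1 / L" using M L by (intro divide_right_mono mult_left_mono) auto
    finally show ?thesis using L by (simp add: norm_mult field_simps)
  qed
  thus ?thesis by blast
qed

text \<open>By \<open>laplace_parts\<close> the peeled coefficient is \<open>\<phi> (H k 0)\<close>
  and the remainder is the transform of the next derivative; the boundary term at 1 is exponentially
  small and has the zero expansion. The map \<open>\<phi>\<close> will be the real or the imaginary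
  part.\<close>

lemma laplace_expansion:
  assumes phi: "bounded_linear \<phi>"
  shows "inv_expansion K (\<lambda>L. \<phi> (of_real L * laplace k L)) (Abs_fps (\<lambda>n. \<phi> (H (k + n) 0)))"
proof (induction K arbitrary: k)
  case 0
  obtain M where M: "\<And>L. L > 0 \<Longrightarrow> norm (of_real L * laplace k L) \<le> M" using laplace_bound by blast
  obtain B where B: "B > 0" "\<And>z. norm (\<phi> z) \<le> norm z * B" using bounded_linear.pos_bounded[OF phi] by blast
  have "eventually (\<lambda>L. norm (\<phi> (of_real L * laplace k L)) \<le> (M * B) * norm (1::real)) at_top"
    using eventually_gt_at_top[of 0]
  proof eventually_elim
    case (elim L)
    have "norm (\<phi> (of_real L * laplace k L)) \<le> norm (of_real L * laplace k L) * B" by (rule B)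
    also have "\<dots> \<le> M * B" using M[OF elim] B(1) by (intro mult_right_mono) auto
    finally show ?case by simp
  qed
  thus ?case by (auto intro: bigoI)
next
  case (Suc K)
  interpret bounded_linear \<phi> by fact
  have sc: "\<phi> (of_real r * z) = r * \<phi> z" for r z by (simp add: scaleR scaleR_conv_of_real[symmetric])
  have "L * (\<phi> (of_real L * laplace k L) - \<phi> (H k 0)) =
     \<phi> (of_real L * laplace (Suc k) L) + (- \<phi> (H k 1)) * L ^ 1 * exp (- L)" for L
  proof -
    have "\<phi> (of_real L * laplace k L) = \<phi> (H k 0) - exp (- L) * \<phi> (H k 1) + \<phi> (laplace (Suc k) L)"
      by (simp only: laplace_parts[of L k] add diff mult.commute[of "H k 1"] sc)
    hence "\<phi> (of_real L * laplace k L) - \<phi> (H k 0) = \<phi> (laplace (Suc k) L) - exp (- L) * \<phi> (H k 1)" by simp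
    thus ?thesis by (simp only: sc[of L "laplace (Suc k) L"]) (simp add: algebra_simps)
  qed
  moreover have "fps_shift 1 (Abs_fps (\<lambda>n. \<phi> (H (k + n) 0))) = Abs_fps (\<lambda>n. \<phi> (H (Suc k + n) 0)) + 0"
    by (simp add: fps_eq_iff)
  ultimately show ?case using inv_expansion_add[OF Suc.IH[of "Suc k"] inv_expansion_exp_neg[of K "- \<phi> (H k 1)" 1]]
    by simp
qed

end

section \<open>The Taylor coefficients of the rotated Gamma function\<close>

lemma fps_mult_nth_le_5:
  fixes X Y :: "'a :: comm_ring_1 fps"
  shows "fps_nth (X * Y) (Suc 0) = fps_nth X 0 * fps_nth Y (Suc 0) + fps_nth X (Suc 0) * fps_nth Y 0"
    "fps_nth (X * Y) 2 = fps_nth X 0 * fps_nth Y 2 + fps_nth X (Suc 0) * fps_nth Y (Suc 0) + fps_nth X 2 * fps_nth Y 0"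
    "fps_nth (X * Y) 3 = fps_nth X 0 * fps_nth Y 3 + fps_nth X (Suc 0) * fps_nth Y 2 + fps_nth X 2 * fps_nth Y (Suc 0) + fps_nth X 3 * fps_nth Y 0"
    "fps_nth (X * Y) 4 = fps_nth X 0 * fps_nth Y 4 + fps_nth X (Suc 0) * fps_nth Y 3 + fps_nth X 2 * fps_nth Y 2 + fps_nth X 3 * fps_nth Y (Suc 0) + fps_nth X 4 * fps_nth Y 0"
    "fps_nth (X * Y) 5 = fps_nth X 0 * fps_nth Y 5 + fps_nth X (Suc 0) * fps_nth Y 4 + fps_nth X 2 * fps_nth Y 3 + fps_nth X 3 * fps_nth Y 2 + fps_nth X 4 * fps_nth Y (Suc 0) + fps_nth X 5 * fps_nth Y 0"
  by (simp_all add: fps_mult_nth numeral_eq_Suc)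

definition gamma_fps :: "complex fps" where "gamma_fps = fps_expansion Gamma 1"

definition gamma_coeff :: "nat \<Rightarrow> real" where "gamma_coeff n = Re (fps_nth gamma_fps n)"

lemma has_fps_expansion_gamma: "(\<lambda>z. Gamma (1 + z)) has_fps_expansion gamma_fps"
  unfolding gamma_fps_def
  by (rule analytic_at_imp_has_fps_expansion) (auto intro!: analytic_Gamma)

lemma eventually_not_nonpos_Int: "eventually (\<lambda>z::complex. 1 + z \<notin> \<int>\<^sub>\<le>\<^sub>0 \<and> 1 - z \<notin> \<int>\<^sub>\<le>\<^sub>0) (nhds 0)"
proof -
  have "eventually (\<lambda>z::complex. z \<in> ball 0 1) (nhds 0)"
    by (rule eventually_nhds_in_open) auto
  thus ?thesis
  proof eventually_elim
    case (elim z)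
    hence "\<bar>Re z\<bar> < 1" using abs_Re_le_cmod[of z] by simp
    hence "Re (1 + z) > 0" "Re (1 - z) > 0" by auto
    moreover have "w \<notin> \<int>\<^sub>\<le>\<^sub>0" if "Re w > 0" for w :: complex using that by (auto elim!: nonpos_Ints_cases)
    ultimately show ?case by blast
  qed
qed

text \<open>The identity Gamma' = Gamma * Digamma, read as a recurrence for the Taylor coefficients
  of Gamma at 1.\<close>

lemma fps_deriv_gamma_fps:
  "fps_deriv gamma_fps = gamma_fps * Abs_fps (\<lambda>n. of_real (Polygamma n 1 / fact n))"
proof -
  have "(\<lambda>z. Digamma (1 + z)) has_fps_expansion fps_expansion (Digamma :: complex \<Rightarrow> complex) 1"
    by (rule analytic_at_imp_has_fps_expansion) (auto intro!: analytic_on_Polygamma)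
  also have "fps_expansion (Digamma :: complex \<Rightarrow> complex) 1 = Abs_fps (\<lambda>n. of_real (Polygamma n 1 / fact n))"
  proof -
    have "(deriv ^^ n) Digamma (1 :: complex) = of_real (Polygamma n 1)" for n
      using higher_deriv_Polygamma[of "1 :: complex" n 0] Polygamma_of_real[of 1 n, where 'a = complex] by simp
    thus ?thesis by (simp add: fps_expansion_def fps_eq_iff)
  qed
  finally have E1: "(\<lambda>z. Gamma (1 + z) * Digamma (1 + z)) has_fps_expansion
     gamma_fps * Abs_fps (\<lambda>n. of_real (Polygamma n 1 / fact n))"
    by (intro has_fps_expansion_mult has_fps_expansion_gamma)
  have ev: "eventually (\<lambda>z. deriv (\<lambda>z. Gamma (1 + z)) z = Gamma (1 + z) * Digamma (1 + z)) (nhds (0::complex))"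
    using eventually_not_nonpos_Int
    by eventually_elim (rule DERIV_imp_deriv, auto intro!: derivative_eq_intros)
  have E2: "deriv (\<lambda>z. Gamma (1 + z)) has_fps_expansion fps_deriv gamma_fps"
    by (intro has_fps_expansion_deriv has_fps_expansion_gamma)
  show ?thesis
    by (rule fps_expansion_unique_complex[OF E2 has_fps_expansion_cong[OF ev refl, THEN iffD2, OF E1]])
qed

lemma gamma_fps_0: "fps_nth gamma_fps 0 = 1"
  by (simp add: gamma_fps_def fps_expansion_def)

text \<open>The recurrence has real data, so reality propagates from the constant term.\<close>

lemma gamma_fps_real: "fps_nth gamma_fps n = of_real (gamma_coeff n)"
proof -
  have "fps_nth gamma_fps n \<in> \<real>"
  proof (induction n rule: less_induct)
    case (less n)
    show ?case
    proof (cases n)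
      case (Suc m)
      have "of_nat (Suc m) * fps_nth gamma_fps (Suc m) = fps_nth (fps_deriv gamma_fps) m" by simp
      also have "\<dots> = (\<Sum>i=0..m. fps_nth gamma_fps i * of_real (Polygamma (m - i) 1 / fact (m - i)))"
        unfolding fps_deriv_gamma_fps by (simp add: fps_mult_nth)
      also have "\<dots> \<in> \<real>" using less Suc by (intro sum_in_Reals Reals_mult Reals_of_real) auto
      finally have "of_nat (Suc m) * fps_nth gamma_fps (Suc m) / of_nat (Suc m) \<in> \<real>"
        by (intro Reals_divide) auto
      thus ?thesis using Suc by (simp del: of_nat_Suc)
    qed (simp add: gamma_fps_0)
  qed
  thus ?thesis by (simp add: gamma_coeff_def)
qed

lemma gamma_coeff_0: "gamma_coeff 0 = 1"
  by (simp add: gamma_coeff_def gamma_fps_0)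

lemma gamma_coeff_recurrence:
  "real (Suc n) * gamma_coeff (Suc n) = fps_nth (Abs_fps gamma_coeff * Abs_fps (\<lambda>n. Polygamma n 1 / fact n)) n"
proof -
  have "of_nat (Suc n) * fps_nth gamma_fps (Suc n) = fps_nth (fps_deriv gamma_fps) n" by simp
  also have "\<dots> = (\<Sum>i=0..n. fps_nth gamma_fps i * of_real (Polygamma (n - i) 1 / fact (n - i)))"
    unfolding fps_deriv_gamma_fps by (simp add: fps_mult_nth)
  also have "\<dots> = of_real (\<Sum>i=0..n. gamma_coeff i * (Polygamma (n - i) 1 / fact (n - i)))"
    by (simp add: gamma_fps_real)
  finally have "complex_of_real (real (Suc n) * gamma_coeff (Suc n)) =
      of_real (\<Sum>i=0..n. gamma_coeff i * (Polygamma (n - i) 1 / fact (n - i)))"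
    by (simp add: gamma_fps_real del: of_nat_Suc)
  thus ?thesis unfolding of_real_eq_iff by (simp add: fps_mult_nth)
qed

text \<open>
  The reflection formula supplies the coefficients of order 2 and 4, so that neither \<open>\<zeta>(2)\<close>
  nor \<open>\<zeta>(4)\<close> has to be evaluated.
\<close>
lemma gamma_reflection_fps:
  "Abs_fps gamma_coeff * Abs_fps (\<lambda>n. (-1) ^ n * gamma_coeff n) * fps_sin pi = fps_const pi * fps_X"
proof -
  have hol: "Gamma holomorphic_on {z. Re z > 0}"
    by (rule holomorphic_Gamma) (auto elim!: nonpos_Ints_cases)
  have op: "open {z. Re z > 0}" by (simp add: open_halfspace_Re_gt)
  have opS: "open {z. Re z < 1}" by (simp add: open_halfspace_Re_lt)
  have ana: "(\<lambda>z. Gamma (1 - z)) analytic_on {0::complex}"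
    by (intro analytic_intros) auto
  have e2: "fps_expansion (\<lambda>z::complex. Gamma (1 - z)) 0 = Abs_fps (\<lambda>n. of_real ((-1) ^ n * gamma_coeff n))"
  proof (rule fps_ext)
    fix n
    have "(deriv ^^ n) (\<lambda>z::complex. Gamma ((-1) * z + 1)) 0 = (-1) ^ n * (deriv ^^ n) Gamma ((-1) * 0 + 1)"
      by (rule higher_deriv_compose_linear'[OF hol opS op]) auto
    hence "fps_nth (fps_expansion (\<lambda>z::complex. Gamma (1 - z)) 0) n = (-1) ^ n * fps_nth gamma_fps n"
      by (simp add: fps_expansion_def gamma_fps_def)
    thus "fps_nth (fps_expansion (\<lambda>z::complex. Gamma (1 - z)) 0) n = fps_nth (Abs_fps (\<lambda>n. of_real ((-1) ^ n * gamma_coeff n))) n"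
      by (simp add: gamma_fps_real)
  qed
  have E1: "(\<lambda>z. Gamma (1 + z) * Gamma (1 - z) * sin (of_real pi * z)) has_fps_expansion
      gamma_fps * Abs_fps (\<lambda>n. of_real ((-1) ^ n * gamma_coeff n)) * fps_sin (of_real pi)"
    using analytic_at_imp_has_fps_expansion_0[OF ana] unfolding e2
    by (intro has_fps_expansion_mult has_fps_expansion_gamma has_fps_expansion_sin)
  have E2: "(\<lambda>z. of_real pi * z) has_fps_expansion fps_const (complex_of_real pi) * fps_X"
    by (intro has_fps_expansion_cmult_left has_fps_expansion_fps_X)
  have ev: "eventually (\<lambda>z::complex. Gamma (1 + z) * Gamma (1 - z) * sin (of_real pi * z) = of_real pi * z) (nhds 0)"
    using eventually_not_nonpos_Int
  proof eventually_elim
    case (elim z)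
    have nz: "Gamma (1 + z) \<noteq> 0" "Gamma (1 - z) \<noteq> 0" using elim by (auto simp: Gamma_eq_zero_iff)
    have "rGamma z = z * rGamma (1 + z)" using rGamma_plus1[of z] by (simp add: add.commute)
    hence "sin (of_real pi * z) = of_real pi * (z * rGamma (1 + z) * rGamma (1 - z))"
      using rGamma_reflection_complex[of z] by simp
    thus ?case using nz by (simp add: rGamma_inverse_Gamma field_simps)
  qed
  have eq: "gamma_fps * Abs_fps (\<lambda>n. of_real ((-1) ^ n * gamma_coeff n)) * fps_sin (of_real pi) =
      fps_const (complex_of_real pi) * fps_X"
    by (rule fps_expansion_unique_complex[OF has_fps_expansion_cong[OF ev refl, THEN iffD1, OF E1] E2])
  show ?thesis
  proof (rule fps_ext)
    fix n
    have "complex_of_real (fps_nth (Abs_fps gamma_coeff * Abs_fps (\<lambda>n. (-1) ^ n * gamma_coeff n) * fps_sin pi) n) =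
      fps_nth (gamma_fps * Abs_fps (\<lambda>n. of_real ((-1) ^ n * gamma_coeff n)) * fps_sin (of_real pi)) n"
      by (simp add: fps_mult_nth gamma_fps_real fps_sin_def if_distrib cong: if_cong)
    also have "\<dots> = complex_of_real (fps_nth (fps_const pi * fps_X) n)" unfolding eq by simp
    finally show "fps_nth (Abs_fps gamma_coeff * Abs_fps (\<lambda>n. (-1) ^ n * gamma_coeff n) * fps_sin pi) n =
      fps_nth (fps_const pi * fps_X) n" unfolding of_real_eq_iff .
  qed
qed

lemma Polygamma_2_1: "Polygamma 2 (1::real) = - 2 * zeta 3"
proof -
  have "inverse ((1 + real k) ^ Suc 2) = 1 / real (Suc k) powr 3" for k
    by (simp add: powr_numeral divide_inverse numeral_eq_Suc add.commute)
  thus ?thesis by (simp add: Polygamma_def zeta_def)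
qed

lemma gamma_coeff_values:
  defines "g \<equiv> euler_mascheroni" and "p \<equiv> pi" and "z \<equiv> zeta 3"
  shows "gamma_coeff (Suc 0) = - g"
    "gamma_coeff 2 = g ^ 2 / 2 + p ^ 2 / 12"
    "gamma_coeff 3 = - (g ^ 3) / 6 - g * p ^ 2 / 12 - z / 3"
    "gamma_coeff 4 = g ^ 4 / 24 + g ^ 2 * p ^ 2 / 24 + g * z / 3 + p ^ 4 / 160"
proof -
  define a where "a = Polygamma 1 (1::real)"
  have p0: "Polygamma 0 (1::real) = - g" by (simp add: g_def)
  note r = gamma_coeff_recurrence
  have c1: "gamma_coeff (Suc 0) = - g"
    using r[of 0] by (simp add: gamma_coeff_0 p0 del: Digamma_1)
  have c2: "2 * gamma_coeff 2 = g ^ 2 + a"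
    using r[of 1] by (simp add: fps_mult_nth_le_5 gamma_coeff_0 c1 p0 a_def power2_eq_square numeral_2_eq_2 del: Digamma_1)
  have c3: "3 * gamma_coeff 3 = - z - g * a - gamma_coeff 2 * g"
    using r[of 2] by (simp add: fps_mult_nth_le_5 gamma_coeff_0 c1 p0 a_def Polygamma_2_1 z_def numeral_3_eq_3 algebra_simps del: Digamma_1)
  have s: "fps_nth (fps_sin p) 0 = 0" "fps_nth (fps_sin p) (Suc 0) = p" "fps_nth (fps_sin p) 2 = 0"
    "fps_nth (fps_sin p) 3 = - (p ^ 3) / 6" "fps_nth (fps_sin p) 4 = 0" "fps_nth (fps_sin p) 5 = p ^ 5 / 120"
    by (simp_all add: fps_sin_def fact_numeral)
  note refl = gamma_reflection_fps[folded p_def]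
  \<comment> \<open>This is the series of pi z / sin (pi z). Orders 3 and 5 of the reflection
    identity give its coefficients of order 2 and 4; these fix \<open>gamma_coeff 2\<close> and,
    once \<open>gamma_coeff 3\<close> is known from the recurrence,
    \<open>gamma_coeff 4\<close>.\<close>
  define E where "E = Abs_fps gamma_coeff * Abs_fps (\<lambda>n. (-1) ^ n * gamma_coeff n)"
  have e: "fps_nth E 0 = 1" "fps_nth E (Suc 0) = 0" "fps_nth E 2 = 2 * gamma_coeff 2 - g ^ 2"
    "fps_nth E 4 = 2 * gamma_coeff 4 + 2 * g * gamma_coeff 3 + gamma_coeff 2 ^ 2"
    unfolding E_def by (simp_all add: fps_mult_nth_le_5 gamma_coeff_0 c1 power2_eq_square)
  have p: "p > 0" by (simp add: p_def)
  have "fps_nth (E * fps_sin p) 3 = 0" unfolding E_def refl by simp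
  hence "p * (fps_nth E 2 - p ^ 2 / 6) = 0"
    unfolding fps_mult_nth_le_5 s e by (simp add: algebra_simps power2_eq_square power3_eq_cube)
  hence e2: "fps_nth E 2 = p ^ 2 / 6" using p by simp
  have "fps_nth (E * fps_sin p) 5 = 0" unfolding E_def refl by simp
  hence "fps_nth E 4 * p - fps_nth E 2 * p ^ 3 / 6 + p ^ 5 / 120 = 0"
    unfolding fps_mult_nth_le_5 s e(1,2) by simp
  hence "p * (fps_nth E 4 - p ^ 4 / 36 + p ^ 4 / 120) = 0"
    unfolding e2 by (simp add: algebra_simps numeral_eq_Suc)
  hence e4: "fps_nth E 4 = 7 * p ^ 4 / 360" using p by simp
  have a: "a = p ^ 2 / 6" using c2 e2 e(3) by simp
  have g2: "gamma_coeff 2 = g ^ 2 / 2 + p ^ 2 / 12" using c2 a by simp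
  have g3: "gamma_coeff 3 = - (g ^ 3) / 6 - g * p ^ 2 / 12 - z / 3"
    using c3 unfolding a g2 by (simp add: field_simps power2_eq_square power3_eq_cube)
  have "2 * gamma_coeff 4 = 7 * p ^ 4 / 360 - 2 * g * gamma_coeff 3 - gamma_coeff 2 ^ 2" using e4 e(4) by simp
  hence g4: "gamma_coeff 4 = g ^ 4 / 24 + g ^ 2 * p ^ 2 / 24 + g * z / 3 + p ^ 4 / 160"
    unfolding g2 g3 by (simp add: field_simps numeral_eq_Suc)
  show "gamma_coeff (Suc 0) = - g" "gamma_coeff 2 = g ^ 2 / 2 + p ^ 2 / 12"
    "gamma_coeff 3 = - (g ^ 3) / 6 - g * p ^ 2 / 12 - z / 3"
    "gamma_coeff 4 = g ^ 4 / 24 + g ^ 2 * p ^ 2 / 24 + g * z / 3 + p ^ 4 / 160"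
    by (fact c1 g2 g3 g4)+
qed

text \<open>The real and imaginary parts of its Laplace transform are the coefficients of sin (pi e)
  and - cos (pi e) in the approximate equation for a gap e; see
  \<open>laplace_rot_sin\<close>.\<close>

definition gamma_rot :: "complex \<Rightarrow> complex" where
  "gamma_rot z = Gamma (1 + z) * exp (\<i> * of_real pi * z)"

lemma higher_deriv_gamma_rot_0:
  "(deriv ^^ n) gamma_rot 0 = fact n * fps_nth (gamma_fps * fps_exp (\<i> * of_real pi)) n"
proof -
  have "gamma_rot has_fps_expansion gamma_fps * fps_exp (\<i> * of_real pi)"
    unfolding gamma_rot_def[abs_def] by (intro has_fps_expansion_mult has_fps_expansion_gamma has_fps_expansion_exp)
  from fps_nth_fps_expansion[OF this, of n] show ?thesis by simp
qed

interpretation rot: watson "\<lambda>k. (deriv ^^ k) gamma_rot"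
proof
  fix x :: real and k :: nat
  assume x: "x \<in> {0..1}"
  have "gamma_rot holomorphic_on {z. Re z > -1}"
    unfolding gamma_rot_def by (intro holomorphic_intros) (auto elim!: nonpos_Ints_cases simp: complex_eq_iff)
  hence "(deriv ^^ k) gamma_rot holomorphic_on {z. Re z > -1}"
    by (intro holomorphic_higher_deriv open_halfspace_Re_gt)
  from holomorphic_derivI[OF this open_halfspace_Re_gt, of "of_real x"] x
  show "((deriv ^^ k) gamma_rot has_field_derivative (deriv ^^ Suc k) gamma_rot (of_real x)) (at (of_real x))"
    by simp
qed

text \<open>The entries are the derivatives at 0 rather than the Taylor coefficients, since
  integration by parts produces these as the coefficients of 1 / L^n.\<close>

definition cos_fps :: "real fps" where "cos_fps = Abs_fps (\<lambda>n. Re ((deriv ^^ n) gamma_rot 0))"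
definition sin_fps :: "real fps" where "sin_fps = Abs_fps (\<lambda>n. Im ((deriv ^^ n) gamma_rot 0))"

text \<open>The formal version, in the variable 1 / L, of (1 / pi) arctan (S / C), where C and S are
  the real and imaginary parts of L times the transform.\<close>

definition eps_fps :: "real fps" where
  "eps_fps = fps_const (1 / pi) * fps_compose (Abs_fps arctan_coeff) (sin_fps * inverse cos_fps)"

text \<open>As \<open>sin_fps\<close> has no constant term, the quotient up to order 5 involves
  \<open>cos_fps\<close> only up to order 4.\<close>

lemma cos_sin_fps_values:
  defines "g \<equiv> euler_mascheroni" and "p \<equiv> pi" and "z \<equiv> zeta 3"
  shows "fps_nth cos_fps 0 = 1" "fps_nth cos_fps (Suc 0) = - g"
    "fps_nth cos_fps 2 = g ^ 2 - 5 / 6 * p ^ 2"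
    "fps_nth cos_fps 3 = - (g ^ 3) + 5 / 2 * g * p ^ 2 - 2 * z"
    "fps_nth cos_fps 4 = g ^ 4 - 5 * g ^ 2 * p ^ 2 + 8 * g * z + 3 / 20 * p ^ 4"
    "fps_nth sin_fps 0 = 0" "fps_nth sin_fps (Suc 0) = p" "fps_nth sin_fps 2 = - 2 * g * p"
    "fps_nth sin_fps 3 = 3 * g ^ 2 * p - p ^ 3 / 2"
    "fps_nth sin_fps 4 = - 4 * g ^ 3 * p + 2 * g * p ^ 3 - 8 * p * z"
    "fps_nth sin_fps 5 = 5 * g ^ 4 * p - 5 * g ^ 2 * p ^ 3 + 40 * g * p * z + p ^ 5 / 12"
proof -
  define E where "E = fps_exp (\<i> * complex_of_real p)"
  have E: "fps_nth E 0 = 1" "fps_nth E (Suc 0) = \<i> * of_real p" "fps_nth E 2 = of_real (- (p ^ 2) / 2)"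
    "fps_nth E 3 = \<i> * of_real (- (p ^ 3) / 6)" "fps_nth E 4 = of_real (p ^ 4 / 24)"
    "fps_nth E 5 = \<i> * of_real (p ^ 5 / 120)"
    unfolding E_def by (simp_all add: fact_numeral power_mult_distrib power_numeral_even power_numeral_odd complex_eq_iff Let_def)
  note d = higher_deriv_gamma_rot_0[folded p_def, folded E_def]
  note gv = gamma_coeff_values[folded g_def p_def z_def]
  note S = d fps_mult_nth_le_5 gamma_fps_real E gamma_coeff_0 gv
  show "fps_nth cos_fps 0 = 1" "fps_nth sin_fps 0 = 0"
    by (simp_all add: cos_fps_def sin_fps_def d[of 0, simplified] gamma_fps_0 E)
  show "fps_nth cos_fps (Suc 0) = - g" "fps_nth sin_fps (Suc 0) = p"
    using d[of "Suc 0"] by (simp_all add: cos_fps_def sin_fps_def S(2-))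
  show "fps_nth cos_fps 2 = g ^ 2 - 5 / 6 * p ^ 2" "fps_nth sin_fps 2 = - 2 * g * p"
    unfolding cos_fps_def sin_fps_def fps_nth_Abs_fps S by (simp_all add: field_simps numeral_eq_Suc)
  show "fps_nth cos_fps 3 = - (g ^ 3) + 5 / 2 * g * p ^ 2 - 2 * z" "fps_nth sin_fps 3 = 3 * g ^ 2 * p - p ^ 3 / 2"
    unfolding cos_fps_def sin_fps_def fps_nth_Abs_fps S by (simp_all add: field_simps numeral_eq_Suc)
  show "fps_nth cos_fps 4 = g ^ 4 - 5 * g ^ 2 * p ^ 2 + 8 * g * z + 3 / 20 * p ^ 4"
    "fps_nth sin_fps 4 = - 4 * g ^ 3 * p + 2 * g * p ^ 3 - 8 * p * z"
    unfolding cos_fps_def sin_fps_def fps_nth_Abs_fps S by (simp_all add: field_simps numeral_eq_Suc)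
  show "fps_nth sin_fps 5 = 5 * g ^ 4 * p - 5 * g ^ 2 * p ^ 3 + 40 * g * p * z + p ^ 5 / 12"
    unfolding cos_fps_def sin_fps_def fps_nth_Abs_fps S by (simp_all add: field_simps numeral_eq_Suc)
qed

text \<open>The coefficients of the quotient \<open>W\<close> are solved successively from W *
  \<open>cos_fps\<close> = \<open>sin_fps\<close>. Since W starts at order 1, only W, W^3 and W^5
  enter the arctangent up to order 5.\<close>

lemma eps_fps_values:
  defines "g \<equiv> euler_mascheroni" and "p \<equiv> pi" and "z \<equiv> zeta 3"
  shows "fps_nth eps_fps 0 = 0" "fps_nth eps_fps (Suc 0) = 1" "fps_nth eps_fps 2 = - g"
    "fps_nth eps_fps 3 = g ^ 2" "fps_nth eps_fps 4 = - (g ^ 3 + 6 * z)"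
    "fps_nth eps_fps 5 = g ^ 4 + 24 * g * z + 7 * p ^ 4 / 90"
proof -
  define W where "W = sin_fps * inverse cos_fps"
  note cs = cos_sin_fps_values[folded g_def p_def z_def]
  have p: "p > 0" by (simp add: p_def)
  have WC: "W * cos_fps = sin_fps"
    unfolding W_def mult.assoc by (subst inverse_mult_eq_1) (simp_all add: cs)
  have w0: "fps_nth W 0 = 0" by (simp add: W_def cs)
  have w1: "fps_nth W (Suc 0) = p"
    using arg_cong[OF WC, of "\<lambda>f. fps_nth f (Suc 0)"] unfolding fps_mult_nth_le_5 cs w0 by simp
  have w2: "fps_nth W 2 = - g * p"
    using arg_cong[OF WC, of "\<lambda>f. fps_nth f 2"] unfolding fps_mult_nth_le_5 cs w0 w1 by (simp add: algebra_simps)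
  have w3: "fps_nth W 3 = g ^ 2 * p + p ^ 3 / 3"
    using arg_cong[OF WC, of "\<lambda>f. fps_nth f 3"] unfolding fps_mult_nth_le_5 cs w0 w1 w2
    by (simp add: field_simps numeral_eq_Suc)
  have w4: "fps_nth W 4 = - (g ^ 3) * p - g * p ^ 3 - 6 * p * z"
    using arg_cong[OF WC, of "\<lambda>f. fps_nth f 4"] unfolding fps_mult_nth_le_5 cs w0 w1 w2 w3
    by (simp add: field_simps numeral_eq_Suc)
  have w5: "fps_nth W 5 = g ^ 4 * p + 2 * g ^ 2 * p ^ 3 + 24 * g * p * z + 19 / 90 * p ^ 5"
    using arg_cong[OF WC, of "\<lambda>f. fps_nth f 5"] unfolding fps_mult_nth_le_5 cs w0 w1 w2 w3 w4
    by (simp add: field_simps numeral_eq_Suc)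
  define V where "V = W * W"
  have v: "fps_nth V 0 = 0" "fps_nth V (Suc 0) = 0" "fps_nth V 2 = p ^ 2" "fps_nth V 3 = - 2 * g * p ^ 2"
    "fps_nth V 4 = 3 * g ^ 2 * p ^ 2 + 2 / 3 * p ^ 4"
    unfolding V_def fps_mult_nth_le_5 fps_mult_nth_0 w0 w1 w2 w3 by (simp_all add: field_simps numeral_eq_Suc)
  define U where "U = W * V"
  have u: "fps_nth U 0 = 0" "fps_nth U (Suc 0) = 0" "fps_nth U 2 = 0" "fps_nth U 3 = p ^ 3" "fps_nth U 4 = - 3 * g * p ^ 3"
    "fps_nth U 5 = 6 * g ^ 2 * p ^ 3 + p ^ 5"
    unfolding U_def fps_mult_nth_le_5 fps_mult_nth_0 w0 w1 w2 w3 v by (simp_all add: field_simps numeral_eq_Suc)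
  have t: "fps_nth (U * V) 5 = p ^ 5"
    unfolding fps_mult_nth_le_5 u v by (simp add: numeral_eq_Suc)
  have pw: "W ^ 3 = U" "W ^ 5 = U * V" unfolding U_def V_def by (simp_all add: numeral_eq_Suc mult_ac)
  have b: "arctan_coeff 0 = 0" "arctan_coeff (Suc 0) = 1" "arctan_coeff 2 = 0" "arctan_coeff 3 = - 1 / 3"
    "arctan_coeff 4 = 0" "arctan_coeff 5 = 1 / 5"
    by (simp_all add: arctan_coeff_def)
  have sums: "(\<Sum>i=0..1. f i) = f 0 + f (Suc 0)" "(\<Sum>i=0..2. f i) = f 0 + f (Suc 0) + f 2"
    "(\<Sum>i=0..3. f i) = f 0 + f (Suc 0) + f 2 + f 3" "(\<Sum>i=0..4. f i) = f 0 + f (Suc 0) + f 2 + f 3 + f 4"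
    "(\<Sum>i=0..5. f i) = f 0 + f (Suc 0) + f 2 + f 3 + f 4 + f 5" for f :: "nat \<Rightarrow> real"
    by (simp_all add: numeral_eq_Suc)
  have n: "fps_nth eps_fps k = (\<Sum>i=0..k. arctan_coeff i * fps_nth (W ^ i) k) / p" for k
    by (simp add: eps_fps_def fps_compose_nth W_def p_def)
  show "fps_nth eps_fps 0 = 0" by (simp add: n b)
  show "fps_nth eps_fps (Suc 0) = 1" using p w1 unfolding n One_nat_def[symmetric] sums by (simp add: b)
  show "fps_nth eps_fps 2 = - g" using p w2 unfolding n sums by (simp add: b)
  show "fps_nth eps_fps 3 = g ^ 2" using p unfolding n sums b pw u power_Suc0_right w3 by (simp add: field_simps)
  show "fps_nth eps_fps 4 = - (g ^ 3 + 6 * z)" using p unfolding n sums b pw u power_Suc0_right w4 by (simp add: field_simps)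
  show "fps_nth eps_fps 5 = g ^ 4 + 24 * g * z + 7 * p ^ 4 / 90"
    using p unfolding n sums b pw u t power_Suc0_right w5 by (simp add: field_simps numeral_eq_Suc)
qed

text \<open>The factor L cancels in the quotient; it makes the real part tend to 1, so that the
  denominator has an invertible expansion.\<close>

definition eps_approx :: "real \<Rightarrow> real" where
  "eps_approx L = 1 / pi * arctan (Im (of_real L * rot.laplace 0 L) * inverse (Re (of_real L * rot.laplace 0 L)))"

lemma cos_expansion: "inv_expansion K (\<lambda>L. Re (of_real L * rot.laplace 0 L)) cos_fps"
  using rot.laplace_expansion[OF bounded_linear_Re, of K 0] by (simp add: cos_fps_def)

lemma sin_expansion: "inv_expansion K (\<lambda>L. Im (of_real L * rot.laplace 0 L)) sin_fps"
  using rot.laplace_expansion[OF bounded_linear_Im, of K 0] by (simp add: sin_fps_def)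

lemma eps_approx_expansion: "inv_expansion K eps_approx eps_fps"
  unfolding eps_approx_def eps_fps_def
  by (intro inv_expansion_cmult inv_expansion_arctan inv_expansion_mult sin_expansion inv_expansion_inverse cos_expansion)
     (simp_all add: cos_sin_fps_values)

section \<open>Asymptotics of the zeros\<close>

lemma arctan_lipschitz: "\<bar>arctan x - arctan y\<bar> \<le> \<bar>x - y\<bar>"
proof -
  have *: "\<bar>arctan b - arctan a\<bar> \<le> \<bar>b - a\<bar>" if ab: "a < b" for a b
  proof -
    obtain z where z: "arctan b - arctan a = (b - a) * inverse (1 + z\<^sup>2)"
      using MVT2[OF ab DERIV_arctan] by blast
    have "1 + z\<^sup>2 \<ge> 1" by simp
    hence "0 \<le> inverse (1 + z\<^sup>2)" "inverse (1 + z\<^sup>2) \<le> 1" by (simp, intro inverse_le_1_iff[THEN iffD2]) simp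
    thus ?thesis unfolding z abs_mult using ab by (simp add: mult_left_le)
  qed
  consider "x < y" | "y < x" | "x = y" by linarith
  thus ?thesis using *[of x y] *[of y x] by cases (auto simp: abs_minus_commute)
qed

text \<open>For s in (n, n + 1) both n^(-x) and Gamma (s - x) / Gamma s lie between these two
  powers. The quotient of the powers is q^x, and q^x \<ge> q because x \<le> 1.\<close>

lemma powr_neg_diff_le:
  assumes n: "n \<ge> 2" and x: "x \<in> {0..1}"
  shows "(real n - 1) powr (- x) - (real n + 1) powr (- x) \<le> 2 / real n"
proof -
  define q where "q = (real n - 1) / (real n + 1)"
  have q: "0 < q" "q \<le> 1" using n by (auto simp: q_def)
  have "q powr 1 \<le> q powr x" using q x by (intro powr_mono') auto
  hence qx: "q \<le> q powr x" using q by simp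
  have "(real n - 1) powr (- x) * q powr x = (real n + 1) powr (- x)"
    unfolding q_def using n by (simp add: powr_divide powr_minus field_simps)
  hence "(real n - 1) powr (- x) - (real n + 1) powr (- x) = (real n - 1) powr (- x) * (1 - q powr x)"
    by (simp add: right_diff_distrib)
  also have "\<dots> \<le> 1 * (1 - q)"
  proof (intro mult_mono)
    have "(real n - 1) powr (- x) \<le> (real n - 1) powr 0" using n x by (intro powr_mono) auto
    thus "(real n - 1) powr (- x) \<le> 1" using n by simp
    have "q powr x \<le> q powr 0" using q x by (intro powr_mono') auto
    thus "0 \<le> 1 - q powr x" using q by simp
  qed (use qx in auto)
  also have "\<dots> = 2 / (real n + 1)" using n by (simp add: q_def field_simps)
  also have "\<dots> \<le> 2 / real n" using n by (intro divide_left_mono) auto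
  finally show ?thesis .
qed

lemma Gamma_bounded: obtains M where "M > 0" "\<And>x::real. x \<in> {0..1} \<Longrightarrow> Gamma (1 + x) \<le> M"
proof -
  have "compact ((\<lambda>x::real. Gamma (1 + x)) ` {0..1})"
    by (intro compact_continuous_image continuous_on_Gamma_compose continuous_intros) auto
  hence "bounded ((\<lambda>x::real. Gamma (1 + x)) ` {0..1})" by (rule compact_imp_bounded)
  then obtain M where "M > 0" "\<And>x::real. x \<in> {0..1} \<Longrightarrow> norm (Gamma (1 + x)) \<le> M"
    unfolding bounded_pos by blast
  thus ?thesis using that[of M] by (auto simp: abs_le_iff)
qed

lemma laplace_rot_sin:
  "((\<lambda>x. Gamma (1 + x) * exp (- L * x) * sin (pi * (e - x))) has_integral
     (sin (pi * e) * Re (rot.laplace 0 L) - cos (pi * e) * Im (rot.laplace 0 L))) {0..1}"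
proof -
  define h where "h = (\<lambda>z. sin (pi * e) * Re z - cos (pi * e) * Im z)"
  have bl: "bounded_linear h" unfolding h_def
    by (intro bounded_linear_sub bounded_linear_const_mult bounded_linear_Re bounded_linear_Im)
  have "((\<lambda>x. (deriv ^^ 0) gamma_rot (of_real x) * of_real (exp (- L * x))) has_integral rot.laplace 0 L) {0..1}"
    unfolding rot.laplace_def by (intro integrable_integral rot.laplace_integrable)
  from has_integral_linear[OF this bl]
  have "((\<lambda>x. h (gamma_rot (of_real x) * of_real (exp (- L * x)))) has_integral h (rot.laplace 0 L)) {0..1}"
    by (simp add: o_def)
  moreover have "h (gamma_rot (of_real x) * of_real (exp (- L * x))) = Gamma (1 + x) * exp (- L * x) * sin (pi * (e - x))" for x
  proof -
    have G: "Gamma (1 + complex_of_real x) = of_real (Gamma (1 + x))"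
      using Gamma_complex_of_real[of "1 + x"] by simp
    have E: "exp (\<i> * of_real pi * of_real x) = cis (pi * x)" by (simp add: cis_conv_exp mult.assoc)
    have "gamma_rot (of_real x) * of_real (exp (- L * x)) = of_real (Gamma (1 + x) * exp (- L * x)) * cis (pi * x)"
      unfolding gamma_rot_def G E of_real_mult by (simp only: mult_ac)
    hence "h (gamma_rot (of_real x) * of_real (exp (- L * x))) =
       (Gamma (1 + x) * exp (- L * x)) * (sin (pi * e) * cos (pi * x) - cos (pi * e) * sin (pi * x))"
      unfolding h_def by (simp add: algebra_simps)
    also have "sin (pi * e) * cos (pi * x) - cos (pi * e) * sin (pi * x) = sin (pi * (e - x))"
      by (simp add: right_diff_distrib sin_diff)
    finally show ?thesis .
  qed
  ultimately show ?thesis by (simp add: h_def)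
qed

context gregory_zeros
begin

text \<open>The exact equation \<open>gmoment n e = 0\<close> is multiplied by s, which turns the
  weight into Gamma (1 + x) Gamma (s - x) / Gamma s. Replacing the last quotient by n^(-x) = exp (-
  L x) costs at most 2 / n at each x, and the result is the Laplace transform.\<close>

lemma rho_implicit:
  assumes M: "\<And>x::real. x \<in> {0..1} \<Longrightarrow> Gamma (1 + x) \<le> M" and n: "n \<ge> 2"
  defines "e \<equiv> \<rho> n - real n" and "L \<equiv> ln (real n)"
  shows "\<bar>sin (pi * e) * Re (rot.laplace 0 L) - cos (pi * e) * Im (rot.laplace 0 L)\<bar> \<le> M * (2 / real n)"
proof -
  define s where "s = real n + e"
  have e: "0 < e" "e < 1" using rho[of n] n by (auto simp: e_def)
  have s: "s > 1" "s = \<rho> n" using n e by (auto simp: s_def e_def)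
  have gm: "gmoment n e = 0"
  proof -
    have "gregory_real (real n + e) = 0" using rho_zero[of n] n by (simp add: e_def)
    thus ?thesis using gregory_real_eq_gmoment[of n e] s(1) by (simp add: s_def)
  qed
  have "continuous_on {0..1} (\<lambda>x. gweight s x * sin (pi * (e - x)))"
    by (intro continuous_intros continuous_on_gweight s(1))
  hence "((\<lambda>x. gweight s x * sin (pi * (e - x))) has_integral gmoment n e) {0..1}"
    unfolding gmoment_def s_def[symmetric] by (intro integrable_integral integrable_continuous_interval)
  hence "((\<lambda>x. gweight s x * sin (pi * (e - x))) has_integral 0) {0..1}" unfolding gm .
  from has_integral_mult_right[OF this, of s]
  have Z: "((\<lambda>x. s * (gweight s x * sin (pi * (e - x)))) has_integral 0) {0..1}" by simp
  define f where "f = (\<lambda>x. Gamma (1 + x) * exp (- L * x) * sin (pi * (e - x)) - s * (gweight s x * sin (pi * (e - x))))"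
  have I: "(f has_integral (sin (pi * e) * Re (rot.laplace 0 L) - cos (pi * e) * Im (rot.laplace 0 L))) {0..1}"
    using has_integral_diff[OF laplace_rot_sin[of L e] Z] by (simp add: f_def)
  have bd: "norm (f x) \<le> M * (2 / real n)" if x: "x \<in> {0..1}" for x
  proof -
    define R where "R = Gamma (s - x) / Gamma s"
    have ni: "s \<notin> \<int>\<^sub>\<le>\<^sub>0" using s by (auto elim!: nonpos_Ints_cases)
    have G: "s * gweight s x = Gamma (1 + x) * R"
      unfolding gweight_def Gamma_plus1[OF ni] R_def using s by simp
    have ex: "exp (- L * x) = real n powr (- x)" using n by (simp add: L_def powr_def mult.commute)
    have eq: "f x = Gamma (1 + x) * ((real n powr (- x) - R) * sin (pi * (e - x)))"
      unfolding f_def ex mult.assoc[symmetric] G by (simp add: algebra_simps)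
    have R: "s powr (- x) \<le> R" "R \<le> (s - 1) powr (- x)"
      unfolding R_def using Gamma_ratio_bounds[OF s(1) x] by auto
    have "(real n + 1) powr (- x) \<le> s powr (- x)" using s e n x by (intro powr_mono2') (auto simp: s_def)
    moreover have "(s - 1) powr (- x) \<le> (real n - 1) powr (- x)" using s e n x by (intro powr_mono2') (auto simp: s_def)
    moreover have "(real n + 1) powr (- x) \<le> real n powr (- x)" using n x by (intro powr_mono2') auto
    moreover have "real n powr (- x) \<le> (real n - 1) powr (- x)" using n x by (intro powr_mono2') auto
    ultimately have "\<bar>real n powr (- x) - R\<bar> \<le> 2 / real n"
      using powr_neg_diff_le[OF n x] R by linarith
    hence "\<bar>real n powr (- x) - R\<bar> * \<bar>sin (pi * (e - x))\<bar> \<le> 2 / real n * 1"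
      by (intro mult_mono) auto
    moreover have "0 < Gamma (1 + x)" using x by simp
    ultimately show ?thesis
      unfolding eq real_norm_def abs_mult using M[OF x] by (intro mult_mono) auto
  qed
  have "norm (integral {0..1} f) \<le> integral {0..1} (\<lambda>x::real. M * (2 / real n))"
    using I bd by (intro integral_norm_bound_integral) auto
  thus ?thesis using integral_unique[OF I] by simp
qed

lemma rho_gap_le:
  assumes "n \<ge> 2"
  shows "\<rho> n - real n \<le> \<rho> 2 - 2"
  using assms
proof (induction n rule: dec_induct)
  case (step m)
  thus ?case using rho_gap_decreasing[of m] by linarith
qed simp

text \<open>For n \<ge> 2 the gaps are at most that of n = 2, hence below 1/2: the angle a stays in
  (0, pi/2), where arctan inverts tan, and cos a is bounded below by \<kappa>. The factor ln n in
  the error is the L by which the implicit equation is multiplied.\<close>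

lemma rho_gap_approx:
  assumes rho2: "\<rho> 2 < 5 / 2"
  shows "(\<lambda>n. \<rho> n - real n - eps_approx (ln (real n))) \<in> O(\<lambda>n. ln (real n) / real n)"
proof -
  obtain M where M: "M > 0" "\<And>x::real. x \<in> {0..1} \<Longrightarrow> Gamma (1 + x) \<le> M" by (rule Gamma_bounded) blast
  define \<kappa> where "\<kappa> = cos (pi * (\<rho> 2 - 2))"
  have e2: "0 < \<rho> 2 - 2" "\<rho> 2 - 2 < 1 / 2" using rho(1)[of 2] rho2 by auto
  have \<kappa>: "\<kappa> > 0" unfolding \<kappa>_def using e2 by (intro cos_gt_zero) auto
  have "((\<lambda>L. Re (of_real L * rot.laplace 0 L)) \<longlongrightarrow> 1) at_top"
    using inv_expansion_tendsto[OF cos_expansion] cos_sin_fps_values(1) by simp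
  hence "eventually (\<lambda>L. Re (of_real L * rot.laplace 0 L) > 1 / 2) at_top"
    by (intro order_tendstoD) auto
  moreover have "filterlim (\<lambda>n. ln (real n)) at_top sequentially" by real_asymp
  ultimately have ev: "eventually (\<lambda>n. Re (of_real (ln (real n)) * rot.laplace 0 (ln (real n))) > 1 / 2) sequentially"
    by (rule eventually_compose_filterlim)
  show ?thesis
  proof (rule bigoI)
    show "eventually (\<lambda>n. norm (\<rho> n - real n - eps_approx (ln (real n))) \<le> (4 * M / (\<kappa> * pi)) * norm (ln (real n) / real n)) sequentially"
      using ev eventually_ge_at_top[of 2]
    proof eventually_elim
      case (elim n)
      define L where "L = ln (real n)"
      define a where "a = pi * (\<rho> n - real n)"
      define C where "C = Re (of_real L * rot.laplace 0 L)"
      define S where "S = Im (of_real L * rot.laplace 0 L)"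
      have L: "L > 0" using elim by (simp add: L_def)
      have C: "C > 1 / 2" using elim by (simp add: C_def L_def)
      have a: "0 < a" "a \<le> pi * (\<rho> 2 - 2)" "pi * (\<rho> 2 - 2) < pi / 2"
        using rho(1)[of n] rho_gap_le[of n] e2 elim by (auto simp: a_def)
      have ca: "cos a \<ge> \<kappa>" unfolding \<kappa>_def using a by (intro cos_monotone_0_pi_le) auto
      have "\<bar>sin a * Re (rot.laplace 0 L) - cos a * Im (rot.laplace 0 L)\<bar> \<le> M * (2 / real n)"
        unfolding a_def L_def by (rule rho_implicit[OF M(2) elim(2)])
      hence "L * \<bar>sin a * Re (rot.laplace 0 L) - cos a * Im (rot.laplace 0 L)\<bar> \<le> L * (M * (2 / real n))"
        using L by (intro mult_left_mono) auto
      moreover have "L * \<bar>sin a * Re (rot.laplace 0 L) - cos a * Im (rot.laplace 0 L)\<bar> = \<bar>sin a * C - cos a * S\<bar>"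
      proof -
        have "sin a * C - cos a * S = L * (sin a * Re (rot.laplace 0 L) - cos a * Im (rot.laplace 0 L))"
          by (simp add: C_def S_def algebra_simps)
        thus ?thesis using L by (simp add: abs_mult)
      qed
      ultimately have main: "\<bar>sin a * C - cos a * S\<bar> \<le> 2 * M * L / real n" by (simp add: mult_ac)
      have "\<bar>a - arctan (S * inverse C)\<bar> = \<bar>arctan (tan a) - arctan (S * inverse C)\<bar>"
      proof -
        have "- (pi / 2) < a" "a < pi / 2" using a pi_gt_zero by linarith+
        thus ?thesis by (simp add: arctan_tan)
      qed
      also have "\<dots> \<le> \<bar>tan a - S * inverse C\<bar>" by (rule arctan_lipschitz)
      also have "tan a - S * inverse C = (sin a * C - cos a * S) / (cos a * C)"
        using ca \<kappa> C by (simp add: tan_def field_simps)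
      also have "\<bar>\<dots>\<bar> = \<bar>sin a * C - cos a * S\<bar> / (cos a * C)"
        using ca \<kappa> C by (simp add: abs_mult)
      also have "\<dots> \<le> (2 * M * L / real n) / (\<kappa> * (1 / 2))"
        using main ca \<kappa> C by (intro frac_le mult_mono mult_pos_pos) auto
      finally have "\<bar>a - arctan (S * inverse C)\<bar> / pi \<le> (2 * M * L / real n) / (\<kappa> * (1 / 2)) / pi"
        by (intro divide_right_mono) auto
      also have "\<dots> = (4 * M / (\<kappa> * pi)) * (L / real n)" by (simp add: mult_ac)
      finally have "\<bar>a - arctan (S * inverse C)\<bar> / pi \<le> (4 * M / (\<kappa> * pi)) * (L / real n)" .
      moreover have "\<rho> n - real n - eps_approx L = (a - arctan (S * inverse C)) / pi"
        by (simp add: eps_approx_def a_def S_def C_def diff_divide_distrib)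
      ultimately show ?case unfolding L_def[symmetric] using L by simp
    qed
  qed
qed

lemma rho_gap_expansion:
  assumes rho2: "\<rho> 2 < 5 / 2"
  shows "(\<lambda>n. \<rho> n - real n - (\<Sum>k<K. fps_nth eps_fps k / ln (real n) ^ k)) \<in> O(\<lambda>n. 1 / ln (real n) ^ K)"
proof -
  have lim: "filterlim (\<lambda>n. ln (real n)) at_top sequentially" by real_asymp
  \<comment> \<open>Every power of ln n is negligible against n, so this error does not affect any
    coefficient.\<close>
  have "(\<lambda>n::nat. ln (real n) / real n) \<in> O(\<lambda>n. 1 / ln (real n) ^ K)" by real_asymp
  with rho_gap_approx[OF rho2] have 1: "(\<lambda>n. \<rho> n - real n - eps_approx (ln (real n))) \<in> O(\<lambda>n. 1 / ln (real n) ^ K)"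
    by (rule landau_o.big_trans)
  have 2: "(\<lambda>n. eps_approx (ln (real n)) - (\<Sum>k<K. fps_nth eps_fps k / ln (real n) ^ k)) \<in> O(\<lambda>n. 1 / ln (real n) ^ K)"
    by (rule landau_o.big.compose[OF inv_expansion_imp_bigo[OF eps_approx_expansion] lim])
  have "(\<lambda>n. (\<rho> n - real n - eps_approx (ln (real n))) + (eps_approx (ln (real n)) - (\<Sum>k<K. fps_nth eps_fps k / ln (real n) ^ k)))
      = (\<lambda>n. \<rho> n - real n - (\<Sum>k<K. fps_nth eps_fps k / ln (real n) ^ k))"
    by (simp add: fun_eq_iff)
  with sum_in_bigo(1)[OF 1 2] show ?thesis by (simp only:)
qed

lemma zorder_gregory: "z \<in> zeros gregory \<Longrightarrow> z \<in> \<real> \<and> zorder gregory z = 1"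
  unfolding zeros_gregory using zorder_canon zseq_real by (auto simp: gregory_eq_canon)

end

theorem theorem1p2:
  shows
    "real_entire gregory \<and>
     growth_order gregory = 1 \<and>
     exponential_type gregory = ereal pi \<and>
     gregory \<in> cartwright_class \<and>
     (\<forall>\<theta>. pl_indicator gregory \<theta> = ereal (pi * \<bar>sin \<theta>\<bar>)) \<and>
     (\<forall>z\<in>zeros gregory. z \<in> \<real> \<and> zorder gregory z = 1) \<and>
     (\<exists>\<rho> :: nat \<Rightarrow> real.
        (\<forall>n\<ge>1. real n < \<rho> n \<and> \<rho> n < real n + 1) \<and>
        zeros gregory = {- of_nat n | n. n \<ge> 1} \<union> {of_real (\<rho> n) | n. n \<ge> 1} \<and>
        3 / 2 < \<rho> 1 \<and> \<rho> 1 < 2 \<and>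
        (\<forall>n\<ge>2. real n < \<rho> n \<and> \<rho> n < real n + 1 / 2) \<and>
        (\<forall>n\<ge>1. \<rho> n - real n > \<rho> (Suc n) - real (Suc n) \<and> \<rho> n - real n > 0) \<and>
        has_genus_one_product gregory (of_real euler_mascheroni) (zeros gregory) \<and>
        (\<forall>z. (\<lambda>n. (1 + z / of_nat (Suc n)) * (1 - z / of_real (\<rho> (Suc n)))) has_prod gregory z) \<and>
        locally_uniform_limit
          (\<lambda>N z. \<Prod>n=1..N. (1 + z / of_nat n) * (1 - z / of_real (\<rho> n))) gregory sequentially \<and>
        gregory \<in> laguerre_polya_class \<and>
        (\<lambda>n. 1 / real (Suc n) - 1 / \<rho> (Suc n)) sums euler_mascheroni \<and>
        (\<lambda>n. \<rho> n - real n -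
           (let L = ln (real n); \<gamma> = euler_mascheroni in
              1 / L - \<gamma> / L ^ 2 + \<gamma> ^ 2 / L ^ 3 - (\<gamma> ^ 3 + 6 * zeta 3) / L ^ 4
              + (\<gamma> ^ 4 + 24 * \<gamma> * zeta 3 + 7 * pi ^ 4 / 90) / L ^ 5))
          \<in> O(\<lambda>n. 1 / ln (real n) ^ 6) \<and>
        (\<exists>a :: nat \<Rightarrow> real. \<forall>K\<ge>1.
           (\<lambda>n. \<rho> n - real n - (\<Sum>k=1..K. a k / ln (real n) ^ k))
             \<in> O(\<lambda>n. 1 / ln (real n) ^ (K + 1))))"
proof -
  obtain \<rho> :: "nat \<Rightarrow> real" where
    \<rho>: "\<And>n. n \<ge> 1 \<Longrightarrow> real n < \<rho> n \<and> \<rho> n < real n + 1 \<and> gregory_real (\<rho> n) = 0"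
    and r: "3 / 2 < \<rho> 1" "\<rho> 2 < 5 / 2"
    using gregory_real_zeros_exist by blast
  interpret gregory_zeros \<rho>
    by unfold_locales (use \<rho> in auto)
  have five: "(\<lambda>n. \<rho> n - real n -
           (let L = ln (real n); \<gamma> = euler_mascheroni in
              1 / L - \<gamma> / L ^ 2 + \<gamma> ^ 2 / L ^ 3 - (\<gamma> ^ 3 + 6 * zeta 3) / L ^ 4
              + (\<gamma> ^ 4 + 24 * \<gamma> * zeta 3 + 7 * pi ^ 4 / 90) / L ^ 5))
          \<in> O(\<lambda>n. 1 / ln (real n) ^ 6)"
  proof -
    have "(\<Sum>k<6. fps_nth eps_fps k / L ^ k) = 1 / L - euler_mascheroni / L ^ 2 + euler_mascheroni ^ 2 / L ^ 3
        - (euler_mascheroni ^ 3 + 6 * zeta 3) / L ^ 4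
        + (euler_mascheroni ^ 4 + 24 * euler_mascheroni * zeta 3 + 7 * pi ^ 4 / 90) / L ^ 5" for L
    proof -
      have "(\<Sum>k<6. f k) = f 0 + f (Suc 0) + f 2 + f 3 + f 4 + f 5" for f :: "nat \<Rightarrow> real"
        by (simp add: numeral_eq_Suc)
      thus ?thesis by (simp only: eps_fps_values) (simp add: add_divide_distrib diff_divide_distrib)
    qed
    with rho_gap_expansion[OF r(2), of 6] show ?thesis by (simp add: Let_def)
  qed
  have all: "(\<lambda>n. \<rho> n - real n - (\<Sum>k=1..K. fps_nth eps_fps k / ln (real n) ^ k)) \<in> O(\<lambda>n. 1 / ln (real n) ^ (K + 1))" for K
  proof -
    have "(\<Sum>k<K+1. fps_nth eps_fps k / L ^ k) = (\<Sum>k=1..K. fps_nth eps_fps k / L ^ k)" for L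
    proof -
      \<comment> \<open>The constant coefficient of \<open>eps_fps\<close> vanishes, so the sum may
        start at k = 1.\<close>
      have "{..<K+1} = insert 0 {1..K}" by auto
      thus ?thesis by (simp add: eps_fps_values)
    qed
    with rho_gap_expansion[OF r(2), of "K + 1"] show ?thesis by simp
  qed
  have prod: "locally_uniform_limit (\<lambda>N z. \<Prod>n=1..N. (1 + z / of_nat n) * (1 - z / of_real (\<rho> n))) gregory sequentially"
    using locally_uniform_limit_pprod unfolding pprod_def[abs_def] gregory_eq_canon .
  have rho1: "\<rho> 1 < 2" using rho(2)[of 1] by simp
  have gap: "\<forall>n\<ge>1. \<rho> n - real n > \<rho> (Suc n) - real (Suc n) \<and> \<rho> n - real n > 0"
    using rho_gap_decreasing rho(1) by auto
  have ex: "\<exists>a :: nat \<Rightarrow> real. \<forall>K\<ge>1. (\<lambda>n. \<rho> n - real n - (\<Sum>k=1..K. a k / ln (real n) ^ k))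
             \<in> O(\<lambda>n. 1 / ln (real n) ^ (K + 1))"
    using all by blast
  show ?thesis
  proof (intro ex conjI exI[of _ \<rho>] allI impI)
    show "\<forall>z\<in>zeros gregory. z \<in> \<real> \<and> zorder gregory z = 1" using zorder_gregory by blast
    show "zeros gregory = {- of_nat n | n. n \<ge> 1} \<union> {of_real (\<rho> n) | n. n \<ge> 1}"
      unfolding zeros_gregory by (rule range_zseq)
    show "has_genus_one_product gregory (of_real euler_mascheroni) (zeros gregory)"
      using has_genus_one_product_canon unfolding zeros_gregory sigma_eq gregory_eq_canon[symmetric] .
    show "(\<lambda>n. (1 + z / of_nat (Suc n)) * (1 - z / of_real (\<rho> (Suc n)))) has_prod gregory z" for z
      unfolding gregory_eq_canon by (rule has_prod_canon)
    show "gregory \<in> laguerre_polya_class" unfolding gregory_eq_canon by (rule canon_laguerre_polya)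
    show "(\<lambda>n. 1 / real (Suc n) - 1 / \<rho> (Suc n)) sums euler_mascheroni"
      using sigma_sums unfolding sigma_eq .
    show "\<rho> n < real n + 1 / 2" if "n \<ge> 2" for n using rho_gap_le[OF that] r(2) by linarith
    show "\<rho> (Suc n) - real (Suc n) < \<rho> n - real n" "0 < \<rho> n - real n" if "n \<ge> 1" for n
      using gap that by blast+
  qed (use real_entire_gregory growth_order_gregory exponential_type_gregory gregory_cartwright
         pl_indicator_gregory prod five r(1) rho1 rho in auto)
qed

end
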